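(* Let $d\in\{2,3\}$, $L,M,N$ positive integers, $K:=dM+LN$. Let $\mathbf{A}\in\mathbb{R}^{dM\times dM}$, $\mathbf{C}\in\mathbb{R}^{LN\times LN}$ be symmetric positive definite, $\mathbf{B}\in\mathbb{R}^{dM\times LN}$ such that $\begin{pmatrix}\mathbf{A}&\mathbf{B}\\ \mathbf{B}^\top&\mathbf{C}\end{pmatrix}$ is positive definite, $\mathbf{D}=\operatorname{diag}(D_1\mathbf{I}_{L\times L},\dots,D_N\mathbf{I}_{L\times L})$ with $D_i>0$, $\mathbf{l}\in\mathbb{R}^{dM}$, and let $\mathbf{S}_i:\mathbb{R}^L\times\mathbb{R}^L\to\mathbb{R}^L$ ($i=1,\dots,N$) be semismooth. Define $\mathbf{F}:\mathbb{R}^{dM}\times\mathbb{R}^{LN}\times\mathbb{R}^{LN}\to\mathbb{R}^{K+LN}$ by $\mathbf{F}(\mathbf{a},\mathbf{b},\mathbf{c})=(\mathbf{A}\mathbf{a}+\mathbf{B}\mathbf{b}+\mathbf{l},\ \mathbf{B}^\top\mathbf{a}+\mathbf{C}\mathbf{b}+\mathbf{D}\mathbf{c},\ \mathbf{S}_1(\mathbf{b}_1,\mathbf{c}_1),\dots,\mathbf{S}_N(\mathbf{b}_N,\mathbf{c}_N))$, with $\mathbf{b}_i=(b_{L(i-1)+1},\dots,b_{Li})^\top$ and $\mathbf{c}_i$ analogously. Assume $\mathbf{x}^*=(\mathbf{a}^*,\mathbf{b}^*,\mathbf{c}^* )$ is a solution of $\mathbf{F}(\mathbf{x}^* )=\mathbf{0}$.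 Every $\mathbf{H}\in\partial\mathbf{F}(\mathbf{x}^* )$ has the form $\begin{pmatrix}\mathbf{A}&\mathbf{B}&\mathbf{0}\\ \mathbf{B}^\top&\mathbf{C}&\mathbf{D}\\ \mathbf{0}&\mathbf{X}&\mathbf{Y}\end{pmatrix}$ with $\mathbf{X}=\operatorname{diag}(\mathbf{X}_1,\dots,\mathbf{X}_N)$, $\mathbf{Y}=\operatorname{diag}(\mathbf{Y}_1,\dots,\mathbf{Y}_N)$, $\mathbf{X}_i,\mathbf{Y}_i\in\mathbb{R}^{L\times L}$; suppose that for every such $\mathbf{H}$ the pair $(\mathbf{X}_i,\mathbf{Y}_i)$ is eigencomplementary for all $i\in\{1,\dots,N\}$. Then the semismooth Newton method — starting from $\mathbf{x}^{(0)}$, choose any $\mathbf{H}_k\in\partial\mathbf{F}(\mathbf{x}^{(k)})$, solve $\mathbf{H}_k\Delta\mathbf{x}^{(k)}=-\mathbf{F}(\mathbf{x}^{(k)})$ and set $\mathbf{x}^{(k+1)}=\mathbf{x}^{(k)}+\Delta\mathbf{x}^{(k)}$ — is well-defined for all starting points in a neighborhood of $\mathbf{x}^*$ and the iterates converge superlinearly to $\mathbf{x}^*$. Moreover, if the functions $\mathbf{S}_i$ are $\alpha$-order semismooth with $\alpha\in(0,1]$, then the convergence is of order $1+\alpha$.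
   Context: Semismoothness and $\alpha$-order semismoothness are in the sense of Qi and Sun (1993): $G$ is semismooth at $x$ if it is locally Lipschitz near $x$ and $\lim_{V\in\partial G(x+th'),\,h'\to h,\,t\downarrow0}Vh'$ exists for all $h$; $\alpha$-order semismooth if moreover $Vh-G'(x;h)=O(|h|^{1+\alpha})$ for $V\in\partial G(x+h)$, $h\to0$. $\partial\mathbf{F}(\mathbf{x})$ is the Clarke subdifferential: the convex hull of all limits $\lim_n\nabla\mathbf{F}(\mathbf{x}_n)$ with $\mathbf{x}_n\to\mathbf{x}$ and $\mathbf{F}$ differentiable at each $\mathbf{x}_n$. A pair $(\mathbf{F},\mathbf{G})$ of real symmetric $L\times L$ matrices is called eigencomplementary if $\mathbf{F}$ is negative semi-definite, $\mathbf{G}$ is positive semi-definite, they have a common basis of eigenvectors of $\mathbb{R}^L$, and, if both are singular, additionally $\bigoplus_{\xi\in\sigma(\mathbf{F}),\,\xi<0}\operatorname{Eig}_{\mathbf{F}}(\xi)=\operatorname{Eig}_{\mathbf{G}}(0)$ ($\sigma$ = spectrum, $\operatorname{Eig}$ = eigenspace). "Well-defined in a neighborhood" means there is a neighborhood $U$ of $\mathbf{x}^*$ such that for every $\mathbf{x}^{(0)}\in U$ and every choice of $\mathbf{H}_k$, all $\mathbf{H}_k$ are invertible and the iterates converge to $\mathbf{x}^*$; superlinear means $|\mathbf{x}^{(k+1)}-\mathbf{x}^*|=o(|\mathbf{x}^{(k)}-\mathbf{x}^*|)$, order $1+\alpha$ means $|\mathbf{x}^{(k+1)}-\mathbf{x}^*|=O(|\mathbf{x}^{(k)}-\mathbf{x}^*|^{1+\alpha})$.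 *)

theory Defs
  imports "HOL-Analysis.Analysis"
begin

definition clarke_jac ::
  "('a::euclidean_space \<Rightarrow> 'b::euclidean_space) \<Rightarrow> 'a \<Rightarrow> ('a \<Rightarrow>\<^sub>L 'b) set" where
  "clarke_jac G x = convex hull
     {V. \<exists>xs Df. xs \<longlonglongrightarrow> x \<and>
           (\<forall>n. (G has_derivative blinfun_apply (Df n)) (at (xs n))) \<and>
           Df \<longlonglongrightarrow> V}"

definition locally_lipschitz_near ::
  "('a::euclidean_space \<Rightarrow> 'b::euclidean_space) \<Rightarrow> 'a \<Rightarrow> bool" where
  "locally_lipschitz_near G x \<longleftrightarrow>
     (\<exists>e>0. \<exists>K. \<forall>y\<in>ball x e. \<forall>z\<in>ball x e. norm (G y - G z) \<le> K * norm (y - z))"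

text \<open>Semismoothness in the sense of Qi and Sun (1993).\<close>
definition semismooth_at ::
  "('a::euclidean_space \<Rightarrow> 'b::euclidean_space) \<Rightarrow> 'a \<Rightarrow> bool" where
  "semismooth_at G x \<longleftrightarrow> locally_lipschitz_near G x \<and>
     (\<forall>h. \<exists>l. \<forall>\<epsilon>>0. \<exists>\<delta>>0. \<forall>t h' V.
         0 < t \<and> t < \<delta> \<and> norm (h' - h) < \<delta> \<and> V \<in> clarke_jac G (x + t *\<^sub>R h')
           \<longrightarrow> norm (blinfun_apply V h' - l) < \<epsilon>)"

definition dir_deriv ::
  "('a::euclidean_space \<Rightarrow> 'b::euclidean_space) \<Rightarrow> 'a \<Rightarrow> 'a \<Rightarrow> 'b" where
  "dir_deriv G x h = Lim (at_right (0::real)) (\<lambda>t. (1 / t) *\<^sub>R (G (x + t *\<^sub>R h) - G x))"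

definition semismooth_order_at ::
  "real \<Rightarrow> ('a::euclidean_space \<Rightarrow> 'b::euclidean_space) \<Rightarrow> 'a \<Rightarrow> bool" where
  "semismooth_order_at \<alpha> G x \<longleftrightarrow> semismooth_at G x \<and>
     (\<exists>C \<delta>. \<delta> > 0 \<and> (\<forall>h V. h \<noteq> 0 \<and> norm h < \<delta> \<and> V \<in> clarke_jac G (x + h)
        \<longrightarrow> norm (blinfun_apply V h - dir_deriv G x h) \<le> C * norm h powr (1 + \<alpha>)))"

definition sym_pos_def :: "real^'n^'n \<Rightarrow> bool" where
  "sym_pos_def A \<longleftrightarrow> transpose A = A \<and> (\<forall>x. x \<noteq> 0 \<longrightarrow> 0 < x \<bullet> (A *v x))"

definition eigencomplementary :: "real^'l^'l \<Rightarrow> real^'l^'l \<Rightarrow> bool" where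
  "eigencomplementary F G \<longleftrightarrow>
     transpose F = F \<and> transpose G = G \<and>
     (\<forall>v. v \<bullet> (F *v v) \<le> 0) \<and>
     (\<forall>v. 0 \<le> v \<bullet> (G *v v)) \<and>
     (\<exists>E. independent E \<and> span E = UNIV \<and>
          (\<forall>v\<in>E. (\<exists>\<xi>. F *v v = \<xi> *\<^sub>R v) \<and> (\<exists>\<mu>. G *v v = \<mu> *\<^sub>R v))) \<and>
     (\<not> invertible F \<and> \<not> invertible G \<longrightarrow>
        span (\<Union>{{v. F *v v = \<xi> *\<^sub>R v} | \<xi>. \<xi> < 0}) = {v. G *v v = 0})"

text \<open>Vectors in R^{LN} are indexed by pairs (i,j), i the block (1..N), j the
  position within the block (1..L); block i of v:\<close>
definition blk :: "real^('n::finite \<times> 'l::finite) \<Rightarrow> 'n \<Rightarrow> real^'l" where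
  "blk v i = (\<chi> j. v $ (i, j))"

definition diag_blocks :: "('n::finite \<Rightarrow> real) \<Rightarrow> real^('n \<times> 'l::finite)^('n \<times> 'l)" where
  "diag_blocks Dv = (\<chi> p q. if p = q then Dv (fst p) else 0)"

definition sys_F ::
  "real^'a::finite^'a \<Rightarrow> real^('n::finite \<times> 'l::finite)^'a \<Rightarrow> real^('n \<times> 'l)^('n \<times> 'l) \<Rightarrow> real^('n \<times> 'l)^('n \<times> 'l)
   \<Rightarrow> real^'a \<Rightarrow> ('n \<Rightarrow> ((real^'l) \<times> (real^'l)) \<Rightarrow> real^'l)
   \<Rightarrow> ((real^'a) \<times> (real^('n \<times> 'l)) \<times> (real^('n \<times> 'l))) \<Rightarrow> ((real^'a) \<times> (real^('n \<times> 'l)) \<times> (real^('n \<times> 'l)))" where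
  "sys_F A B C D l S = (\<lambda>(a, b, c).
     (A *v a + B *v b + l,
      transpose B *v a + C *v b + D *v c,
      \<chi> p. S (fst p) (blk b (fst p), blk c (fst p)) $ snd p))"

text \<open>The blocks X_i and Y_i of a (generalized) Jacobian H: the (3,2) and (3,3)
  blocks of H are X = diag(X_1..X_N), Y = diag(Y_1..Y_N).\<close>
definition Xblk :: "((real^'a::finite) \<times> (real^('n::finite \<times> 'l::finite)) \<times> (real^('n \<times> 'l))) \<Rightarrow>\<^sub>L ((real^'a) \<times> (real^('n \<times> 'l)) \<times> (real^('n \<times> 'l)))
    \<Rightarrow> 'n \<Rightarrow> real^'l^'l" where
  "Xblk H i = (\<chi> j k. snd (snd (blinfun_apply H (0, axis (i, k) 1, 0))) $ (i, j))"

definition Yblk :: "((real^'a::finite) \<times> (real^('n::finite \<times> 'l::finite)) \<times> (real^('n \<times> 'l))) \<Rightarrow>\<^sub>L ((real^'a) \<times> (real^('n \<times> 'l)) \<times> (real^('n \<times> 'l)))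
    \<Rightarrow> 'n \<Rightarrow> real^'l^'l" where
  "Yblk H i = (\<chi> j k. snd (snd (blinfun_apply H (0, 0, axis (i, k) 1))) $ (i, j))"

end

theory Submission
  imports Defs
begin

text \<open>Near a solution, semismoothness makes \<open>F x - H (x - x*)\<close> small compared with \<open>x - x*\<close> for every
  \<open>H\<close> in the generalized Jacobian at \<open>x\<close>. If moreover all these \<open>H\<close> are uniformly invertible, one
  Newton step contracts the distance to the solution by this ratio up to a constant.

  The residual estimate needs a mean value inequality in which only points of differentiability are
  tested. It follows from Rademacher's theorem by averaging over small balls. Rademacher's theorem in
  turn is reduced to the real line, where a Lipschitz function plus a steep linear one is the
  distribution function of a measure with a density, so that Lebesgue's differentiation theorem applies.

  Invertibility holds at the solution because an eigencomplementary pair satisfies \<open>b \<bullet> c \<ge> 0\<close>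
  whenever \<open>X b + Y c = 0\<close>, and it persists nearby, uniformly, by compactness and upper
  semicontinuity of the Clarke Jacobian.\<close>

section \<open>Rademacher's theorem\<close>

text \<open>A segment starting at the solution may miss every point of differentiability, so
  increments of \<open>F\<close> cannot be recovered by integrating derivatives along it. Averaging
  over parallel segments lets derivatives at nearby points control increments all the same. A second
  obstacle is that semismoothness restrains a derivative at \<open>x + s *\<^sub>R k\<close> only
  through its value on the radial direction \<open>k\<close>, whereas the mean value inequality
  tests one fixed direction near a whole segment. Cutting off a short initial piece reconciles the
  two: away from \<open>x\<close>, nearby points have nearby radial directions.

  \<open>F\<close> is never shown to be semismooth. Its affine rows have zero residual, so the
  residual of \<open>F\<close> is assembled from those of the maps \<open>S i\<close>, each taken
  with the block \<open>block_jac i H\<close> of the same \<open>H\<close>. Eigencomplementarity is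
  an algebraic condition at the solution that nearby Jacobians may violate; what survives the
  perturbation is its quantitative consequence, a lower bound \<open>c * norm v\<close> for the norm
  of \<open>H v\<close>.\<close>

lemma lipschitz_right_quotient_AE:
  fixes f :: "real \<Rightarrow> real"
  assumes lip: "L-lipschitz_on UNIV f"
  shows "AE t in lborel. convergent (\<lambda>n. real (Suc n) * (f (t + 1 / real (Suc n)) - f t))"
proof -
  have L0: "0 \<le> L" using lip by (rule lipschitz_on_nonneg)
  have lipf: "\<bar>f x - f y\<bar> \<le> L * \<bar>x - y\<bar>" for x y
    using lipschitz_onD[OF lip, of x y] by (simp add: dist_real_def)
  \<comment> \<open>The added slope exceeds \<open>L\<close> by 1, so \<open>h\<close> grows at rate
    at least 1: it is a bijection of the line with 1-Lipschitz inverse \<open>g\<close>. Being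
    Lipschitz itself, it maps null sets to null sets.\<close>
  define h where "h t = f t + (L + 1) * t" for t
  have h_lower: "y - x \<le> h y - h x" if "x \<le> y" for x y
    using lipf[of x y] that by (simp add: h_def algebra_simps abs_if split: if_splits)
  have h_upper: "\<bar>h y - h x\<bar> \<le> (2 * L + 1) * \<bar>y - x\<bar>" for x y
  proof -
    have "\<bar>h y - h x\<bar> \<le> \<bar>f y - f x\<bar> + \<bar>(L+1) * (y - x)\<bar>" by (simp add: h_def algebra_simps)
    also have "\<bar>(L+1) * (y - x)\<bar> = (L+1) * \<bar>y - x\<bar>" using L0 by (simp add: abs_mult)
    finally show ?thesis using lipf[of y x] by (simp add: algebra_simps)
  qed
  have h_cont: "continuous_on UNIV h"
    unfolding h_def using lipschitz_on_continuous_on[OF lip] by (intro continuous_intros) auto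
  have h_inj: "inj h"
  proof (rule injI)
    fix x y assume "h x = h y"
    then show "x = y" using h_lower[of x y] h_lower[of y x] by linarith
  qed
  have h_surj: "\<exists>x. h x = c" for c
  proof -
    define a where "a = - \<bar>c - h 0\<bar>" 
    define b where "b = \<bar>c - h 0\<bar>"
    have "h a \<le> c" using h_lower[of a 0] by (simp add: a_def)
    moreover have "c \<le> h b" using h_lower[of 0 b] by (simp add: b_def)
    moreover have "a \<le> b" by (simp add: a_def b_def)
    ultimately show ?thesis
      using IVT'[of h a c b] continuous_on_subset[OF h_cont] by auto
  qed
  define g where "g = inv h"
  have gh[simp]: "g (h x) = x" for x using h_inj by (simp add: g_def)
  have hg[simp]: "h (g x) = x" for x using h_surj by (metis g_def f_inv_into_f rangeI)
  have "1-lipschitz_on UNIV g"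
  proof (rule lipschitz_onI)
    fix x y :: real
    show "dist (g x) (g y) \<le> 1 * dist x y"
      using h_lower[of "g x" "g y"] h_lower[of "g y" "g x"]
      by (cases "g x \<le> g y") (auto simp: dist_real_def)
  qed simp
  then have g_meas[measurable]: "g \<in> borel_measurable borel"
    by (intro borel_measurable_continuous_onI lipschitz_on_continuous_on)
  have vim: "g -` A = h ` A" for A
    by (auto simp: image_iff) (metis hg)
  \<comment> \<open>\<mu> gives a set the Lebesgue measure of its image under \<open>h\<close>, so
    an interval gets the increment of \<open>h\<close>. A density of \<mu> is therefore the
    candidate for the derivative of \<open>h\<close>.\<close>
  define \<mu> where "\<mu> = distr lborel borel g"
  have "absolutely_continuous lborel \<mu>"
    unfolding absolutely_continuous_def
  proof
    fix A :: "real set" assume A: "A \<in> null_sets lborel"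
    then have "negligible A" "A \<in> sets borel"
      by (auto simp: negligible_iff_null_sets null_sets_completionI)
    have "negligible (h ` A)"
    proof (rule negligible_locally_Lipschitz_image)
      fix x assume "x \<in> A"
      show "\<exists>T B. open T \<and> x \<in> T \<and> (\<forall>y\<in>A \<inter> T. norm (h y - h x) \<le> B * norm (y - x))"
        using h_upper by (intro exI[of _ UNIV] exI[of _ "2*L+1"]) auto
    qed (use \<open>negligible A\<close> in auto)
    moreover have "h ` A \<in> sets borel"
      using measurable_sets[OF g_meas \<open>A \<in> sets borel\<close>] by (simp add: vim)
    ultimately have "emeasure lborel (h ` A) = 0"
      by (simp add: negligible_iff_null_sets null_sets_def)
    then show "A \<in> null_sets \<mu>"
      using \<open>A \<in> sets borel\<close> by (auto simp: \<mu>_def null_sets_def emeasure_distr vim)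
  qed
  then obtain k where k[measurable]: "k \<in> borel_measurable lborel" and dk: "density lborel k = \<mu>"
    using sigma_finite_measure.Radon_Nikodym[OF sigma_finite_lborel, of \<mu>] by (auto simp: \<mu>_def)
  have nnk: "(\<integral>\<^sup>+x. k x * indicator {a..b} x \<partial>lborel) = ennreal (h b - h a)" if "a \<le> b" for a b
  proof -
    have "(\<integral>\<^sup>+x. k x * indicator {a..b} x \<partial>lborel) = emeasure \<mu> {a..b}"
      unfolding dk[symmetric] by (subst emeasure_density) auto
    also have "\<dots> = emeasure lborel (h ` {a..b})"
      by (simp add: \<mu>_def emeasure_distr vim)
    also have "h ` {a..b} = {h a..h b}"
    proof (intro equalityI subsetI)
      fix y assume "y \<in> h ` {a..b}"
      then show "y \<in> {h a..h b}" using h_lower by fastforce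
    next
      fix y assume y: "y \<in> {h a..h b}"
      have "g y \<in> {a..b}"
        using h_lower[of "g y" a] h_lower[of b "g y"] y by fastforce
      then show "y \<in> h ` {a..b}" by (metis hg imageI)
    qed
    also have "emeasure lborel {h a..h b} = ennreal (h b - h a)"
      using h_lower[OF that] that by simp
    finally show ?thesis .
  qed
  \<comment> \<open>The density takes extended values. Finite mass of the intervals from
    \<open>-n\<close> to \<open>n\<close> makes it finite almost everywhere, so that passing to the
    real function \<open>k'\<close> changes no integral.\<close>
  have "AE x in lborel. \<forall>n::nat. k x * indicator {-real n..real n} x \<noteq> \<infinity>"
    unfolding AE_all_countable
    by (intro allI nn_integral_PInf_AE) (auto simp: nnk)
  then have kfin: "AE x in lborel. k x \<noteq> \<infinity>"
  proof eventually_elim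
    fix x assume *: "\<forall>n::nat. k x * indicator {-real n..real n} x \<noteq> \<infinity>"
    obtain n :: nat where "\<bar>x\<bar> \<le> real n" using real_arch_simple by blast
    then show "k x \<noteq> \<infinity>" using *[rule_format, of n] by (auto simp: indicator_def abs_le_iff)
  qed
  define k' where "k' x = enn2real (k x)" for x
  have k'[measurable]: "k' \<in> borel_measurable borel" unfolding k'_def using k by simp
  have int: "(k' has_integral (h b - h a)) {a..b}" if "a \<le> b" for a b
  proof -
    have "(\<integral>\<^sup>+x. ennreal (k' x * indicator {a..b} x) \<partial>lborel) = (\<integral>\<^sup>+x. k x * indicator {a..b} x \<partial>lborel)"
      using kfin by (intro nn_integral_cong_AE) (auto simp: k'_def indicator_def top.not_eq_extremum)
    then have "((\<lambda>x. k' x * indicator {a..b} x) has_integral (h b - h a)) UNIV"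
      using nnk[OF that] h_lower[OF that] that
      by (intro nn_integral_has_integral) (auto simp: k'_def)
    moreover have "(\<lambda>x. k' x * indicator {a..b} x) = (\<lambda>x. if x \<in> {a..b} then k' x else 0)"
      by (auto simp: indicator_def)
    ultimately show ?thesis by (simp only: has_integral_restrict_UNIV)
  qed
  have "k' integrable_on cbox a b" for a b
    using int[of a b] by (cases "a \<le> b") auto
  \<comment> \<open>The cubes of this differentiation theorem have \<open>x\<close> as their lower
    corner, which on the line yields right-hand quotients.\<close>
  then obtain N where N: "negligible N"
    and Nlim: "\<And>x e. \<lbrakk>x \<notin> N; 0 < e\<rbrakk> \<Longrightarrow>
      \<exists>d>0. \<forall>s. 0 < s \<and> s < d \<longrightarrow> norm (integral (cbox x (x + s *\<^sub>R One)) k' /\<^sub>R s ^ DIM(real) - k' x) < e"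
    using integrable_ccontinuous_explicit[of k'] by metis
  have "AE x in lebesgue. x \<notin> N"
    using N by (simp add: negligible_iff_null_sets AE_not_in)
  then have "AE x in lborel. x \<notin> N"
    using N by (simp add: AE_completion_iff)
  then show ?thesis
  proof eventually_elim
    fix x assume x: "x \<notin> N"
    have "(\<lambda>n. real (Suc n) * (h (x + 1 / real (Suc n)) - h x)) \<longlonglongrightarrow> k' x"
    proof (rule LIMSEQ_I)
      fix e :: real assume "0 < e"
      from Nlim[OF x this] obtain d where d: "d > 0"
        and dd: "\<And>s. 0 < s \<Longrightarrow> s < d \<Longrightarrow> \<bar>inverse s * (h (x + s) - h x) - k' x\<bar> < e"
        using int[THEN integral_unique, of x "x + _"] by force
      from d obtain n0 where n0: "1 / real (Suc n0) < d" using nat_approx_posE by blast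
      show "\<exists>no. \<forall>n\<ge>no. norm (real (Suc n) * (h (x + 1 / real (Suc n)) - h x) - k' x) < e"
      proof (intro exI allI impI)
        fix n assume "n0 \<le> n"
        then have "1 / real (Suc n) \<le> 1 / real (Suc n0)" by (simp add: frac_le)
        then have "1 / real (Suc n) < d" using n0 by linarith
        from dd[OF _ this] show "norm (real (Suc n) * (h (x + 1 / real (Suc n)) - h x) - k' x) < e"
          by (simp add: inverse_eq_divide)
      qed
    qed
    then have "(\<lambda>n. real (Suc n) * (h (x + 1 / real (Suc n)) - h x) - (L + 1)) \<longlonglongrightarrow> k' x - (L+1)"
      by (intro tendsto_intros)
    moreover have "real (Suc n) * (h (x + 1 / real (Suc n)) - h x) - (L + 1)
        = real (Suc n) * (f (x + 1 / real (Suc n)) - f x)" for n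
      by (simp add: h_def field_simps)
    ultimately show "convergent (\<lambda>n. real (Suc n) * (f (x + 1 / real (Suc n)) - f x))"
      by (auto simp: convergent_def)
  qed
qed

section \<open>Difference quotients along a fixed direction\<close>

definition rquot :: "('a::real_normed_vector \<Rightarrow> 'b::real_normed_vector) \<Rightarrow> 'a \<Rightarrow> 'a \<Rightarrow> nat \<Rightarrow> 'b" where
  "rquot g v y n = real (Suc n) *\<^sub>R (g (y + (1 / real (Suc n)) *\<^sub>R v) - g y)"

text \<open>The quotients are sampled at the steps \<open>1 / Suc n\<close> because a sequential
  limit is measurable. Where they diverge the value is unspecified; the function is total and
  measurable all the same.\<close>

definition rderiv :: "('a::real_normed_vector \<Rightarrow> 'b::real_normed_vector) \<Rightarrow> 'a \<Rightarrow> 'a \<Rightarrow> 'b" where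
  "rderiv g v y = lim (rquot g v y)"

lemma lipschitz_norm_diff_le:
  fixes g :: "'a::real_normed_vector \<Rightarrow> 'b::real_normed_vector"
  assumes "L-lipschitz_on UNIV g"
  shows "norm (g x - g y) \<le> L * norm (x - y)"
  using lipschitz_onD[OF assms, of x y] by (simp add: dist_norm)

lemma norm_rquot_le:
  assumes "L-lipschitz_on UNIV g"
  shows "norm (rquot g v y n) \<le> L * norm v"
proof -
  have "norm (rquot g v y n) = real (Suc n) * norm (g (y + (1 / real (Suc n)) *\<^sub>R v) - g y)"
    by (simp add: rquot_def)
  also have "\<dots> \<le> real (Suc n) * (L * norm ((1 / real (Suc n)) *\<^sub>R v))"
    using lipschitz_norm_diff_le[OF assms, of "y + (1 / real (Suc n)) *\<^sub>R v" y]
    by (intro mult_left_mono) auto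
  also have "\<dots> = L * norm v" by simp
  finally show ?thesis .
qed

lemma borel_measurable_lipschitz:
  fixes g :: "'a::euclidean_space \<Rightarrow> 'b::euclidean_space"
  assumes "L-lipschitz_on UNIV g"
  shows "g \<in> borel_measurable borel"
  using assms by (intro borel_measurable_continuous_onI lipschitz_on_continuous_on)

lemma borel_measurable_rquot:
  fixes g :: "'a::euclidean_space \<Rightarrow> 'b::euclidean_space"
  assumes "L-lipschitz_on UNIV g"
  shows "(\<lambda>y. rquot g v y n) \<in> borel_measurable borel"
proof -
  note [measurable] = borel_measurable_lipschitz[OF assms]
  show ?thesis unfolding rquot_def by measurable
qed

lemma borel_measurable_rderiv:
  fixes g :: "'a::euclidean_space \<Rightarrow> 'b::euclidean_space"
  assumes "L-lipschitz_on UNIV g"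
  shows "rderiv g v \<in> borel_measurable borel"
proof -
  note [measurable] = borel_measurable_rquot[OF assms]
  have "(\<lambda>y. lim (\<lambda>n. rquot g v y n)) \<in> borel_measurable borel" by measurable
  then show ?thesis by (simp add: rderiv_def[abs_def])
qed

lemma rquot_tendsto_rderiv:
  "convergent (rquot g v y) \<Longrightarrow> rquot g v y \<longlonglongrightarrow> rderiv g v y"
  unfolding rderiv_def by (rule convergent_LIMSEQ_iff[THEN iffD1])

lemma AE_lborel_translate:
  fixes c :: "'a::euclidean_space"
  assumes [measurable]: "{x. P x} \<in> sets borel" and "AE x in lborel. P (c + x)"
  shows "AE x in lborel. P x"
proof -
  have "(AE x in distr lborel borel ((+) c). P x) \<longleftrightarrow> (AE x in lborel. P (c + x))"
    by (rule AE_distr_iff) auto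
  then show ?thesis using assms(2) unfolding lborel_distr_plus by blast
qed

text \<open>Tonelli on the lines parallel to \<open>v\<close>, where translation invariance replaces
  a rotation moving \<open>v\<close> to a coordinate axis.\<close>

lemma convergent_rquot_AE_real:
  fixes g :: "'a::euclidean_space \<Rightarrow> real"
  assumes lip: "L-lipschitz_on UNIV g"
  shows "AE y in lborel. convergent (rquot g v y)"
proof -
  note [measurable] = borel_measurable_lipschitz[OF lip]
  have line: "AE s in lborel. convergent (rquot g v (y + s *\<^sub>R v))" for y
  proof -
    have "(L * norm v)-lipschitz_on UNIV (\<lambda>s::real. g (y + s *\<^sub>R v))"
    proof (rule lipschitz_onI)
      fix s t :: real
      show "dist (g (y + s *\<^sub>R v)) (g (y + t *\<^sub>R v)) \<le> L * norm v * dist s t"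
        using lipschitz_norm_diff_le[OF lip, of "y + s *\<^sub>R v" "y + t *\<^sub>R v"]
        by (simp add: dist_norm algebra_simps flip: scaleR_diff_left)
    qed (use lipschitz_on_nonneg[OF lip] in simp)
    from lipschitz_right_quotient_AE[OF this] show ?thesis
      by (simp add: rquot_def[abs_def] scaleR_add_left add.assoc del: of_nat_Suc)
  qed
  have "{p \<in> space (lborel \<Otimes>\<^sub>M lborel). convergent (rquot g v (fst p + snd p *\<^sub>R v))}
      \<in> sets ((lborel :: 'a measure) \<Otimes>\<^sub>M (lborel :: real measure))"
    unfolding Cauchy_convergent_iff[symmetric] rquot_def[abs_def]
    by measurable
  from lborel_pair.AE_commute[OF this] line
  have "AE s in lborel. AE y in lborel. convergent (rquot g v (y + s *\<^sub>R v))" by simp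
  \<comment> \<open>For a nonzero measure, what holds almost everywhere holds somewhere. One good
    \<open>s\<close> is enough, since translating back by \<open>s *\<^sub>R v\<close> preserves
    null sets.\<close>
  moreover have "ae_filter (lborel :: real measure) \<noteq> bot"
    by (simp add: ae_filter_eq_bot_iff)
  ultimately obtain s where s: "AE y in lborel. convergent (rquot g v (y + s *\<^sub>R v))"
    using eventually_happens' by blast
  have meas: "{y. convergent (rquot g v y)} \<in> sets borel"
  proof -
    have "{y \<in> space borel. Cauchy (\<lambda>n. rquot g v y n)} \<in> sets borel"
      unfolding rquot_def[abs_def] by measurable
    then show ?thesis by (simp add: Cauchy_convergent_iff)
  qed
  show ?thesis
    by (rule AE_lborel_translate[OF meas, of "s *\<^sub>R v"]) (use s in \<open>simp add: add.commute\<close>)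
qed

text \<open>The Lipschitz bound \<open>L * norm v\<close> dominates all quotients at once and is
  integrable over a set of finite measure.\<close>

lemma tendsto_integral_rquot:
  fixes g :: "'a::euclidean_space \<Rightarrow> 'b::euclidean_space"
  assumes lip: "L-lipschitz_on UNIV g" and conv: "AE y in lborel. convergent (rquot g v y)"
    and Q[measurable]: "Q \<in> sets borel" and fin: "emeasure lborel Q < \<infinity>"
  shows "set_integrable lborel Q (rderiv g v)"
    and "(\<lambda>n. LINT y:Q|lborel. rquot g v y n) \<longlonglongrightarrow> (LINT y:Q|lborel. rderiv g v y)"
proof -
  note [measurable] = borel_measurable_rderiv[OF lip] borel_measurable_rquot[OF lip]
  let ?w = "\<lambda>y. L * norm v * indicator Q y"
  have w: "integrable lborel ?w" using fin by simp
  have lim: "AE y in lborel. (\<lambda>n. indicator Q y *\<^sub>R rquot g v y n) \<longlonglongrightarrow> indicator Q y *\<^sub>R rderiv g v y"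
    using conv by eventually_elim (intro tendsto_intros rquot_tendsto_rderiv)
  have bd: "AE y in lborel. norm (indicator Q y *\<^sub>R rquot g v y n) \<le> ?w y" for n
    using norm_rquot_le[OF lip] by (auto simp: indicator_def)
  show "set_integrable lborel Q (rderiv g v)"
    unfolding set_integrable_def
    by (rule integrable_dominated_convergence[where f = "\<lambda>y. indicator Q y *\<^sub>R rderiv g v y", OF _ _ w lim bd]) measurable
  show "(\<lambda>n. LINT y:Q|lborel. rquot g v y n) \<longlonglongrightarrow> (LINT y:Q|lborel. rderiv g v y)"
    unfolding set_lebesgue_integral_def
    by (rule integral_dominated_convergence[OF _ _ w lim bd]) measurable
qed

text \<open>Moving along \<open>v + w\<close> is moving along \<open>v\<close> and then along
  \<open>w\<close> from the point reached, which changes with \<open>n\<close>.\<close>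

lemma rquot_add:
  "rquot g (v + w) y n = rquot g w ((1 / real (Suc n)) *\<^sub>R v + y) n + rquot g v y n"
  by (simp add: rquot_def algebra_simps del: of_nat_Suc)

text \<open>At almost every \<open>x\<close> the value \<open>u x\<close> is the limit of averages
  over shrinking cubes at \<open>x\<close>, and these averages all vanish.\<close>

lemma AE_eq_0_if_box_integrals_0:
  fixes u :: "'a::euclidean_space \<Rightarrow> 'b::euclidean_space"
  assumes int: "\<And>a b. (u has_integral 0) (cbox a b)"
  shows "AE x in lborel. u x = 0"
proof -
  have "u integrable_on cbox a b" for a b using int by blast
  then obtain N where N: "negligible N"
    and Nlim: "\<And>x e. \<lbrakk>x \<notin> N; 0 < e\<rbrakk> \<Longrightarrow>
      \<exists>d>0. \<forall>h. 0 < h \<and> h < d \<longrightarrow> norm (integral (cbox x (x + h *\<^sub>R One)) u /\<^sub>R h ^ DIM('a) - u x) < e"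
    using integrable_ccontinuous_explicit[of u] by metis
  have "AE x in lebesgue. x \<notin> N"
    using N by (simp add: negligible_iff_null_sets AE_not_in)
  then have "AE x in lborel. x \<notin> N"
    using N by (simp add: AE_completion_iff)
  then show ?thesis
  proof eventually_elim
    fix x assume x: "x \<notin> N"
    have "norm (u x) < e" if e: "0 < e" for e
    proof -
      obtain d where "d > 0" and d: "\<And>h. 0 < h \<Longrightarrow> h < d \<Longrightarrow>
          norm (integral (cbox x (x + h *\<^sub>R One)) u /\<^sub>R h ^ DIM('a) - u x) < e"
        using Nlim[OF x e] by blast
      show ?thesis using d[of "d/2"] \<open>d > 0\<close> int[THEN integral_unique] by simp
    qed
    then show "u x = 0" by (metis less_irrefl norm_eq_zero norm_ge_zero order_le_less)
  qed
qed

text \<open>Because of the moving base point in \<open>rquot_add\<close>, the limits are not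
  compared pointwise. Under an integral over a box the motion becomes a translation of the box,
  which is harmless in the limit; equality of all box integrals then gives equality almost
  everywhere.\<close>

lemma rderiv_add_AE:
  fixes g :: "'a::euclidean_space \<Rightarrow> real"
  assumes lip: "L-lipschitz_on UNIV g"
  shows "AE y in lborel. rderiv g (v + w) y = rderiv g v y + rderiv g w y"
proof -
  note conv = convergent_rquot_AE_real[OF lip]
  note L0 = lipschitz_on_nonneg[OF lip]
  note [measurable] = borel_measurable_rderiv[OF lip] borel_measurable_rquot[OF lip]
  define u where "u y = rderiv g (v + w) y - (rderiv g w y + rderiv g v y)" for y
  have "(u has_integral 0) (cbox a b)" for a b
  proof -
    let ?Q = "cbox a b"
    have fin: "emeasure lborel ?Q < \<infinity>" by (simp add: emeasure_lborel_cbox_eq)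
    obtain R where R: "\<And>x. x \<in> ?Q \<Longrightarrow> norm x \<le> R"
      using bounded_cbox[of a b] by (auto simp: bounded_iff)
    note si = tendsto_integral_rquot(1)[OF lip conv _ fin, simplified]
    note lim = tendsto_integral_rquot(2)[OF lip conv _ fin, simplified]
    define I where "I n = (LINT y:?Q|lborel. rquot g w ((1 / real (Suc n)) *\<^sub>R v + y) n)" for n
    \<comment> \<open>Translation invariance moves the shift from the integrand to the box.\<close>
    have I_eq: "I n = (LINT z|lborel. indicator ?Q (z - (1 / real (Suc n)) *\<^sub>R v) *\<^sub>R rquot g w z n)" for n
    proof -
      let ?c = "(1 / real (Suc n)) *\<^sub>R v"
      have "(LINT z|distr lborel borel ((+) ?c). indicator ?Q (z - ?c) *\<^sub>R rquot g w z n)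
         = (LINT y|lborel. indicator ?Q ((?c + y) - ?c) *\<^sub>R rquot g w (?c + y) n)"
        by (rule integral_distr) measurable
      then show ?thesis
        by (simp add: lborel_distr_plus I_def set_lebesgue_integral_def)
    qed
    have "I \<longlonglongrightarrow> (LINT z|lborel. indicator ?Q z *\<^sub>R rderiv g w z)"
      unfolding I_eq[abs_def]
    proof (rule integral_dominated_convergence)
      \<comment> \<open>The shifts have length at most \<open>norm v\<close>, so one ball contains
        all translated boxes.\<close>
      let ?W = "\<lambda>z::'a. L * norm w * indicator (cball 0 (R + norm v)) z"
      have "emeasure lborel (cball 0 (R + norm v) :: 'a set) < \<infinity>"
        by (rule emeasure_bounded_finite) simp
      then show "integrable lborel ?W"
        by (intro integrable_mult_right integrable_real_indicator) auto
      show "AE z in lborel. norm (indicator ?Q (z - (1 / real (Suc n)) *\<^sub>R v) *\<^sub>R rquot g w z n) \<le> ?W z" for n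
      proof (rule AE_I2)
        fix z
        have "z \<in> cball 0 (R + norm v)" if "z - (1 / real (Suc n)) *\<^sub>R v \<in> ?Q"
        proof -
          have "norm z \<le> norm (z - (1 / real (Suc n)) *\<^sub>R v) + norm ((1 / real (Suc n)) *\<^sub>R v)"
            by (metis diff_add_cancel norm_triangle_ineq)
          also have "norm ((1 / real (Suc n)) *\<^sub>R v) \<le> norm v"
            by (simp add: divide_le_eq mult_right_le_one_le algebra_simps)
          finally show ?thesis using R[OF that] by simp
        qed
        then show "norm (indicator ?Q (z - (1 / real (Suc n)) *\<^sub>R v) *\<^sub>R rquot g w z n) \<le> ?W z"
          using norm_rquot_le[OF lip, of w z n] L0 by (auto simp: indicator_def)
      qed
      \<comment> \<open>On the frontier the indicators of the translated boxes may converge to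
        something other than the indicator of the box. The frontier is a null set.\<close>
      have "AE z in lebesgue. z \<notin> cbox a b - box a b"
        using negligible_frontier_interval[of a b]
        unfolding negligible_iff_null_sets by (rule AE_not_in)
      then have "AE z in lborel. z \<notin> cbox a b - box a b"
        by (subst (asm) AE_completion_iff) auto
      with conv[of w]
      show "AE z in lborel. (\<lambda>n. indicator ?Q (z - (1 / real (Suc n)) *\<^sub>R v) *\<^sub>R rquot g w z n)
          \<longlonglongrightarrow> indicator ?Q z *\<^sub>R rderiv g w z"
      proof eventually_elim
        case (elim z)
        have "(\<lambda>n. z - (1 / real (Suc n)) *\<^sub>R v) \<longlonglongrightarrow> z - 0 *\<^sub>R v"
          using LIMSEQ_inverse_real_of_nat unfolding inverse_eq_divide by (intro tendsto_intros)
        then have zlim: "(\<lambda>n. z - (1 / real (Suc n)) *\<^sub>R v) \<longlonglongrightarrow> z" by simp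
        have "\<forall>\<^sub>F n in sequentially. indicator ?Q (z - (1 / real (Suc n)) *\<^sub>R v) = (indicator ?Q z :: real)"
        proof (cases "z \<in> box a b")
          case True
          then show ?thesis
            using topological_tendstoD[OF zlim open_box True]
            by (auto elim!: eventually_mono simp: indicator_def box_subset_cbox[THEN subsetD])
        next
          case False
          then have "z \<in> - cbox a b" using elim by auto
          from topological_tendstoD[OF zlim _ this] this show ?thesis
            by (auto elim!: eventually_mono simp: indicator_def open_Compl closed_cbox)
        qed
        then have "(\<lambda>n. indicator ?Q (z - (1 / real (Suc n)) *\<^sub>R v)) \<longlonglongrightarrow> (indicator ?Q z :: real)"
          by (rule tendsto_eventually)
        then show ?case
          using rquot_tendsto_rderiv[OF elim(1)] by (intro tendsto_intros)
      qed
    qed measurable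
    then have "(\<lambda>n. I n + (LINT y:?Q|lborel. rquot g v y n))
        \<longlonglongrightarrow> (LINT z:?Q|lborel. rderiv g w z) + (LINT z:?Q|lborel. rderiv g v z)"
      using lim by (intro tendsto_intros) (auto simp: set_lebesgue_integral_def)
    moreover have "I n + (LINT y:?Q|lborel. rquot g v y n) = (LINT y:?Q|lborel. rquot g (v+w) y n)" for n
    proof -
      have "set_integrable lborel ?Q (\<lambda>y. rquot g v' (c + y) n)" for v' c
        unfolding set_integrable_def
      proof (rule Bochner_Integration.integrable_bound)
        show "integrable lborel (\<lambda>y. L * norm v' * indicator ?Q y)" using fin by simp
      qed (use norm_rquot_le[OF lip, of v' _ n] L0 in \<open>auto simp: indicator_def abs_mult\<close>)
      from this this[where c=0] show ?thesis
        unfolding I_def rquot_add by (subst set_integral_add) auto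
    qed
    ultimately have "(LINT z:?Q|lborel. rderiv g (v + w) z)
        = (LINT z:?Q|lborel. rderiv g w z) + (LINT z:?Q|lborel. rderiv g v z)"
      using lim[of "v + w"] LIMSEQ_unique by auto
    then have "(LINT z:?Q|lborel. u z) = 0"
      unfolding u_def using si by (simp add: set_integral_diff set_integral_add)
    moreover have "set_integrable lborel ?Q u"
      unfolding u_def using si by (intro set_integral_diff set_integral_add)
    ultimately show ?thesis
      using set_borel_integral_eq_integral[of ?Q u] by (metis has_integral_integral)
  qed
  then have "AE y in lborel. u y = 0" by (rule AE_eq_0_if_box_integrals_0)
  then show ?thesis by eventually_elim (simp add: u_def)
qed

section \<open>From sampled right quotients to differentiability\<close>

lemma right_derivative_if_rquot_tendsto:
  fixes g :: "'a::real_normed_vector \<Rightarrow> 'b::real_normed_vector"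
  assumes lip: "L-lipschitz_on UNIV g" and lim: "rquot g v y \<longlonglongrightarrow> D"
  shows "((\<lambda>s. (1 / s) *\<^sub>R (g (y + s *\<^sub>R v) - g y)) \<longlongrightarrow> D) (at_right 0)"
proof -
  define q where "q s = (1 / s) *\<^sub>R (g (y + s *\<^sub>R v) - g y)" for s
  \<comment> \<open>For \<open>s\<close> below 1, \<open>Suc (N s)\<close> is the integer part of
    \<open>1 / s\<close>; the subtracted 1 cancels the \<open>Suc\<close> in \<open>rquot\<close>.
    The sampled step is thus the smallest reciprocal of a positive integer that is at least
    \<open>s\<close>.\<close>
  define N where "N s = nat \<lfloor>1 / s\<rfloor> - 1" for s :: real
  note L0 = lipschitz_on_nonneg[OF lip]
  have "filterlim (\<lambda>s::real. 1 / s) at_top (at_right 0)"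
    using filterlim_inverse_at_top_right by (simp add: inverse_eq_divide)
  then have "filterlim N at_top (at_right 0)"
    unfolding N_def
    by (intro filterlim_compose[OF filterlim_minus_const_nat_at_top]
        filterlim_compose[OF filterlim_nat_sequentially] filterlim_compose[OF filterlim_floor_sequentially])
  then have X: "((\<lambda>s. rquot g v y (N s)) \<longlongrightarrow> D) (at_right 0)"
    by (rule filterlim_compose[OF lim])
  \<comment> \<open>With \<sigma> the sampled step, moving the end point and changing the divisor
    each cost \<open>L * norm v * (\<sigma> / s - 1)\<close>, and \<open>\<sigma> / s\<close>
    exceeds 1 by at most \<open>2 * s\<close>; hence the factor 4.\<close>
  have close: "norm (q s - rquot g v y (N s)) \<le> 4 * L * norm v * s" if s: "0 < s" "s < 1" for s
  proof -
    define k where "k = real (Suc (N s))"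
    have "1 \<le> \<lfloor>1 / s\<rfloor>" using s by (simp add: le_floor_iff)
    then have k_eq: "k = of_int \<lfloor>1 / s\<rfloor>" by (simp add: k_def N_def of_nat_nat del: one_le_floor)
    then have k: "1 \<le> k" "k \<le> 1 / s" "1 / s < k + 1" using \<open>1 \<le> \<lfloor>1 / s\<rfloor>\<close> by linarith+
    define \<sigma> where "\<sigma> = 1 / k"
    have \<sigma>: "s \<le> \<sigma>" "0 < \<sigma>" using k s by (auto simp: \<sigma>_def field_simps)
    have *: "\<sigma> / s - 1 \<le> 2 * s"
    proof -
      have "\<sigma> / s - 1 = (1 / s - k) / k" using s k by (simp add: \<sigma>_def field_simps)
      also have "\<dots> \<le> 1 / k" using k by (intro divide_right_mono) auto
      also have "1 / k \<le> 2 * s"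
      proof -
        have "1 < s * (k + 1)" using k s by (simp add: field_simps)
        also have "\<dots> \<le> s * (2 * k)" using s k by (intro mult_left_mono) auto
        finally show ?thesis using k by (simp add: field_simps)
      qed
      finally show ?thesis .
    qed
    have r: "rquot g v y (N s) = (1 / \<sigma>) *\<^sub>R (g (y + \<sigma> *\<^sub>R v) - g y)"
      by (simp add: rquot_def \<sigma>_def k_def del: of_nat_Suc)
    have "q s - rquot g v y (N s)
        = (1 / s) *\<^sub>R (g (y + s *\<^sub>R v) - g (y + \<sigma> *\<^sub>R v)) + (1 / s - 1 / \<sigma>) *\<^sub>R (g (y + \<sigma> *\<^sub>R v) - g y)"
      unfolding r q_def by (simp add: algebra_simps)
    also have "norm \<dots> \<le> (1 / s) * norm (g (y + s *\<^sub>R v) - g (y + \<sigma> *\<^sub>R v))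
        + (1 / s - 1 / \<sigma>) * norm (g (y + \<sigma> *\<^sub>R v) - g y)"
    proof -
      have "0 \<le> 1 / s - 1 / \<sigma>" using s \<sigma> by (simp add: frac_le)
      then show ?thesis using norm_triangle_ineq s by (smt (verit) norm_scaleR divide_pos_pos)
    qed
    also have "\<dots> \<le> (1 / s) * (L * ((\<sigma> - s) * norm v)) + (1 / s - 1 / \<sigma>) * (L * (\<sigma> * norm v))"
    proof (intro add_mono mult_left_mono)
      show "norm (g (y + s *\<^sub>R v) - g (y + \<sigma> *\<^sub>R v)) \<le> L * ((\<sigma> - s) * norm v)"
        using lipschitz_norm_diff_le[OF lip, of "y + s *\<^sub>R v" "y + \<sigma> *\<^sub>R v"] \<sigma>
        by (simp flip: scaleR_diff_left)
      show "norm (g (y + \<sigma> *\<^sub>R v) - g y) \<le> L * (\<sigma> * norm v)"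
        using lipschitz_norm_diff_le[OF lip, of "y + \<sigma> *\<^sub>R v" y] \<sigma> by simp
      show "0 \<le> 1 / s - 1 / \<sigma>" using s \<sigma> by (simp add: frac_le)
    qed (use s in auto)
    also have "\<dots> = 2 * L * norm v * (\<sigma> / s - 1)" using s \<sigma> by (simp add: field_simps)
    also have "\<dots> \<le> 2 * L * norm v * (2 * s)" using * L0 by (intro mult_left_mono) auto
    finally show ?thesis by (simp add: mult_ac)
  qed
  have "((\<lambda>s. q s - rquot g v y (N s)) \<longlongrightarrow> 0) (at_right 0)"
  proof (rule Lim_null_comparison)
    show "\<forall>\<^sub>F s in at_right 0. norm (q s - rquot g v y (N s)) \<le> 4 * L * norm v * s"
      using close by (auto simp: eventually_at_right_field intro!: exI[of _ 1])
    show "((\<lambda>s. 4 * L * norm v * s) \<longlongrightarrow> 0) (at_right 0)"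
      by (rule tendsto_eq_intros refl tendsto_ident_at | simp)+
  qed
  from tendsto_add[OF this X] show ?thesis by (simp add: q_def)
qed

lemma rderiv_eqI:
  "rquot g v y \<longlonglongrightarrow> D \<Longrightarrow> rderiv g v y = D"
  unfolding rderiv_def by (rule limI)

lemma filterlim_inverse_Suc_at_right:
  assumes "0 < (c::real)"
  shows "filterlim (\<lambda>n. c / real (Suc n)) (at_right 0) sequentially"
proof -
  have "(\<lambda>n. c * (1 / real (Suc n))) \<longlonglongrightarrow> c * 0"
    using LIMSEQ_inverse_real_of_nat unfolding inverse_eq_divide by (intro tendsto_intros)
  then show ?thesis
    using assms by (auto simp: filterlim_at)
qed

text \<open>The steps \<open>c / Suc n\<close> are in general not among the sampled ones, so the
  limit over all small positive steps is used.\<close>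

lemma rderiv_scaleR_pos:
  fixes g :: "'a::euclidean_space \<Rightarrow> 'b::euclidean_space"
  assumes lip: "L-lipschitz_on UNIV g" and conv: "convergent (rquot g v y)" and c: "0 < c"
  shows "rderiv g (c *\<^sub>R v) y = c *\<^sub>R rderiv g v y"
proof (rule rderiv_eqI)
  let ?q = "\<lambda>s. (1 / s) *\<^sub>R (g (y + s *\<^sub>R v) - g y)"
  have "(\<lambda>n. c *\<^sub>R ?q (c / real (Suc n))) \<longlonglongrightarrow> c *\<^sub>R rderiv g v y"
    using filterlim_compose[OF right_derivative_if_rquot_tendsto[OF lip rquot_tendsto_rderiv[OF conv]]
        filterlim_inverse_Suc_at_right[OF c]]
    by (intro tendsto_intros)
  moreover have "c *\<^sub>R ?q (c / real (Suc n)) = rquot g (c *\<^sub>R v) y n" for n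
    using c by (simp add: rquot_def del: of_nat_Suc)
  ultimately show "rquot g (c *\<^sub>R v) y \<longlonglongrightarrow> c *\<^sub>R rderiv g v y" by simp
qed

lemma rderiv_0 [simp]: "rderiv g 0 y = 0"
  by (rule rderiv_eqI) (simp add: rquot_def[abs_def])

text \<open>Right quotients along \<open>v\<close> say nothing by themselves about the opposite
  direction. For negative \<open>c\<close> the relation comes from additivity, applied to
  \<open>c *\<^sub>R v\<close> and \<open>(- c) *\<^sub>R v\<close> with sum 0.\<close>

lemma rderiv_scaleR_AE:
  fixes g :: "'a::euclidean_space \<Rightarrow> real"
  assumes lip: "L-lipschitz_on UNIV g"
  shows "AE y in lborel. rderiv g (c *\<^sub>R v) y = c * rderiv g v y"
proof -
  consider "c > 0" | "c = 0" | "c < 0" by linarith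
  then show ?thesis
  proof cases
    case 1
    show ?thesis
      using convergent_rquot_AE_real[OF lip, of v]
      by eventually_elim (simp add: rderiv_scaleR_pos[OF lip _ 1])
  next
    case 3
    show ?thesis
      using convergent_rquot_AE_real[OF lip, of v] rderiv_add_AE[OF lip, of "c *\<^sub>R v" "(- c) *\<^sub>R v"]
    proof eventually_elim
      case (elim y)
      have "rderiv g (- c *\<^sub>R v) y = - c *\<^sub>R rderiv g v y"
        using rderiv_scaleR_pos[OF lip elim(1), of "- c"] 3 by simp
      then show ?case using elim(2) by simp
    qed
  qed simp
qed

lemma rderiv_linear_AE:
  fixes g :: "'a::euclidean_space \<Rightarrow> real"
  assumes lip: "L-lipschitz_on UNIV g"
  shows "AE y in lborel. rderiv g v y = (\<Sum>b\<in>Basis. (v \<bullet> b) * rderiv g b y)"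
proof -
  have "AE y in lborel. rderiv g (\<Sum>b\<in>I. (v \<bullet> b) *\<^sub>R b) y = (\<Sum>b\<in>I. (v \<bullet> b) * rderiv g b y)"
    if "finite I" for I
    using that
  proof (induction I)
    case (insert b I)
    from insert.IH rderiv_scaleR_AE[OF lip, of "v \<bullet> b" b]
      rderiv_add_AE[OF lip, of "(v \<bullet> b) *\<^sub>R b" "\<Sum>b\<in>I. (v \<bullet> b) *\<^sub>R b"]
    show ?case
      by eventually_elim (use insert.hyps in simp)
  qed simp
  from this[OF finite_Basis] show ?thesis by (simp add: euclidean_representation)
qed

text \<open>Lipschitz continuity makes the quotients equicontinuous in the direction, so finitely
  many directions from \<open>V\<close> close to the unit sphere decide about all unit directions
  uniformly.\<close>

lemma has_derivative_if_dense_right_derivatives: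
  fixes g :: "'a::euclidean_space \<Rightarrow> 'b::real_normed_vector"
  assumes lip: "L-lipschitz_on UNIV g" and T: "bounded_linear T"
    and dense: "\<And>X. open X \<Longrightarrow> X \<noteq> {} \<Longrightarrow> \<exists>v\<in>V. v \<in> X"
    and rd: "\<And>v. v \<in> V \<Longrightarrow> ((\<lambda>s. (1 / s) *\<^sub>R (g (y + s *\<^sub>R v) - g y)) \<longlongrightarrow> T v) (at_right 0)"
  shows "(g has_derivative T) (at y)"
  unfolding has_derivative_at_alt
proof (intro conjI allI impI T)
  fix e :: real assume e: "0 < e"
  note L0 = lipschitz_on_nonneg[OF lip]
  interpret bounded_linear T by fact
  obtain K where K: "K > 0" "\<And>u. norm (T u) \<le> norm u * K" using pos_bounded by blast
  \<comment> \<open>Replacing a unit direction by a net point within \<eta> costs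
    \<open>L * \<eta>\<close> in the quotient and \<open>K * \<eta>\<close> in \<open>T\<close>,
    together \<open>e / 2\<close>. The other half pays for the finitely many quotients of the
    net.\<close>
  define \<eta> where "\<eta> = e / (2 * (L + K))"
  have \<eta>: "\<eta> > 0" "(L + K) * \<eta> = e / 2" using e K L0 by (auto simp: \<eta>_def field_simps)
  have "sphere 0 1 \<subseteq> (\<Union>v\<in>V. ball v \<eta>)"
  proof
    fix u :: 'a
    have "\<exists>v\<in>V. v \<in> ball u \<eta>" using \<eta> by (intro dense) auto
    then show "u \<in> (\<Union>v\<in>V. ball v \<eta>)" by (auto simp: dist_commute)
  qed
  then obtain F where F: "F \<subseteq> V" "finite F" "sphere 0 1 \<subseteq> (\<Union>v\<in>F. ball v \<eta>)"
    by (rule compactE_image[OF compact_sphere, rotated]) auto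
  have "\<forall>\<^sub>F s in at_right 0. \<forall>v\<in>F. norm ((1 / s) *\<^sub>R (g (y + s *\<^sub>R v) - g y) - T v) < e / 2"
  proof (rule eventually_ball_finite[OF F(2)], intro ballI)
    fix v assume "v \<in> F"
    then have "v \<in> V" using F by blast
    from tendstoD[OF rd[OF this], of "e/2"] e
    show "\<forall>\<^sub>F s in at_right 0. norm ((1 / s) *\<^sub>R (g (y + s *\<^sub>R v) - g y) - T v) < e / 2"
      by (simp add: dist_norm)
  qed
  then obtain d where d: "d > 0"
    and close: "\<And>s v. 0 < s \<Longrightarrow> s < d \<Longrightarrow> v \<in> F \<Longrightarrow> norm ((1 / s) *\<^sub>R (g (y + s *\<^sub>R v) - g y) - T v) < e / 2"
    by (auto simp: eventually_at_right_field)
  show "\<exists>d>0. \<forall>z. norm (z - y) < d \<longrightarrow> norm (g z - g y - T (z - y)) \<le> e * norm (z - y)"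
  proof (intro exI[of _ d] conjI allI impI d)
    fix z assume z: "norm (z - y) < d"
    show "norm (g z - g y - T (z - y)) \<le> e * norm (z - y)"
    proof (cases "z = y")
      case False
      define t where "t = norm (z - y)"
      have t: "0 < t" "t < d" using z False by (auto simp: t_def)
      define u where "u = (1 / t) *\<^sub>R (z - y)"
      have zu: "z = y + t *\<^sub>R u" using t by (simp add: u_def)
      have "norm u = 1" using t by (simp add: u_def t_def)
      then obtain v where v: "v \<in> F" "norm (v - u) < \<eta>"
        using F(3) by (auto simp: dist_norm)
      have 1: "norm (g (y + t *\<^sub>R v) - g y - t *\<^sub>R T v) \<le> t * (e / 2)"
      proof -
        have "g (y + t *\<^sub>R v) - g y - t *\<^sub>R T v = t *\<^sub>R ((1 / t) *\<^sub>R (g (y + t *\<^sub>R v) - g y) - T v)"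
          using t by (simp add: algebra_simps)
        then show ?thesis using close[OF t v(1)] t by simp
      qed
      have 2: "norm (g z - g (y + t *\<^sub>R v)) \<le> L * (t * \<eta>)"
      proof -
        have "norm (g z - g (y + t *\<^sub>R v)) \<le> L * norm (t *\<^sub>R (u - v))"
          using lipschitz_norm_diff_le[OF lip, of z "y + t *\<^sub>R v"]
          by (simp add: zu flip: scaleR_diff_right)
        also have "\<dots> \<le> L * (t * \<eta>)"
          using v t L0 by (intro mult_left_mono) (auto simp: norm_minus_commute)
        finally show ?thesis .
      qed
      have 3: "norm (t *\<^sub>R T v - T (z - y)) \<le> t * \<eta> * K"
      proof -
        have "t *\<^sub>R T v - T (z - y) = T (t *\<^sub>R (v - u))" by (simp add: zu scaleR diff scaleR_diff_right)
        then have "norm (t *\<^sub>R T v - T (z - y)) \<le> norm (t *\<^sub>R (v - u)) * K"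
          using K(2)[of "t *\<^sub>R (v - u)"] by (simp only:)
        also have "\<dots> \<le> t * \<eta> * K" using v t K by (intro mult_right_mono) auto
        finally show ?thesis .
      qed
      have "norm (g z - g y - T (z - y)) \<le> t * (e / 2) + L * (t * \<eta>) + t * \<eta> * K"
        using norm_triangle_le[OF add_mono[OF norm_triangle_le[OF add_mono[OF 1 2]] 3]]
        by (simp add: norm_triangle_le 1 2 3)
      also have "\<dots> = t * (e / 2 + (L + K) * \<eta>)" by (simp add: algebra_simps)
      also have "\<dots> = e * t" by (simp add: \<eta>)
      finally show ?thesis by (simp add: t_def)
    qed (simp add: zero)
  qed
qed

text \<open>The null set outside which linearity in the direction holds depends on the direction.
  Over a countable dense set of directions the union is still null, and density does the
  rest.\<close>

theorem rademacher:
  fixes g :: "'a::euclidean_space \<Rightarrow> 'b::euclidean_space"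
  assumes lip: "L-lipschitz_on UNIV g"
  shows "AE y in lborel. g differentiable (at y)"
proof -
  have real: "AE y in lborel. f differentiable (at y)"
    if lipf: "L-lipschitz_on UNIV f" for f :: "'a \<Rightarrow> real"
  proof -
    obtain V :: "'a set" where V: "countable V" "\<And>X. open X \<Longrightarrow> X \<noteq> {} \<Longrightarrow> \<exists>v\<in>V. v \<in> X"
      by (rule countable_dense_setE) blast
    have "AE y in lborel. \<forall>v\<in>V. convergent (rquot f v y)
        \<and> rderiv f v y = (\<Sum>b\<in>Basis. (v \<bullet> b) * rderiv f b y)"
      unfolding AE_ball_countable[OF V(1)]
      using convergent_rquot_AE_real[OF lipf] rderiv_linear_AE[OF lipf] by auto
    then show ?thesis
    proof eventually_elim
      case (elim y)
      have "(f has_derivative (\<lambda>v. \<Sum>b\<in>Basis. (v \<bullet> b) * rderiv f b y)) (at y)"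
      proof (rule has_derivative_if_dense_right_derivatives[OF lipf _ V(2)])
        show "bounded_linear (\<lambda>v. \<Sum>b\<in>Basis. (v \<bullet> b) * rderiv f b y)"
          by (intro bounded_linear_sum bounded_linear_mult_const bounded_linear_inner_left)
        fix v assume "v \<in> V"
        then show "((\<lambda>s. (1 / s) *\<^sub>R (f (y + s *\<^sub>R v) - f y)) \<longlongrightarrow> (\<Sum>b\<in>Basis. (v \<bullet> b) * rderiv f b y)) (at_right 0)"
          using right_derivative_if_rquot_tendsto[OF lipf, of v y] elim rquot_tendsto_rderiv by metis
      qed
      then show ?case by (auto simp: differentiable_def)
    qed
  qed
  have "AE y in lborel. \<forall>i\<in>Basis. (\<lambda>x. g x \<bullet> i) differentiable (at y)"
  proof (subst AE_ball_countable)
    show "\<forall>i\<in>Basis. AE y in lborel. (\<lambda>x. g x \<bullet> i) differentiable (at y)"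
    proof (intro ballI real lipschitz_onI)
      fix i :: 'b and x y assume i: "i \<in> Basis"
      have "\<bar>(g x - g y) \<bullet> i\<bar> \<le> norm (g x - g y)" using i by (rule Basis_le_norm)
      then show "dist (g x \<bullet> i) (g y \<bullet> i) \<le> L * dist x y"
        using lipschitz_norm_diff_le[OF lip, of x y]
        by (simp add: dist_norm inner_diff_left)
    qed (rule lipschitz_on_nonneg[OF lip])
  qed (simp add: countable_finite)
  then show ?thesis
    by eventually_elim (use differentiable_componentwise_within in blast)
qed

section \<open>Mean value inequality and semismooth residuals\<close>

lemma DERIV_along_line:
  fixes f :: "'a::real_normed_vector \<Rightarrow> real"
  assumes "(f has_derivative D) (at y)"
  shows "((\<lambda>h. (f (y + h *\<^sub>R e) - f y) / h) \<longlongrightarrow> D e) (at 0)"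
proof -
  have "((\<lambda>h. y + h *\<^sub>R e) has_derivative (\<lambda>h. h *\<^sub>R e)) (at 0)"
    by (auto intro!: derivative_eq_intros)
  then have "((\<lambda>h. f (y + h *\<^sub>R e)) has_derivative (\<lambda>h. D (h *\<^sub>R e))) (at 0)"
    by (rule has_derivative_compose) (use assms in simp)
  moreover have "(\<lambda>h. D (h *\<^sub>R e)) = (*) (D e)"
    using has_derivative_linear[OF assms] by (simp add: fun_eq_iff linear_scale)
  ultimately have "((\<lambda>h. f (y + h *\<^sub>R e)) has_real_derivative D e) (at 0)"
    by (simp add: has_field_derivative_def)
  then show ?thesis by (simp add: DERIV_def)
qed

text \<open>Averaging over a small ball turns almost everywhere differentiability into
  differentiability everywhere, so that the classical mean value theorem applies to the averages.\<close>

proposition lipschitz_mean_value: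
  fixes G :: "'a::euclidean_space \<Rightarrow> 'b::euclidean_space"
  assumes lip: "L-lipschitz_on UNIV G" and r: "0 < r" and M: "0 \<le> M"
    and bound: "\<And>u y D. 0 \<le> u \<Longrightarrow> u \<le> 1 \<Longrightarrow> norm (y - (p + u *\<^sub>R (q - p))) < r \<Longrightarrow>
      (G has_derivative D) (at y) \<Longrightarrow> norm (D (q - p) - l) \<le> M"
  shows "norm (G q - G p - l) \<le> M"
proof -
  define e where "e = q - p"
  \<comment> \<open>The error serves as its own test vector: pairing with \<open>z\<close> reduces
    the claim to real functions, for which the mean value theorem has an intermediate point.\<close>
  define z where "z = G q - G p - l"
  note L0 = lipschitz_on_nonneg[OF lip]
  \<comment> \<open>An average over a ball of radius \<rho> differs from the value at its centre by
    at most \<open>L * \<rho> * norm z\<close>, and this happens at both ends of the segment; hence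
    \<open>2 * L * \<rho>\<close>. At the end \<rho> tends to 0.\<close>
  have est: "norm z * norm z \<le> (M + 2 * L * \<rho>) * norm z" if \<rho>: "0 < \<rho>" "\<rho> \<le> r" for \<rho>
  proof -
    define Q :: "'a set" where "Q = ball 0 \<rho>"
    have [measurable]: "Q \<in> sets borel" by (simp add: Q_def)
    have fin: "emeasure lborel Q < \<infinity>" unfolding Q_def by (rule emeasure_bounded_finite) simp
    define m where "m = measure lborel Q"
    have "m > 0" using \<rho> content_ball_pos[of \<rho> "0::'a"] by (simp add: m_def Q_def)
    have int_const: "set_integrable lborel Q (\<lambda>w. c)" "(LINT w:Q|lborel. c) = c * m" for c :: real
      using fin by (simp_all add: set_integrable_def set_lebesgue_integral_def m_def mult.commute)
    define f where "f t w = G (p + t *\<^sub>R e + w) \<bullet> z" for t :: real and w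
    have lipf: "\<bar>f t w - f s v\<bar> \<le> L * norm z * (\<bar>t - s\<bar> * norm e + norm (w - v))" for t w s v
    proof -
      have "\<bar>f t w - f s v\<bar> \<le> norm (G (p + t *\<^sub>R e + w) - G (p + s *\<^sub>R e + v)) * norm z"
        unfolding f_def inner_diff_left[symmetric] by (rule Cauchy_Schwarz_ineq2)
      also have "\<dots> \<le> (L * norm ((p + t *\<^sub>R e + w) - (p + s *\<^sub>R e + v))) * norm z"
        by (intro mult_right_mono lipschitz_norm_diff_le[OF lip]) simp
      also have "(p + t *\<^sub>R e + w) - (p + s *\<^sub>R e + v) = (t - s) *\<^sub>R e + (w - v)"
        by (simp add: algebra_simps)
      also have "L * norm ((t - s) *\<^sub>R e + (w - v)) * norm z
          \<le> L * (\<bar>t - s\<bar> * norm e + norm (w - v)) * norm z"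
        by (intro mult_right_mono mult_left_mono order_trans[OF norm_triangle_ineq] L0) simp_all
      finally show ?thesis by (simp add: mult_ac)
    qed
    have lipft: "(L * norm z)-lipschitz_on UNIV (f t)" for t
      using lipf[of t _ t] L0 by (intro lipschitz_onI) (auto simp: dist_norm)
    note [measurable] = borel_measurable_lipschitz[OF lipft] borel_measurable_rderiv[OF lipft]
    have diff: "AE w in lborel. \<exists>D. (G has_derivative D) (at (p + t *\<^sub>R e + w))
        \<and> (f t has_derivative (\<lambda>v. D v \<bullet> z)) (at w)" for t
    proof -
      have "L-lipschitz_on UNIV (\<lambda>w. G (p + t *\<^sub>R e + w))"
        using lipschitz_norm_diff_le[OF lip, of "p + t *\<^sub>R e + _" "p + t *\<^sub>R e + _"] L0
        by (intro lipschitz_onI) (auto simp: dist_norm)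
      from rademacher[OF this] show ?thesis
      proof eventually_elim
        case (elim w)
        then obtain D where D: "((\<lambda>w. G (p + t *\<^sub>R e + w)) has_derivative D) (at w)"
          by (auto simp: differentiable_def)
        have "((\<lambda>x. x - (p + t *\<^sub>R e)) has_derivative (\<lambda>v. v)) (at (p + t *\<^sub>R e + w))"
          by (auto intro!: derivative_eq_intros)
        from has_derivative_compose[OF this, of "\<lambda>w. G (p + t *\<^sub>R e + w)" D] D
        have "(G has_derivative D) (at (p + t *\<^sub>R e + w))" by simp
        moreover have "(f t has_derivative (\<lambda>v. D v \<bullet> z)) (at w)"
          unfolding f_def using D by (rule has_derivative_inner_left)
        ultimately show ?case by blast
      qed
    qed
    have rd: "rderiv (f t) e w = D e" if "(f t has_derivative D) (at w)" for t w D
    proof (rule rderiv_eqI)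
      have "filterlim (\<lambda>n. 1 / real (Suc n)) (at 0) sequentially"
        using filterlim_inverse_Suc_at_right[of 1] by (rule filterlim_mono) (auto simp: at_within_le_at)
      from filterlim_compose[OF DERIV_along_line[OF that] this]
      show "rquot (f t) e w \<longlonglongrightarrow> D e" by (simp add: rquot_def[abs_def] mult.commute del: of_nat_Suc)
    qed
    have fint: "set_integrable lborel Q (f t)" for t
    proof -
      have "integrable lborel (\<lambda>w. (\<bar>f t 0\<bar> + L * norm z * \<rho>) * indicator Q w)"
        using fin by simp
      then show ?thesis unfolding set_integrable_def
      proof (rule Bochner_Integration.integrable_bound)
        show "AE w in lborel. norm (indicator Q w *\<^sub>R f t w) \<le> norm ((\<bar>f t 0\<bar> + L * norm z * \<rho>) * indicator Q w)"
        proof (rule AE_I2)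
          fix w
          have "\<bar>f t w\<bar> \<le> \<bar>\<bar>f t 0\<bar> + L * norm z * \<rho>\<bar>" if "norm w < \<rho>"
          proof -
            have "L * norm z * norm w \<le> L * norm z * \<rho>"
              using that L0 by (intro mult_left_mono) auto
            then show ?thesis using lipf[of t w t 0] by simp
          qed
          then show "norm (indicator Q w *\<^sub>R f t w) \<le> norm ((\<bar>f t 0\<bar> + L * norm z * \<rho>) * indicator Q w)"
            by (auto simp: indicator_def Q_def)
        qed
      qed measurable
    qed
    define \<phi> where "\<phi> t = (LINT w:Q|lborel. f t w)" for t
    have rdint: "set_integrable lborel Q (rderiv (f t) e)" for t
      by (rule tendsto_integral_rquot(1)[OF lipft convergent_rquot_AE_real[OF lipft] _ fin]) simp
    \<comment> \<open>Differentiation under the integral. For each fixed \<open>t\<close> the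
      translates \<open>p + t *\<^sub>R e + w\<close> are points of differentiability for almost
      every \<open>w\<close>, so \<open>\<phi>\<close> is differentiable at every
      \<open>t\<close>.\<close>
    have D\<phi>: "DERIV \<phi> t :> (LINT w:Q|lborel. rderiv (f t) e w)" for t
      unfolding DERIV_def tendsto_at_iff_sequentially
    proof (intro allI impI)
      fix X :: "nat \<Rightarrow> real"
      assume X: "\<forall>i. X i \<in> UNIV - {0}" "X \<longlonglongrightarrow> 0"
      then have X0: "X i \<noteq> 0" for i by simp
      have "filterlim X (at 0) sequentially" using X by (simp add: filterlim_at)
      have eq: "(\<phi> (t + X n) - \<phi> t) / X n
          = (LINT w|lborel. indicator Q w *\<^sub>R ((f t (w + X n *\<^sub>R e) - f t w) / X n))" for n
      proof -
        have "f (t + X n) = (\<lambda>w. f t (w + X n *\<^sub>R e))"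
          by (rule ext) (simp add: f_def algebra_simps)
        then have "\<phi> (t + X n) - \<phi> t = (LINT w:Q|lborel. f t (w + X n *\<^sub>R e) - f t w)"
          unfolding \<phi>_def using set_integral_diff(2)[OF fint[of "t + X n"] fint[of t]] by simp
        then have "(\<phi> (t + X n) - \<phi> t) / X n = (LINT w:Q|lborel. f t (w + X n *\<^sub>R e) - f t w) / X n"
          by (simp only:)
        also have "\<dots> = (LINT w|lborel. (indicator Q w *\<^sub>R (f t (w + X n *\<^sub>R e) - f t w)) / X n)"
          unfolding set_lebesgue_integral_def by (rule integral_divide_zero[symmetric])
        finally show ?thesis by (simp only: scaleR_conv_of_real times_divide_eq_right)
      qed
      have "(\<lambda>n. LINT w|lborel. indicator Q w *\<^sub>R ((f t (w + X n *\<^sub>R e) - f t w) / X n))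
          \<longlonglongrightarrow> (LINT w|lborel. indicator Q w *\<^sub>R rderiv (f t) e w)"
      proof (rule integral_dominated_convergence)
        let ?W = "\<lambda>w::'a. L * norm z * norm e * indicator Q w"
        show "integrable lborel ?W"
          using fin by (intro integrable_mult_right integrable_real_indicator) auto
        show "AE w in lborel. (\<lambda>n. indicator Q w *\<^sub>R ((f t (w + X n *\<^sub>R e) - f t w) / X n))
            \<longlonglongrightarrow> indicator Q w *\<^sub>R rderiv (f t) e w"
          using diff[of t]
        proof eventually_elim
          case (elim w)
          then obtain D where D: "(f t has_derivative D) (at w)" by blast
          show ?case
            using filterlim_compose[OF DERIV_along_line[OF D] \<open>filterlim X (at 0) sequentially\<close>, of e] rd[OF D]
            by (intro tendsto_intros) simp
        qed
        show "AE w in lborel. norm (indicator Q w *\<^sub>R ((f t (w + X n *\<^sub>R e) - f t w) / X n)) \<le> ?W w" for n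
        proof (rule AE_I2)
          fix w
          have "\<bar>f t (w + X n *\<^sub>R e) - f t w\<bar> \<le> L * norm z * norm e * \<bar>X n\<bar>"
            using lipf[of t "w + X n *\<^sub>R e" t w]
            by (simp add: mult.assoc mult.commute[of "norm e" "\<bar>X n\<bar>"])
          then show "norm (indicator Q w *\<^sub>R ((f t (w + X n *\<^sub>R e) - f t w) / X n)) \<le> ?W w"
            using X0[of n] by (cases "w \<in> Q") (simp_all add: pos_divide_le_eq)
        qed
      qed measurable
      then show "((\<lambda>h. (\<phi> (t + h) - \<phi> t) / h) \<circ> X) \<longlonglongrightarrow> (LINT w:Q|lborel. rderiv (f t) e w)"
        by (simp add: o_def eq set_lebesgue_integral_def)
    qed
    obtain \<xi> where \<xi>: "0 < \<xi>" "\<xi> < 1"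
      and \<phi>1: "\<phi> 1 - \<phi> 0 = (LINT w:Q|lborel. rderiv (f \<xi>) e w)"
      using MVT2[of 0 1 \<phi> "\<lambda>t. LINT w:Q|lborel. rderiv (f t) e w"] D\<phi> by auto
    \<comment> \<open>Since \<rho> is at most \<open>r\<close>, almost every \<open>w\<close> in the
      ball leads to a point of differentiability to which \<open>bound\<close> applies.\<close>
    have up: "\<phi> 1 - \<phi> 0 \<le> (M * norm z + l \<bullet> z) * m"
      unfolding \<phi>1 int_const(2)[symmetric]
    proof (rule set_integral_mono_AE[OF rdint int_const(1)])
      show "AE w\<in>Q in lborel. rderiv (f \<xi>) e w \<le> M * norm z + l \<bullet> z"
        using diff[of \<xi>]
      proof eventually_elim
        case (elim w)
        then obtain D where D: "(G has_derivative D) (at (p + \<xi> *\<^sub>R e + w))"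
            "(f \<xi> has_derivative (\<lambda>v. D v \<bullet> z)) (at w)" by blast
        show ?case
        proof
          assume "w \<in> Q"
          then have "norm (D e - l) \<le> M"
            using bound[of \<xi> "p + \<xi> *\<^sub>R e + w" D] \<xi> \<rho> D by (simp add: e_def Q_def)
          then have "norm (D e - l) * norm z \<le> M * norm z" by (intro mult_right_mono) auto
          moreover have "(D e - l) \<bullet> z \<le> norm (D e - l) * norm z" by (rule norm_cauchy_schwarz)
          ultimately show "rderiv (f \<xi>) e w \<le> M * norm z + l \<bullet> z"
            using rd[OF D(2)] by (simp add: inner_diff_left)
        qed
      qed
    qed
    have low: "(norm z * norm z + l \<bullet> z - 2 * L * \<rho> * norm z) * m \<le> \<phi> 1 - \<phi> 0"
    proof -
      have "\<phi> 1 - \<phi> 0 = (LINT w:Q|lborel. f 1 w - f 0 w)"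
        unfolding \<phi>_def using set_integral_diff(2)[OF fint[of 1] fint[of 0]] by simp
      moreover have "(LINT w:Q|lborel. norm z * norm z + l \<bullet> z - 2 * L * \<rho> * norm z)
          \<le> (LINT w:Q|lborel. f 1 w - f 0 w)"
      proof (rule set_integral_mono[OF int_const(1) set_integral_diff(1)[OF fint fint]])
        fix w assume "w \<in> Q"
        then have "L * norm z * norm w \<le> L * norm z * \<rho>"
          using L0 by (intro mult_left_mono) (auto simp: Q_def)
        then have "\<bar>f 1 w - f 1 0\<bar> \<le> L * \<rho> * norm z" "\<bar>f 0 w - f 0 0\<bar> \<le> L * \<rho> * norm z"
          using lipf[of 1 w 1 0] lipf[of 0 w 0 0] by (simp_all add: mult_ac)
        moreover have "f 1 0 - f 0 0 = norm z * norm z + l \<bullet> z"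
        proof -
          have "f 1 0 - f 0 0 = (z + l) \<bullet> z"
            by (simp add: f_def e_def z_def flip: inner_diff_left)
          then show ?thesis by (simp add: inner_add_left dot_square_norm power2_eq_square)
        qed
        ultimately show "norm z * norm z + l \<bullet> z - 2 * L * \<rho> * norm z \<le> f 1 w - f 0 w" by linarith
      qed
      ultimately show ?thesis by (simp add: int_const)
    qed
    from mult_right_le_imp_le[OF order_trans[OF low up] \<open>m > 0\<close>] show ?thesis
      by (simp add: algebra_simps)
  qed
  show ?thesis
  proof (cases "z = 0")
    case True
    then show ?thesis using M by (simp add: z_def)
  next
    case False
    have "norm z \<le> M + 2 * L * \<rho>" if "0 < \<rho>" "\<rho> \<le> r" for \<rho>
      using mult_right_le_imp_le[OF est[OF that]] False by simp
    then have ev: "\<forall>\<^sub>F \<rho> in at_right 0. norm z \<le> M + 2 * L * \<rho>"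
      unfolding eventually_at_right_field using r by (intro exI[of _ r]) auto
    have "((\<lambda>\<rho>. M + 2 * L * \<rho>) \<longlongrightarrow> M + 2 * L * 0) (at_right 0)"
      by (intro tendsto_intros)
    from tendsto_lowerbound[OF this ev] have "norm z \<le> M" by simp
    then show ?thesis by (simp add: z_def)
  qed
qed

section \<open>Radial form of the mean value inequality\<close>

lemma has_derivative_norm_le_lipschitz:
  fixes G :: "'a::euclidean_space \<Rightarrow> 'b::euclidean_space"
  assumes lip: "L-lipschitz_on UNIV G" and D: "(G has_derivative D) (at y)"
  shows "norm (D v) \<le> L * norm v"
proof (cases "D v = 0")
  case False
  note L0 = lipschitz_on_nonneg[OF lip]
  have "((\<lambda>x. G x \<bullet> D v) has_derivative (\<lambda>u. D u \<bullet> D v)) (at y)"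
    using D by (rule has_derivative_inner_left)
  from DERIV_along_line[OF this, of v]
  have lim: "((\<lambda>h. (G (y + h *\<^sub>R v) \<bullet> D v - G y \<bullet> D v) / h) \<longlongrightarrow> D v \<bullet> D v) (at 0)" .
  have "norm ((G (y + h *\<^sub>R v) \<bullet> D v - G y \<bullet> D v) / h) \<le> L * norm v * norm (D v)" if "h \<noteq> 0" for h
  proof -
    have "\<bar>(G (y + h *\<^sub>R v) - G y) \<bullet> D v\<bar> \<le> norm (G (y + h *\<^sub>R v) - G y) * norm (D v)"
      by (rule Cauchy_Schwarz_ineq2)
    also have "\<dots> \<le> (L * norm (h *\<^sub>R v)) * norm (D v)"
      using lipschitz_norm_diff_le[OF lip, of "y + h *\<^sub>R v" y] by (intro mult_right_mono) auto
    also have "\<dots> = (L * norm v * norm (D v)) * \<bar>h\<bar>" by (simp add: mult.assoc mult.left_commute)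
    finally show ?thesis using that by (simp add: inner_diff_left pos_divide_le_eq)
  qed
  then have ev: "\<forall>\<^sub>F h in at 0. norm ((G (y + h *\<^sub>R v) \<bullet> D v - G y \<bullet> D v) / h) \<le> L * norm v * norm (D v)"
    by (auto simp: eventually_at intro!: exI[of _ 1])
  have "norm (D v \<bullet> D v) \<le> L * norm v * norm (D v)"
    by (rule tendsto_upperbound[OF tendsto_norm[OF lim] ev]) simp
  then have "norm (D v) * norm (D v) \<le> L * norm v * norm (D v)"
    by (simp add: dot_square_norm power2_eq_square)
  then show ?thesis using False by simp
qed (use lipschitz_on_nonneg[OF lip] in simp)

lemma linear_diff_norm_le:
  assumes "linear D" "\<And>v. norm (D v) \<le> L * norm v" "norm (D k - l) \<le> M"
  shows "norm (D h - l) \<le> M + L * norm (h - k)"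
proof -
  have "D h - l = (D k - l) + D (h - k)" by (simp add: linear_diff[OF assms(1)])
  then show ?thesis using norm_triangle_le[OF add_mono[OF assms(3) assms(2)[of "h - k"]]] by (simp only:)
qed

text \<open>In \<open>bound\<close> a derivative at \<open>x + s *\<^sub>R k\<close> is tested on
  \<open>k\<close> itself, with \<open>k\<close> near \<open>h\<close>; this is the form in which
  semismoothness supplies information. The first \<sigma>-fraction of the segment is estimated by
  the Lipschitz constant alone and disappears as \<sigma> tends to 0.\<close>

lemma radial_mean_value:
  fixes G :: "'a::euclidean_space \<Rightarrow> 'b::euclidean_space"
  assumes lip: "L-lipschitz_on UNIV G" and \<rho>: "0 < \<rho>" and M: "0 \<le> M"
    and bound: "\<And>s k D. 0 < s \<Longrightarrow> s \<le> 1 \<Longrightarrow> norm (k - h) < \<rho> \<Longrightarrow>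
      (G has_derivative D) (at (x + s *\<^sub>R k)) \<Longrightarrow> norm (D k - l) \<le> M"
  shows "norm (G (x + h) - G x - l) \<le> M"
proof -
  note L0 = lipschitz_on_nonneg[OF lip]
  \<comment> \<open>Cost per unit of \<sigma>: \<open>L * \<rho>\<close> for testing on
    \<open>h\<close> instead of \<open>k\<close>, the other two terms for the omitted initial
    piece.\<close>
  define B where "B = L * \<rho> + norm l + L * norm h"
  have est: "norm (G (x + h) - G x - l) \<le> M + B * \<sigma>" if \<sigma>: "0 < \<sigma>" "\<sigma> < 1" for \<sigma>
  proof -
    define p where "p = x + \<sigma> *\<^sub>R h"
    have qp: "(x + h) - p = (1 - \<sigma>) *\<^sub>R h" by (simp add: p_def algebra_simps)
    have "norm (G (x + h) - G p - (1 - \<sigma>) *\<^sub>R l) \<le> (1 - \<sigma>) * (M + L * (\<sigma> * \<rho>))"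
    proof (rule lipschitz_mean_value[OF lip])
      \<comment> \<open>One factor \<sigma> absorbs the division by \<open>s \<ge> \<sigma>\<close>
        that turns \<open>y - x\<close> into \<open>k\<close>. The other brings \<open>k\<close>
        within \<open>\<sigma> * \<rho>\<close> of \<open>h\<close>, so that changing the test
        direction becomes free in the limit.\<close>
      show "0 < \<sigma> * (\<sigma> * \<rho>)" using \<sigma> \<rho> by simp
      show "0 \<le> (1 - \<sigma>) * (M + L * (\<sigma> * \<rho>))" using \<sigma> M \<rho> L0 by simp
      fix u y D
      assume u: "0 \<le> u" "u \<le> 1" and y: "norm (y - (p + u *\<^sub>R (x + h - p))) < \<sigma> * (\<sigma> * \<rho>)"
        and D: "(G has_derivative D) (at y)"
      define s where "s = \<sigma> + u * (1 - \<sigma>)"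
      have "0 \<le> u * (1 - \<sigma>)" "u * (1 - \<sigma>) \<le> 1 - \<sigma>"
        using \<sigma> u mult_right_mono[of u 1 "1 - \<sigma>"] by auto
      then have s: "\<sigma> \<le> s" "0 < s" "s \<le> 1"
        using \<sigma> unfolding s_def by linarith+
      define k where "k = (1 / s) *\<^sub>R (y - x)"
      have yk: "y = x + s *\<^sub>R k" using s by (simp add: k_def)
      have "y - (p + u *\<^sub>R (x + h - p)) = s *\<^sub>R (k - h)"
        unfolding qp by (simp add: yk p_def s_def algebra_simps)
      then have "s * norm (k - h) < \<sigma> * (\<sigma> * \<rho>)" using y s by simp
      also have "\<dots> \<le> s * (\<sigma> * \<rho>)" using s \<sigma> \<rho> by (intro mult_right_mono) auto
      finally have kh: "norm (k - h) < \<sigma> * \<rho>" using s by simp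
      also have "\<dots> \<le> \<rho>" using \<sigma> \<rho> by simp
      finally have "norm (D k - l) \<le> M" using bound[OF s(2,3) _ D[unfolded yk]] by simp
      note Dlin = has_derivative_linear[OF D]
      from linear_diff_norm_le[OF Dlin has_derivative_norm_le_lipschitz[OF lip D] \<open>norm (D k - l) \<le> M\<close>, of h]
      have "norm (D h - l) \<le> M + L * (\<sigma> * \<rho>)"
        using kh L0 mult_left_mono[of "norm (h - k)" "\<sigma> * \<rho>" L] by (simp add: norm_minus_commute)
      moreover have "D (x + h - p) - (1 - \<sigma>) *\<^sub>R l = (1 - \<sigma>) *\<^sub>R (D h - l)"
        unfolding qp by (simp add: linear_scale[OF Dlin] scaleR_diff_right)
      ultimately show "norm (D (x + h - p) - (1 - \<sigma>) *\<^sub>R l) \<le> (1 - \<sigma>) * (M + L * (\<sigma> * \<rho>))"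
        using \<sigma> by simp
    qed
    also have "\<dots> \<le> 1 * (M + L * (\<sigma> * \<rho>))" using \<sigma> M \<rho> L0 by (intro mult_right_mono) auto
    finally have 1: "norm (G (x + h) - G p - (1 - \<sigma>) *\<^sub>R l) \<le> M + L * (\<sigma> * \<rho>)" by simp
    have 2: "norm (G p - G x - \<sigma> *\<^sub>R l) \<le> L * (\<sigma> * norm h) + \<sigma> * norm l"
      using norm_triangle_ineq4[of "G p - G x" "\<sigma> *\<^sub>R l"] lipschitz_norm_diff_le[OF lip, of p x] \<sigma>
      by (simp add: p_def)
    have "G (x + h) - G x - l = (G (x + h) - G p - (1 - \<sigma>) *\<^sub>R l) + (G p - G x - \<sigma> *\<^sub>R l)"
      by (simp add: algebra_simps)
    then have "norm (G (x + h) - G x - l) \<le> (M + L * (\<sigma> * \<rho>)) + (L * (\<sigma> * norm h) + \<sigma> * norm l)"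
      using norm_triangle_le[OF add_mono[OF 1 2]] by (simp only:)
    then show ?thesis by (simp add: B_def algebra_simps)
  qed
  have ev: "\<forall>\<^sub>F \<sigma> in at_right 0. norm (G (x + h) - G x - l) \<le> M + B * \<sigma>"
    unfolding eventually_at_right_field using est by (intro exI[of _ 1]) auto
  have "((\<lambda>\<sigma>. M + B * \<sigma>) \<longlongrightarrow> M + B * 0) (at_right 0)"
    by (intro tendsto_intros)
  from tendsto_lowerbound[OF this ev] show ?thesis by simp
qed

text \<open>The nearest point projection onto a closed ball is 1-Lipschitz, so composing with it
  gives a globally Lipschitz map to which the results above apply. Half the radius keeps the closed
  ball inside the region of the Lipschitz bound; on its interior the projection is the identity, so
  values and derivatives agree.\<close>

lemma locally_lipschitz_near_extension:
  assumes "locally_lipschitz_near G x"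
  shows "\<exists>G' L e. 0 < e \<and> L-lipschitz_on UNIV G' \<and> (\<forall>y\<in>ball x e. G' y = G y \<and>
    (\<forall>D. (G' has_derivative D) (at y) \<longleftrightarrow> (G has_derivative D) (at y)))"
proof -
  obtain e K where e: "e > 0"
    and K: "\<And>y z. y \<in> ball x e \<Longrightarrow> z \<in> ball x e \<Longrightarrow> norm (G y - G z) \<le> K * norm (y - z)"
    using assms unfolding locally_lipschitz_near_def by blast
  define c where "c = closest_point (cball x (e / 2))"
  have cin: "c y \<in> ball x e" for y
    using closest_point_in_set[of "cball x (e/2)" y] e by (auto simp: c_def)
  have cid: "c y = y" if "y \<in> ball x (e / 2)" for y
    using that unfolding c_def by (intro closest_point_self) auto
  have lip: "(max K 0)-lipschitz_on UNIV (G \<circ> c)"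
  proof (rule lipschitz_onI)
    fix y z
    have "norm (G (c y) - G (c z)) \<le> K * norm (c y - c z)" using K cin by blast
    also have "\<dots> \<le> max K 0 * norm (c y - c z)" by (intro mult_right_mono) auto
    also have "\<dots> \<le> max K 0 * norm (y - z)"
      using closest_point_lipschitz[of "cball x (e/2)" y z] e
      by (intro mult_left_mono) (auto simp: c_def dist_norm)
    finally show "dist ((G \<circ> c) y) ((G \<circ> c) z) \<le> max K 0 * dist y z" by (simp add: dist_norm)
  qed simp
  have der: "((G \<circ> c) has_derivative D) (at y) \<longleftrightarrow> (G has_derivative D) (at y)"
    if "y \<in> ball x (e / 2)" for y D
    using has_derivative_transform_within_open[OF _ open_ball that] cid by (metis comp_apply)
  show ?thesis
    using e lip cid der by (intro exI[of _ "G \<circ> c"] exI[of _ "max K 0"] exI[of _ "e/2"]) auto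
qed

section \<open>Residuals at a point of semismoothness\<close>

lemma derivative_in_clarke_jac:
  assumes "(G has_derivative D) (at y)"
  shows "Blinfun D \<in> clarke_jac G y" "blinfun_apply (Blinfun D) = D"
proof -
  show D: "blinfun_apply (Blinfun D) = D"
    using has_derivative_bounded_linear[OF assms] by (rule bounded_linear_Blinfun_apply)
  show "Blinfun D \<in> clarke_jac G y"
    unfolding clarke_jac_def
    by (rule hull_inc) (use assms D in \<open>auto intro!: exI[of _ "\<lambda>_. y"] exI[of _ "\<lambda>_. Blinfun D"]\<close>)
qed

text \<open>One vector \<open>l\<close>, the limit from the definition of semismoothness,
  approximates both the values of Clarke elements and the increments of \<open>G\<close>. The first
  is the definition; the radial mean value inequality derives the second from it.\<close>

lemma semismooth_radial:
  assumes ss: "semismooth_at G x"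
  shows "\<exists>l. \<forall>\<epsilon>>0. \<exists>\<delta>>0. \<forall>t h. 0 < t \<and> t < \<delta> \<and> norm (h - u) < \<delta> \<longrightarrow>
    norm (G (x + t *\<^sub>R h) - G x - t *\<^sub>R l) \<le> \<epsilon> * t \<and>
    (\<forall>V \<in> clarke_jac G (x + t *\<^sub>R h). norm (blinfun_apply V h - l) < \<epsilon>)"
proof -
  from ss have "locally_lipschitz_near G x" by (simp add: semismooth_at_def)
  from locally_lipschitz_near_extension[OF this] obtain G' L e
    where e: "0 < e" and lip: "L-lipschitz_on UNIV G'" and ext: "\<forall>y\<in>ball x e. G' y = G y \<and>
      (\<forall>D. (G' has_derivative D) (at y) \<longleftrightarrow> (G has_derivative D) (at y))"
    by (elim exE conjE)
  have G': "G' y = G y" and der: "(G' has_derivative D) (at y) \<longleftrightarrow> (G has_derivative D) (at y)"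
    if "y \<in> ball x e" for y D
    using ext that by auto
  from ss obtain l where l: "\<And>\<epsilon>. 0 < \<epsilon> \<Longrightarrow> \<exists>\<delta>>0. \<forall>t h' V.
         0 < t \<and> t < \<delta> \<and> norm (h' - u) < \<delta> \<and> V \<in> clarke_jac G (x + t *\<^sub>R h')
           \<longrightarrow> norm (blinfun_apply V h' - l) < \<epsilon>"
    unfolding semismooth_at_def by metis
  show ?thesis
  proof (intro exI[of _ l] allI impI)
    fix \<epsilon> :: real assume \<epsilon>: "0 < \<epsilon>"
    from l[OF this] obtain \<delta> where \<delta>: "0 < \<delta>"
      and close: "\<And>t h' V. 0 < t \<Longrightarrow> t < \<delta> \<Longrightarrow> norm (h' - u) < \<delta> \<Longrightarrow> V \<in> clarke_jac G (x + t *\<^sub>R h') \<Longrightarrow>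
        norm (blinfun_apply V h' - l) < \<epsilon>" by blast
    \<comment> \<open>The half leaves room for the perturbed direction \<open>k'\<close> to stay
      within \<delta> of \<open>u\<close>. The quotient keeps \<open>x + t *\<^sub>R h\<close> in
      the ball where \<open>G\<close> agrees with its Lipschitz extension.\<close>
    define \<delta>' where "\<delta>' = min (\<delta> / 2) (e / (norm u + \<delta>))"
    have nu: "0 < norm u + \<delta>" using \<delta> by (simp add: add_nonneg_pos)
    have \<delta>': "0 < \<delta>'" using \<delta> e nu by (simp add: \<delta>'_def)
    have \<delta>'2: "\<delta>' \<le> \<delta> / 2" unfolding \<delta>'_def by (rule min.cobounded1)
    have small: "x + t *\<^sub>R h \<in> ball x e" if "0 \<le> t" "t < \<delta>'" "norm (h - u) < \<delta>" for t h
    proof -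
      have "norm h \<le> norm u + \<delta>"
        using that norm_triangle_ineq2[of h u] by linarith
      then have "t * norm h \<le> t * (norm u + \<delta>)" using that by (intro mult_left_mono)
      also have "\<dots> < (e / (norm u + \<delta>)) * (norm u + \<delta>)"
        using that nu by (intro mult_strict_right_mono) (auto simp: \<delta>'_def)
      finally show ?thesis using that nu by (simp add: dist_norm)
    qed
    show "\<exists>\<delta>>0. \<forall>t h. 0 < t \<and> t < \<delta> \<and> norm (h - u) < \<delta> \<longrightarrow>
      norm (G (x + t *\<^sub>R h) - G x - t *\<^sub>R l) \<le> \<epsilon> * t \<and>
      (\<forall>V \<in> clarke_jac G (x + t *\<^sub>R h). norm (blinfun_apply V h - l) < \<epsilon>)"
    proof (intro exI[of _ \<delta>'] conjI \<delta>' allI impI ballI; elim conjE)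
      fix t h assume t: "0 < t" "t < \<delta>'" and h: "norm (h - u) < \<delta>'"
      have "norm (G' (x + t *\<^sub>R h) - G' x - t *\<^sub>R l) \<le> \<epsilon> * t"
      proof (rule radial_mean_value[OF lip])
        show "0 < t * (\<delta> / 2)" "0 \<le> \<epsilon> * t" using t \<delta> \<epsilon> by auto
        fix s k D
        assume s: "0 < s" "s \<le> 1" and k: "norm (k - t *\<^sub>R h) < t * (\<delta> / 2)"
          and D: "(G' has_derivative D) (at (x + s *\<^sub>R k))"
        define k' where "k' = (1 / t) *\<^sub>R k"
        have kk': "k = t *\<^sub>R k'" using t by (simp add: k'_def)
        have "norm (k' - h) < \<delta> / 2" using k t by (simp add: kk' flip: scaleR_diff_right)
        then have k'u: "norm (k' - u) < \<delta>"
          using h \<delta>'2 norm_triangle_ineq[of "k' - h" "h - u"] by simp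
        have st: "0 < s * t" "s * t \<le> t" using s t by auto
        have xk: "x + s *\<^sub>R k = x + (s * t) *\<^sub>R k'" by (simp add: kk')
        have "s * t < \<delta>'" using st t by linarith
        then have "x + (s * t) *\<^sub>R k' \<in> ball x e" using st k'u by (intro small) auto
        then have D': "(G has_derivative D) (at (x + (s * t) *\<^sub>R k'))" using D der xk by simp
        have "norm (D k' - l) < \<epsilon>"
          using close[OF st(1) _ k'u derivative_in_clarke_jac(1)[OF D']] derivative_in_clarke_jac(2)[OF D']
            st t \<delta>'2 \<delta> by simp
        moreover have "D k - t *\<^sub>R l = t *\<^sub>R (D k' - l)"
          using linear_scale[OF has_derivative_linear[OF D]] by (simp add: kk' scaleR_diff_right)
        ultimately show "norm (D k - t *\<^sub>R l) \<le> \<epsilon> * t" using t by (simp add: mult.commute)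
      qed
      then show "norm (G (x + t *\<^sub>R h) - G x - t *\<^sub>R l) \<le> \<epsilon> * t"
        using G'[of x] G'[of "x + t *\<^sub>R h"] small[of t h] t h \<delta>'2 \<delta> e by simp
    next
      fix t h V assume "0 < t" "t < \<delta>'" "norm (h - u) < \<delta>'" "V \<in> clarke_jac G (x + t *\<^sub>R h)"
      then show "norm (blinfun_apply V h - l) < \<epsilon>" using close \<delta>'2 \<delta> by simp
    qed
  qed
qed

text \<open>Increment and Clarke element are both within \<open>\<epsilon> / 2 * t\<close> of
  \<open>t *\<^sub>R l u\<close> for directions near \<open>u\<close>. The admissible radius depends
  on \<open>u\<close>; compactness of the unit sphere makes it uniform.\<close>

lemma semismooth_residual:
  assumes ss: "semismooth_at G x" and \<epsilon>: "0 < \<epsilon>"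
  shows "\<exists>\<delta>>0. \<forall>h V. norm h < \<delta> \<and> V \<in> clarke_jac G (x + h) \<longrightarrow>
    norm (G (x + h) - G x - blinfun_apply V h) \<le> \<epsilon> * norm h"
proof -
  have "\<exists>l \<delta>. 0 < \<delta> \<and> (\<forall>t h. 0 < t \<and> t < \<delta> \<and> norm (h - u) < \<delta> \<longrightarrow>
    norm (G (x + t *\<^sub>R h) - G x - t *\<^sub>R l) \<le> \<epsilon> / 2 * t \<and>
    (\<forall>V \<in> clarke_jac G (x + t *\<^sub>R h). norm (blinfun_apply V h - l) < \<epsilon> / 2))" for u
    using semismooth_radial[OF ss, of u] half_gt_zero[OF \<epsilon>] by metis
  then obtain l \<delta> where \<delta>: "\<And>u. 0 < \<delta> u"
    and est: "\<And>u t h. 0 < t \<Longrightarrow> t < \<delta> u \<Longrightarrow> norm (h - u) < \<delta> u \<Longrightarrow>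
      norm (G (x + t *\<^sub>R h) - G x - t *\<^sub>R l u) \<le> \<epsilon> / 2 * t"
    and estV: "\<And>u t h V. 0 < t \<Longrightarrow> t < \<delta> u \<Longrightarrow> norm (h - u) < \<delta> u \<Longrightarrow> V \<in> clarke_jac G (x + t *\<^sub>R h) \<Longrightarrow>
      norm (blinfun_apply V h - l u) < \<epsilon> / 2"
    by metis
  have "sphere 0 1 \<subseteq> (\<Union>u\<in>sphere 0 1. ball u (\<delta> u))" using \<delta> by force
  then obtain F where F: "finite F" "sphere 0 1 \<subseteq> (\<Union>u\<in>F. ball u (\<delta> u))"
    by (rule compactE_image[OF compact_sphere, rotated]) auto
  define d where "d = Min (insert 1 (\<delta> ` F))"
  have d: "0 < d" "\<And>u. u \<in> F \<Longrightarrow> d \<le> \<delta> u" using F \<delta> by (auto simp: d_def)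
  show ?thesis
  proof (intro exI[of _ d] conjI d(1) allI impI; elim conjE)
    fix h V assume h: "norm h < d" and V: "V \<in> clarke_jac G (x + h)"
    show "norm (G (x + h) - G x - blinfun_apply V h) \<le> \<epsilon> * norm h"
    proof (cases "h = 0")
      case True
      then show ?thesis by (simp add: blinfun.zero_right)
    next
      case False
      define t where "t = norm h"
      define w where "w = (1 / t) *\<^sub>R h"
      have t: "0 < t" and hw: "h = t *\<^sub>R w" using False by (auto simp: t_def w_def)
      have "w \<in> sphere 0 1" using False by (simp add: w_def t_def)
      then obtain u where u: "u \<in> F" "norm (w - u) < \<delta> u"
        using F(2) by (force simp: dist_norm norm_minus_commute)
      have tu: "t < \<delta> u" using h d(2)[OF u(1)] by (simp add: t_def)
      have 1: "norm (G (x + h) - G x - t *\<^sub>R l u) \<le> \<epsilon> / 2 * t"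
        using est[OF t tu u(2)] by (simp add: hw)
      have "norm (blinfun_apply V w - l u) \<le> \<epsilon> / 2"
        using estV[OF t tu u(2)] V by (simp add: hw less_imp_le)
      then have "t * norm (l u - blinfun_apply V w) \<le> t * (\<epsilon> / 2)"
        using t by (simp add: norm_minus_commute)
      then have 2: "norm (t *\<^sub>R l u - blinfun_apply V h) \<le> \<epsilon> / 2 * t"
        using t by (simp add: hw blinfun.scaleR_right mult.commute flip: scaleR_diff_right)
      show ?thesis
        using norm_triangle_le[OF add_mono[OF 1 2]] by (simp add: t_def)
    qed
  qed
qed

text \<open>\<open>dir_deriv\<close> is a \<open>Lim\<close> and carries information only once this
  convergence is known.\<close>

lemma semismooth_dir_deriv:
  assumes ss: "semismooth_at G x"
  shows "((\<lambda>t. (1 / t) *\<^sub>R (G (x + t *\<^sub>R h) - G x)) \<longlongrightarrow> dir_deriv G x h) (at_right 0)"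
proof -
  obtain l where l: "\<And>\<epsilon>. 0 < \<epsilon> \<Longrightarrow> \<exists>\<delta>>0. \<forall>t k. 0 < t \<and> t < \<delta> \<and> norm (k - h) < \<delta> \<longrightarrow>
    norm (G (x + t *\<^sub>R k) - G x - t *\<^sub>R l) \<le> \<epsilon> * t"
    using semismooth_radial[OF ss, of h] by metis
  have lim: "((\<lambda>t. (1 / t) *\<^sub>R (G (x + t *\<^sub>R h) - G x)) \<longlongrightarrow> l) (at_right 0)"
  proof (rule tendstoI)
    fix \<epsilon> :: real assume "0 < \<epsilon>"
    then obtain \<delta> where \<delta>: "0 < \<delta>"
      "\<And>t. 0 < t \<Longrightarrow> t < \<delta> \<Longrightarrow> norm (G (x + t *\<^sub>R h) - G x - t *\<^sub>R l) \<le> \<epsilon> / 2 * t"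
      using l[of "\<epsilon> / 2"] by force
    have "dist ((1 / t) *\<^sub>R (G (x + t *\<^sub>R h) - G x)) l < \<epsilon>" if t: "0 < t" "t < \<delta>" for t
    proof -
      have "(1 / t) *\<^sub>R (G (x + t *\<^sub>R h) - G x) - l = (1 / t) *\<^sub>R (G (x + t *\<^sub>R h) - G x - t *\<^sub>R l)"
        using t by (simp add: algebra_simps)
      also have "norm \<dots> \<le> \<epsilon> / 2" using \<delta>(2)[OF t] t by (simp add: pos_divide_le_eq)
      finally show ?thesis using \<open>0 < \<epsilon>\<close> by (simp add: dist_norm)
    qed
    then show "\<forall>\<^sub>F t in at_right 0. dist ((1 / t) *\<^sub>R (G (x + t *\<^sub>R h) - G x)) l < \<epsilon>"
      unfolding eventually_at_right_field using \<delta>(1) by auto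
  qed
  then have "dir_deriv G x h = l"
    unfolding dir_deriv_def by (intro tendsto_Lim) auto
  with lim show ?thesis by simp
qed

lemma semismooth_dir_deriv_scaleR:
  assumes ss: "semismooth_at G x" and s: "0 < s"
  shows "dir_deriv G x (s *\<^sub>R h) = s *\<^sub>R dir_deriv G x h"
proof -
  have "filterlim (\<lambda>t. s * t) (at_right 0) (at_right 0)"
    using filtermap_times_pos_at_right[OF s, of 0] by (simp add: filterlim_def)
  from filterlim_compose[OF semismooth_dir_deriv[OF ss, of h] this]
  have "((\<lambda>t. s *\<^sub>R ((1 / (s * t)) *\<^sub>R (G (x + (s * t) *\<^sub>R h) - G x))) \<longlongrightarrow> s *\<^sub>R dir_deriv G x h) (at_right 0)"
    by (intro tendsto_intros)
  then have "((\<lambda>t. (1 / t) *\<^sub>R (G (x + t *\<^sub>R s *\<^sub>R h) - G x)) \<longlongrightarrow> s *\<^sub>R dir_deriv G x h) (at_right 0)"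
    using s by (simp add: mult.commute)
  from tendsto_unique[OF _ semismooth_dir_deriv[OF ss] this] show ?thesis by simp
qed

text \<open>Both terms are compared with the directional derivative along \<open>h\<close>: the
  Clarke element by the definition of order \<alpha>, the increment by the radial mean value
  inequality. Hence the constant \<open>2 * C\<close>.\<close>

lemma semismooth_order_residual:
  assumes "semismooth_order_at \<alpha> G x" and \<alpha>: "0 < \<alpha>"
  shows "\<exists>C \<delta>. 0 < \<delta> \<and> (\<forall>h V. norm h < \<delta> \<and> V \<in> clarke_jac G (x + h) \<longrightarrow>
    norm (G (x + h) - G x - blinfun_apply V h) \<le> C * norm h powr (1 + \<alpha>))"
proof -
  from assms(1) have ss: "semismooth_at G x" by (simp add: semismooth_order_at_def)
  then have "locally_lipschitz_near G x" by (simp add: semismooth_at_def)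
  from locally_lipschitz_near_extension[OF this] obtain G' L e
    where e: "0 < e" and lip: "L-lipschitz_on UNIV G'" and ext: "\<forall>y\<in>ball x e. G' y = G y \<and>
      (\<forall>D. (G' has_derivative D) (at y) \<longleftrightarrow> (G has_derivative D) (at y))"
    by (elim exE conjE)
  have G': "G' y = G y" and der: "(G' has_derivative D) (at y) \<longleftrightarrow> (G has_derivative D) (at y)"
    if "y \<in> ball x e" for y D
    using ext that by auto
  note L0 = lipschitz_on_nonneg[OF lip]
  let ?d = "dir_deriv G x"
  obtain C0 \<delta> where \<delta>: "0 < \<delta>" and ord0: "\<And>h V. h \<noteq> 0 \<Longrightarrow> norm h < \<delta> \<Longrightarrow> V \<in> clarke_jac G (x + h) \<Longrightarrow>
      norm (blinfun_apply V h - ?d h) \<le> C0 * norm h powr (1 + \<alpha>)"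
    using assms(1) unfolding semismooth_order_at_def by blast
  define C where "C = max C0 0"
  have C: "0 \<le> C" by (simp add: C_def)
  have ord: "norm (blinfun_apply V h - ?d h) \<le> C * norm h powr (1 + \<alpha>)"
    if "h \<noteq> 0" "norm h < \<delta>" "V \<in> clarke_jac G (x + h)" for h V
    using ord0[OF that] mult_right_mono[of C0 C "norm h powr (1 + \<alpha>)"] by (simp add: C_def)
  \<comment> \<open>Directional derivatives inherit the Lipschitz constant. This pays for replacing
    a direction \<open>k\<close> near \<open>h\<close> by \<open>h\<close> itself, at the cost
    \<open>L * \<rho>\<close>.\<close>
  have dlip: "norm (?d h - ?d k) \<le> L * norm (h - k)" for h k
  proof -
    have "\<forall>\<^sub>F t in at_right 0. norm ((1 / t) *\<^sub>R (G (x + t *\<^sub>R h) - G x) - (1 / t) *\<^sub>R (G (x + t *\<^sub>R k) - G x))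
        \<le> L * norm (h - k)"
    proof -
      define m where "m = 1 + norm h + norm k"
      have "norm ((1 / t) *\<^sub>R (G (x + t *\<^sub>R h) - G x) - (1 / t) *\<^sub>R (G (x + t *\<^sub>R k) - G x)) \<le> L * norm (h - k)"
        if t: "0 < t" "t < e / m" for t
      proof -
        have m: "0 < m" "norm h \<le> m" "norm k \<le> m" by (auto simp: m_def add_pos_nonneg)
        then have tm: "t * m < e" using t by (simp add: pos_less_divide_eq)
        have "t * norm h \<le> t * m" "t * norm k \<le> t * m" using m t by (auto intro!: mult_left_mono)
        then have "t * norm h < e" "t * norm k < e" using tm by linarith+
        then have "G (x + t *\<^sub>R h) = G' (x + t *\<^sub>R h)" "G (x + t *\<^sub>R k) = G' (x + t *\<^sub>R k)"
          using t by (auto intro!: G'[symmetric] simp: dist_norm)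
        moreover have "norm (G' (x + t *\<^sub>R h) - G' (x + t *\<^sub>R k)) \<le> L * (t * norm (h - k))"
          using lipschitz_norm_diff_le[OF lip, of "x + t *\<^sub>R h" "x + t *\<^sub>R k"] t
          by (simp flip: scaleR_diff_right)
        ultimately show ?thesis
          using t by (simp add: pos_divide_le_eq mult_ac flip: scaleR_diff_right)
      qed
      moreover have "0 < e / m" using e by (simp add: m_def add_pos_nonneg)
      ultimately show ?thesis unfolding eventually_at_right_field by blast
    qed
    from tendsto_upperbound[OF tendsto_norm[OF tendsto_diff[OF semismooth_dir_deriv[OF ss, of h]
          semismooth_dir_deriv[OF ss, of k]]] this]
    show ?thesis by simp
  qed
  \<comment> \<open>The vectors \<open>s *\<^sub>R k\<close> below have norm less than
    \<open>2 * \<delta>'\<close>, hence less than both \<delta> and \<open>e\<close>.\<close>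
  define \<delta>' where "\<delta>' = min (\<delta> / 2) (e / 2)"
  have \<delta>': "0 < \<delta>'" using \<delta> e by (simp add: \<delta>'_def)
  have Gd: "norm (G (x + h) - G x - ?d h) \<le> C * norm h powr (1 + \<alpha>)" if h: "norm h < \<delta>'" "h \<noteq> 0" for h
  proof -
    have "norm (G' (x + h) - G' x - ?d h) \<le> C * (norm h + \<rho>) powr (1 + \<alpha>) + L * \<rho>"
      if \<rho>: "0 < \<rho>" "\<rho> < min \<delta>' (norm h)" for \<rho>
    proof (rule radial_mean_value[OF lip \<rho>(1)])
      show "0 \<le> C * (norm h + \<rho>) powr (1 + \<alpha>) + L * \<rho>" using C L0 \<rho> by simp
      fix s k D
      assume s: "0 < s" "s \<le> 1" and k: "norm (k - h) < \<rho>"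
        and D: "(G' has_derivative D) (at (x + s *\<^sub>R k))"
      have "norm k \<le> norm h + \<rho>" using k norm_triangle_ineq2[of k h] by linarith
      have "k \<noteq> 0" using k \<rho> by auto
      have "s * norm k \<le> norm k" using s by (simp add: mult_left_le_one_le)
      also have "\<dots> < 2 * \<delta>'" using \<open>norm k \<le> norm h + \<rho>\<close> h \<rho> by simp
      finally have sk: "norm (s *\<^sub>R k) < 2 * \<delta>'" using s by simp
      then have "x + s *\<^sub>R k \<in> ball x e" by (simp add: dist_norm \<delta>'_def)
      then have D': "(G has_derivative D) (at (x + s *\<^sub>R k))" using D der by simp
      have "norm (D (s *\<^sub>R k) - ?d (s *\<^sub>R k)) \<le> C * norm (s *\<^sub>R k) powr (1 + \<alpha>)"
        using ord[OF _ _ derivative_in_clarke_jac(1)[OF D']] derivative_in_clarke_jac(2)[OF D']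
          sk s \<open>k \<noteq> 0\<close> by (simp add: \<delta>'_def)
      moreover have "D (s *\<^sub>R k) - ?d (s *\<^sub>R k) = s *\<^sub>R (D k - ?d k)"
        using linear_scale[OF has_derivative_linear[OF D]] semismooth_dir_deriv_scaleR[OF ss s(1)]
        by (simp add: scaleR_diff_right)
      \<comment> \<open>The order estimate at \<open>s *\<^sub>R k\<close> will be divided by
        \<open>s\<close>. Since \<open>s \<le> 1\<close>, a full factor \<open>s\<close> can be
        split off the right-hand side, so the bound does not deteriorate close to
        \<open>x\<close>.\<close>
      moreover have "C * norm (s *\<^sub>R k) powr (1 + \<alpha>) \<le> C * (s * norm k powr (1 + \<alpha>))"
      proof (rule mult_left_mono[OF _ C])
        have "norm (s *\<^sub>R k) powr (1 + \<alpha>) = s powr (1 + \<alpha>) * norm k powr (1 + \<alpha>)"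
          using s by (simp add: powr_mult)
        also have "s powr (1 + \<alpha>) \<le> s powr 1" using s \<alpha> by (intro powr_mono') auto
        finally show "norm (s *\<^sub>R k) powr (1 + \<alpha>) \<le> s * norm k powr (1 + \<alpha>)"
          using s by (simp add: mult_right_mono)
      qed
      ultimately have "s * norm (D k - ?d k) \<le> s * (C * norm k powr (1 + \<alpha>))"
        using s by (simp only: norm_scaleR abs_of_pos mult.left_commute[of s C])
      then have "norm (D k - ?d k) \<le> C * norm k powr (1 + \<alpha>)" using s by simp
      also have "\<dots> \<le> C * (norm h + \<rho>) powr (1 + \<alpha>)"
        using C \<alpha> \<open>norm k \<le> norm h + \<rho>\<close> by (intro mult_left_mono powr_mono2) auto
      finally have 1: "norm (D k - ?d k) \<le> C * (norm h + \<rho>) powr (1 + \<alpha>)" .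
      have "norm (?d k - ?d h) \<le> L * \<rho>"
        using dlip[of k h] k L0 mult_left_mono[of "norm (k - h)" \<rho> L] by simp
      with norm_triangle_le[OF add_mono[OF 1 this]] L0 \<rho>
      show "norm (D k - ?d h) \<le> C * (norm h + \<rho>) powr (1 + \<alpha>) + L * \<rho>"
        by simp
    qed
    then have ev: "\<forall>\<^sub>F \<rho> in at_right 0. norm (G' (x + h) - G' x - ?d h) \<le> C * (norm h + \<rho>) powr (1 + \<alpha>) + L * \<rho>"
      unfolding eventually_at_right_field using \<delta>' h by (intro exI[of _ "min \<delta>' (norm h)"]) auto
    have "((\<lambda>\<rho>. C * (norm h + \<rho>) powr (1 + \<alpha>) + L * \<rho>)
        \<longlongrightarrow> C * (norm h + 0) powr (1 + \<alpha>) + L * 0) (at_right 0)"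
      using h by (intro tendsto_intros) auto
    from tendsto_lowerbound[OF this ev]
    have "norm (G' (x + h) - G' x - ?d h) \<le> C * norm h powr (1 + \<alpha>)" by simp
    moreover have "x + h \<in> ball x e" "x \<in> ball x e" using h e by (auto simp: dist_norm \<delta>'_def)
    ultimately show ?thesis using G' by simp
  qed
  show ?thesis
  proof (intro exI[of _ "2 * C"] exI[of _ \<delta>'] conjI \<delta>' allI impI; elim conjE)
    fix h V assume h: "norm h < \<delta>'" and V: "V \<in> clarke_jac G (x + h)"
    show "norm (G (x + h) - G x - blinfun_apply V h) \<le> 2 * C * norm h powr (1 + \<alpha>)"
    proof (cases "h = 0")
      case False
      have "norm (blinfun_apply V h - ?d h) \<le> C * norm h powr (1 + \<alpha>)"
        using h \<delta> V False by (intro ord) (auto simp: \<delta>'_def)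
      then have "norm (?d h - blinfun_apply V h) \<le> C * norm h powr (1 + \<alpha>)"
        by (simp add: norm_minus_commute)
      from norm_triangle_le[OF add_mono[OF Gd[OF h False] this]] show ?thesis by simp
    qed (simp add: blinfun.zero_right)
  qed
qed

section \<open>Newton iteration and eigencomplementary pairs\<close>

lemma newton_step_contraction:
  assumes inv: "\<And>v. c * norm v \<le> norm (blinfun_apply H v)"
    and res: "norm (f - blinfun_apply H (x - z)) \<le> r"
    and step: "blinfun_apply H (x' - x) = - f"
  shows "c * norm (x' - z) \<le> r"
proof -
  have "x' - z = (x' - x) + (x - z)" by simp
  then have "blinfun_apply H (x' - z) = - f + blinfun_apply H (x - z)"
    by (simp only: blinfun.add_right step)
  then have "norm (blinfun_apply H (x' - z)) = norm (f - blinfun_apply H (x - z))"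
    by (simp add: norm_minus_commute)
  then show ?thesis using inv[of "x' - z"] res by linarith
qed

lemma bij_blinfun_if_bounded_below:
  fixes H :: "'a::euclidean_space \<Rightarrow>\<^sub>L 'a"
  assumes "0 < c" "\<And>v. c * norm v \<le> norm (blinfun_apply H v)"
  shows "bij (blinfun_apply H)"
proof -
  have lin: "linear (blinfun_apply H)" by (rule bounded_linear.linear[OF blinfun.bounded_linear_right])
  have "inj (blinfun_apply H)"
    unfolding linear_injective_0[OF lin]
  proof (intro allI impI)
    fix v assume "blinfun_apply H v = 0"
    then have "c * norm v \<le> 0" using assms(2)[of v] by simp
    then show "v = 0" using assms(1) by (simp add: mult_le_0_iff)
  qed
  then show ?thesis using linear_injective_imp_surjective[OF lin] by (simp add: bij_def)
qed

text \<open>The same neighbourhood serves all orders of convergence, because the order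
  only concerns the tail of the sequence.\<close>

theorem newton_local_convergence:
  fixes F :: "'a::euclidean_space \<Rightarrow> 'a" and J :: "'a \<Rightarrow> ('a \<Rightarrow>\<^sub>L 'a) set"
  assumes sol: "F z = 0" and c: "0 < c" and \<delta>0: "0 < \<delta>0"
    and below: "\<forall>x \<in> ball z \<delta>0. \<forall>H \<in> J x. \<forall>v. c * norm v \<le> norm (blinfun_apply H v)"
    and residual: "\<forall>\<epsilon>>0. \<exists>\<delta>>0. \<forall>x \<in> ball z \<delta>. \<forall>H \<in> J x.
      norm (F x - blinfun_apply H (x - z)) \<le> \<epsilon> * norm (x - z)"
  shows "\<exists>U. open U \<and> z \<in> U \<and>
      (\<forall>Hs x n. x 0 \<in> U \<and>
        (\<forall>k<n. Hs k \<in> J (x k) \<and> blinfun_apply (Hs k) (x (Suc k) - x k) = - F (x k)) \<and>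
        Hs n \<in> J (x n) \<longrightarrow> bij (blinfun_apply (Hs n))) \<and>
      (\<forall>Hs x. x 0 \<in> U \<and>
        (\<forall>k. Hs k \<in> J (x k) \<and> blinfun_apply (Hs k) (x (Suc k) - x k) = - F (x k)) \<longrightarrow>
        x \<longlonglongrightarrow> z \<and> (\<forall>\<epsilon>>0. \<forall>\<^sub>F k in sequentially. norm (x (Suc k) - z) \<le> \<epsilon> * norm (x k - z))) \<and>
      (\<forall>Hs x \<alpha> C \<delta>. x 0 \<in> U \<and>
        (\<forall>k. Hs k \<in> J (x k) \<and> blinfun_apply (Hs k) (x (Suc k) - x k) = - F (x k)) \<and>
        0 < \<delta> \<and> (\<forall>y \<in> ball z \<delta>. \<forall>H \<in> J y. norm (F y - blinfun_apply H (y - z)) \<le> C * norm (y - z) powr (1 + \<alpha>)) \<longrightarrow>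
        (\<exists>K. \<forall>\<^sub>F k in sequentially. norm (x (Suc k) - z) \<le> K * norm (x k - z) powr (1 + \<alpha>)))"
proof -
  note inv = below[rule_format] and res = residual[rule_format]
  \<comment> \<open>Against the lower bound \<open>c\<close>, a relative residual of
    \<open>c / 2\<close> halves the distance to the solution.\<close>
  obtain \<delta>1 where \<delta>1: "0 < \<delta>1"
    "\<And>x H. x \<in> ball z \<delta>1 \<Longrightarrow> H \<in> J x \<Longrightarrow> norm (F x - blinfun_apply H (x - z)) \<le> c / 2 * norm (x - z)"
    using res[of "c / 2"] c by auto
  define U where "U = ball z (min \<delta>0 \<delta>1)"
  have contract: "norm (x' - z) \<le> norm (x - z) / 2"
    if "x \<in> U" "H \<in> J x" "blinfun_apply H (x' - x) = - F x" for x x' H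
  proof -
    have "c * norm (x' - z) \<le> c / 2 * norm (x - z)"
    proof (rule newton_step_contraction[OF _ _ that(3)])
      show "c * norm v \<le> norm (blinfun_apply H v)" for v
        using that by (intro inv[of x]) (auto simp: U_def)
      show "norm (F x - blinfun_apply H (x - z)) \<le> c / 2 * norm (x - z)"
        using that by (intro \<delta>1(2)) (auto simp: U_def)
    qed
    then show ?thesis using c by simp
  qed
  have stepU: "x' \<in> U" if "x \<in> U" "H \<in> J x" "blinfun_apply H (x' - x) = - F x" for x x' H
    using contract[OF that] that(1) norm_ge_zero[of "x - z"]
    unfolding U_def mem_ball dist_norm norm_minus_commute[of z] by linarith
  \<comment> \<open>Stated for finite runs, because invertibility of \<open>Hs n\<close> is claimed
    when only the steps before \<open>n\<close> have been carried out.\<close>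
  have stay: "x k \<in> U"
    if "x 0 \<in> U" "\<forall>k<n. Hs k \<in> J (x k) \<and> blinfun_apply (Hs k) (x (Suc k) - x k) = - F (x k)" "k \<le> n"
    for x Hs n k
    using that(3)
  proof (induction k)
    case (Suc k)
    then show ?case using that(2) stepU[of "x k" "Hs k" "x (Suc k)"] by auto
  qed (use that(1) in simp)
  have conv: "x \<longlonglongrightarrow> z" and inU: "x k \<in> U"
    if x0: "x 0 \<in> U" and it: "\<forall>k. Hs k \<in> J (x k) \<and> blinfun_apply (Hs k) (x (Suc k) - x k) = - F (x k)"
    for x Hs k
  proof -
    have U: "x k \<in> U" for k using stay[of x k Hs k] that by auto
    then show "x k \<in> U" .
    have geo: "norm (x k - z) \<le> norm (x 0 - z) * (1 / 2) ^ k" for k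
    proof (induction k)
      case (Suc k)
      have "norm (x (Suc k) - z) \<le> norm (x k - z) / 2" using contract[OF U] it by blast
      with Suc show ?case by simp
    qed simp
    have "(\<lambda>k. norm (x 0 - z) * (1 / 2) ^ k) \<longlonglongrightarrow> norm (x 0 - z) * 0"
      by (intro tendsto_intros LIMSEQ_power_zero) simp
    then have "(\<lambda>k. x k - z) \<longlonglongrightarrow> 0"
      using Lim_null_comparison[OF always_eventually[OF allI[OF geo]]] by simp
    then show "x \<longlonglongrightarrow> z" by (simp add: LIM_zero_iff)
  qed
  \<comment> \<open>The bound \<open>r\<close> is arbitrary, so the superlinear rate and the rate of
    order \<open>1 + \<alpha>\<close> are both instances.\<close>
  have tail: "\<forall>\<^sub>F k in sequentially. c * norm (x (Suc k) - z) \<le> r (x k)"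
    if x0: "x 0 \<in> U" and it: "\<forall>k. Hs k \<in> J (x k) \<and> blinfun_apply (Hs k) (x (Suc k) - x k) = - F (x k)"
      and \<delta>: "0 < \<delta>" and r: "\<forall>y \<in> ball z \<delta>. \<forall>H \<in> J y. norm (F y - blinfun_apply H (y - z)) \<le> r y"
    for x Hs \<delta> r
  proof -
    have "\<forall>\<^sub>F k in sequentially. dist (x k) z < \<delta>" by (rule tendstoD[OF conv[OF x0 it] \<delta>])
    then show ?thesis
    proof eventually_elim
      case (elim k)
      have Hk: "Hs k \<in> J (x k)" and st: "blinfun_apply (Hs k) (x (Suc k) - x k) = - F (x k)" using it by auto
      have "x k \<in> ball z \<delta>0" using inU[OF x0 it, of k] by (simp add: U_def)
      from newton_step_contraction[OF inv[OF this Hk] _ st] r Hk elim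
      show ?case by (simp add: dist_commute)
    qed
  qed
  show ?thesis
  proof (intro exI[of _ U] conjI allI impI; (elim conjE)?)
    show "open U" "z \<in> U" using \<delta>0 \<delta>1(1) by (auto simp: U_def)
  next
    fix Hs x n
    assume x0: "x 0 \<in> U" and it: "\<forall>k<n. Hs k \<in> J (x k) \<and> blinfun_apply (Hs k) (x (Suc k) - x k) = - F (x k)"
      and Hn: "Hs n \<in> J (x n)"
    have "x n \<in> ball z \<delta>0" using stay[OF x0 it, of n] by (simp add: U_def)
    then show "bij (blinfun_apply (Hs n))"
      by (intro bij_blinfun_if_bounded_below[OF c] inv[OF _ Hn])
  next
    fix Hs x
    assume x0: "x 0 \<in> U" and it: "\<forall>k. Hs k \<in> J (x k) \<and> blinfun_apply (Hs k) (x (Suc k) - x k) = - F (x k)"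
    show "x \<longlonglongrightarrow> z" by (rule conv[OF x0 it])
    fix \<epsilon> :: real assume \<epsilon>: "0 < \<epsilon>"
    then obtain \<delta> where "0 < \<delta>"
      "\<forall>y \<in> ball z \<delta>. \<forall>H \<in> J y. norm (F y - blinfun_apply H (y - z)) \<le> c * \<epsilon> * norm (y - z)"
      using res[of "c * \<epsilon>"] c by auto
    from tail[OF x0 it this]
    show "\<forall>\<^sub>F k in sequentially. norm (x (Suc k) - z) \<le> \<epsilon> * norm (x k - z)"
      by eventually_elim (use c in simp)
  next
    fix Hs x \<alpha> C \<delta>
    assume x0: "x 0 \<in> U" and it: "\<forall>k. Hs k \<in> J (x k) \<and> blinfun_apply (Hs k) (x (Suc k) - x k) = - F (x k)"
      and \<delta>: "0 < \<delta>" "\<forall>y \<in> ball z \<delta>. \<forall>H \<in> J y. norm (F y - blinfun_apply H (y - z)) \<le> C * norm (y - z) powr (1 + \<alpha>)"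
    from tail[OF x0 it \<delta>]
    have "\<forall>\<^sub>F k in sequentially. norm (x (Suc k) - z) \<le> (C / c) * norm (x k - z) powr (1 + \<alpha>)"
      by eventually_elim (use c in \<open>simp add: field_simps\<close>)
    then show "\<exists>K. \<forall>\<^sub>F k in sequentially. norm (x (Suc k) - z) \<le> K * norm (x k - z) powr (1 + \<alpha>)" by blast
  qed
qed

section \<open>Eigencomplementary pairs\<close>

lemma symmetric_matrix_inner:
  fixes X :: "real^'n^'n"
  assumes "transpose X = X"
  shows "(X *v a) \<bullet> b = a \<bullet> (X *v b)"
proof -
  have "(transpose X *v a) \<bullet> b = a \<bullet> (X *v b)"
    unfolding transpose_matrix_vector by (rule dot_lmul_matrix)
  then show ?thesis by (simp add: assms)
qed

text \<open>A common eigenbasis need not be orthogonal, but eigenvectors that are not orthogonal to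
  each other share both eigenvalues, so that the form below is the squared norm of the
  combination rescaled by \<open>sqrt (- \<xi> * \<mu>)\<close>.\<close>

lemma commuting_eigenbasis_inner_le_0:
  fixes F G :: "real^'l^'l"
  assumes symF: "transpose F = F" and symG: "transpose G = G"
    and F: "\<And>v. v \<bullet> (F *v v) \<le> 0" and G: "\<And>v. 0 \<le> v \<bullet> (G *v v)"
    and E: "independent E" "span E = UNIV"
      "\<And>v. v \<in> E \<Longrightarrow> (\<exists>\<xi>. F *v v = \<xi> *\<^sub>R v) \<and> (\<exists>\<mu>. G *v v = \<mu> *\<^sub>R v)"
  shows "(F *v w) \<bullet> (G *v w) \<le> 0" and "F *v (G *v w) = G *v (F *v w)"
proof -
  have fin: "finite E" using E(1) by (rule independent_imp_finite)
  have "\<forall>v\<in>E. \<exists>\<xi> \<mu>. F *v v = \<xi> *\<^sub>R v \<and> G *v v = \<mu> *\<^sub>R v" using E(3) by blast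
  then obtain \<xi> \<mu> where ev: "\<And>v. v \<in> E \<Longrightarrow> F *v v = \<xi> v *\<^sub>R v" "\<And>v. v \<in> E \<Longrightarrow> G *v v = \<mu> v *\<^sub>R v"
    by metis
  have sa: "(F *v a) \<bullet> b = a \<bullet> (F *v b)" "(G *v a) \<bullet> b = a \<bullet> (G *v b)" for a b
    using symmetric_matrix_inner[OF symF] symmetric_matrix_inner[OF symG] by auto
  have sign: "\<xi> v \<le> 0" "0 \<le> \<mu> v" if "v \<in> E" for v
  proof -
    have "v \<noteq> 0" using that E(1) dependent_zero by blast
    then show "\<xi> v \<le> 0" "0 \<le> \<mu> v"
      using F[of v] G[of v] ev[OF that] by (auto simp: mult_le_0_iff zero_le_mult_iff dot_square_norm)
  qed
  have orth: "v \<bullet> u = 0" if "v \<in> E" "u \<in> E" "\<xi> v \<noteq> \<xi> u \<or> \<mu> v \<noteq> \<mu> u" for v u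
    using sa[of v u] ev that by auto
  obtain a where w: "w = (\<Sum>v\<in>E. a v *\<^sub>R v)"
    using E(2) span_finite[OF fin] by (metis (mono_tags, lifting) UNIV_I imageE)
  have Fw: "F *v w = (\<Sum>v\<in>E. (a v * \<xi> v) *\<^sub>R v)" and Gw: "G *v w = (\<Sum>v\<in>E. (a v * \<mu> v) *\<^sub>R v)"
    unfolding w by (simp_all add: ev matrix_vector_mult_scaleR linear_sum[OF matrix_vector_mul_linear] cong: sum.cong)
  show "F *v (G *v w) = G *v (F *v w)"
    unfolding Fw Gw
    by (simp add: ev matrix_vector_mult_scaleR linear_sum[OF matrix_vector_mul_linear] mult_ac cong: sum.cong)
  have inner_comb: "(\<Sum>v\<in>E. p v *\<^sub>R v) \<bullet> (\<Sum>v\<in>E. q v *\<^sub>R v) = (\<Sum>v\<in>E. \<Sum>v'\<in>E. p v * q v' * (v \<bullet> v'))" for p q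
    unfolding inner_sum_left unfolding inner_sum_right by (simp add: mult_ac)
  define u where "u = (\<Sum>v\<in>E. (a v * sqrt (- \<xi> v * \<mu> v)) *\<^sub>R v)"
  have "- ((F *v w) \<bullet> (G *v w)) = (\<Sum>v\<in>E. \<Sum>v'\<in>E. - ((a v * \<xi> v) * (a v' * \<mu> v') * (v \<bullet> v')))"
    unfolding Fw Gw inner_comb by (simp add: sum_negf)
  also have "\<dots> = (\<Sum>v\<in>E. \<Sum>v'\<in>E. (a v * sqrt (- \<xi> v * \<mu> v)) * (a v' * sqrt (- \<xi> v' * \<mu> v')) * (v \<bullet> v'))"
  proof (intro sum.cong refl)
    fix v v' assume v: "v \<in> E" "v' \<in> E"
    show "- ((a v * \<xi> v) * (a v' * \<mu> v') * (v \<bullet> v'))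
        = (a v * sqrt (- \<xi> v * \<mu> v)) * (a v' * sqrt (- \<xi> v' * \<mu> v')) * (v \<bullet> v')"
    proof (cases "\<xi> v = \<xi> v' \<and> \<mu> v = \<mu> v'")
      case True
      have "0 \<le> - \<xi> v' * \<mu> v'" using sign[OF v(2)] by (simp add: mult_nonpos_nonneg)
      then have "sqrt (- \<xi> v' * \<mu> v') * sqrt (- \<xi> v' * \<mu> v') = - \<xi> v' * \<mu> v'" by simp
      then have "a v * a v' * (v \<bullet> v') * (sqrt (- \<xi> v' * \<mu> v') * sqrt (- \<xi> v' * \<mu> v'))
          = a v * a v' * (v \<bullet> v') * (- \<xi> v' * \<mu> v')" by (simp only:)
      then show ?thesis using True by (simp add: mult_ac)
    next
      case False
      then show ?thesis using orth[OF v] by auto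
    qed
  qed
  also have "\<dots> = u \<bullet> u"
    unfolding u_def inner_comb ..
  finally show "(F *v w) \<bullet> (G *v w) \<le> 0" using inner_ge_zero[of u] by linarith
qed

lemma invertible_matrix_vector_bij:
  fixes A :: "real^'n^'n"
  assumes "invertible A"
  shows "\<exists>x. A *v x = b" and "A *v x = 0 \<Longrightarrow> x = 0"
proof -
  obtain A' where A': "A ** A' = mat 1" "A' ** A = mat 1"
    using assms by (auto simp: invertible_def)
  have "A *v (A' *v b) = b" by (simp add: matrix_vector_mul_assoc A')
  then show "\<exists>x. A *v x = b" by blast
  assume "A *v x = 0"
  then have "(A' ** A) *v x = 0" by (simp flip: matrix_vector_mul_assoc)
  then show "x = 0" by (simp add: A')
qed

text \<open>If \<open>Y\<close> is invertible, write \<open>b = Y w\<close>; commutation gives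
  \<open>c = - X w\<close>, and the sign of the form in \<open>X w\<close> and \<open>Y w\<close>
  concludes. An invertible \<open>X\<close> is treated symmetrically. If both are singular, the
  eigenspace condition forces \<open>X b = 0\<close> and \<open>Y c = 0\<close> and makes the two
  kernels orthogonal, so that \<open>b \<bullet> c\<close> is even 0.\<close>

lemma eigencomplementary_kernel:
  fixes X Y :: "real^'l^'l"
  assumes ec: "eigencomplementary X Y" and eq: "X *v b + Y *v c = 0"
  shows "0 \<le> b \<bullet> c"
proof -
  from ec have symX: "transpose X = X" and symY: "transpose Y = Y"
    and X: "\<And>v. v \<bullet> (X *v v) \<le> 0" and Y: "\<And>v. 0 \<le> v \<bullet> (Y *v v)"
    and sing: "\<not> invertible X \<Longrightarrow> \<not> invertible Y \<Longrightarrow>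
        span (\<Union>{{v. X *v v = \<xi> *\<^sub>R v} | \<xi>. \<xi> < 0}) = {v. Y *v v = 0}"
    by (auto simp: eigencomplementary_def)
  from ec obtain E where E: "independent E" "span E = UNIV"
      "\<And>v. v \<in> E \<Longrightarrow> (\<exists>\<xi>. X *v v = \<xi> *\<^sub>R v) \<and> (\<exists>\<mu>. Y *v v = \<mu> *\<^sub>R v)"
    unfolding eigencomplementary_def by blast
  note form = commuting_eigenbasis_inner_le_0[OF symX symY X Y E]
  have sa: "(X *v a) \<bullet> b = a \<bullet> (X *v b)" "(Y *v a) \<bullet> b = a \<bullet> (Y *v b)" for a b
    using symmetric_matrix_inner[OF symX] symmetric_matrix_inner[OF symY] by auto
  have eq': "X *v b = - (Y *v c)" using eq by (simp add: eq_neg_iff_add_eq_0)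
  show ?thesis
  proof (cases "invertible Y")
    case True
    then obtain w where w: "b = Y *v w" using invertible_matrix_vector_bij(1)[OF True] by metis
    have "Y *v (c + X *v w) = 0"
      using eq' form(2)[of w] by (simp add: w matrix_vector_right_distrib)
    then have "c + X *v w = 0" by (rule invertible_matrix_vector_bij(2)[OF True])
    then have "c = - (X *v w)" by (simp add: eq_neg_iff_add_eq_0)
    then show ?thesis using form(1)[of w] by (simp add: w inner_commute)
  next
    case Y_sing: False
    show ?thesis
    proof (cases "invertible X")
      case True
      then obtain w where w: "c = X *v w" using invertible_matrix_vector_bij(1)[OF True] by metis
      have "X *v (b + Y *v w) = 0"
        using eq' form(2)[of w] by (simp add: w matrix_vector_right_distrib)
      then have "b + Y *v w = 0" by (rule invertible_matrix_vector_bij(2)[OF True])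
      then have "b = - (Y *v w)" by (simp add: eq_neg_iff_add_eq_0)
      then show ?thesis using form(1)[of w] by (simp add: w inner_commute)
    next
      case False
      note N = sing[OF False Y_sing]
      \<comment> \<open>The range of \<open>X\<close> is spanned by eigenvectors with negative
        eigenvalue, and these lie in the kernel of \<open>Y\<close>.\<close>
      have ranX: "Y *v (X *v v) = 0" for v
      proof -
        have "X *v v \<in> span (\<Union>{{v. X *v v = \<xi> *\<^sub>R v} | \<xi>. \<xi> < 0})" for v
        proof -
          have "v \<in> span E" using E(2) by simp
          then show ?thesis
          proof (induction rule: span_induct_alt)
            case (step a v u)
            obtain \<xi> where \<xi>: "X *v v = \<xi> *\<^sub>R v" using E(3) step by blast
            have "v \<noteq> 0" using step E(1) dependent_zero by blast
            then have "\<xi> \<le> 0" using X[of v] \<xi> by (auto simp: mult_le_0_iff dot_square_norm)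
            have "X *v v \<in> span (\<Union>{{v. X *v v = \<xi> *\<^sub>R v} | \<xi>. \<xi> < 0})"
            proof (cases "\<xi> = 0")
              case False
              then have "v \<in> \<Union>{{v. X *v v = \<xi> *\<^sub>R v} | \<xi>. \<xi> < 0}"
                using \<xi> \<open>\<xi> \<le> 0\<close> by (intro UnionI[of "{v. X *v v = \<xi> *\<^sub>R v}"]) auto
              then show ?thesis unfolding \<xi> by (intro span_scale span_base)
            qed (simp add: \<xi> span_zero)
            then show ?case
              using step by (simp add: matrix_vector_right_distrib matrix_vector_mult_scaleR span_add span_scale)
          qed (simp add: span_zero)
        qed
        then show ?thesis using N by auto
      qed
      \<comment> \<open>\<open>c\<close> is a combination of eigenvectors of \<open>X\<close> with
        nonzero eigenvalue, which are orthogonal to the kernel of the symmetric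
        \<open>X\<close>.\<close>
      have kerX: "v \<bullet> c = 0" if "X *v b = 0" "Y *v c = 0" "v = b" for v
      proof -
        have "c \<in> span (\<Union>{{v. X *v v = \<xi> *\<^sub>R v} | \<xi>. \<xi> < 0})" using N that by auto
        then show ?thesis
        proof (induction rule: span_induct_alt)
          case (step r u y)
          then obtain \<xi> where "\<xi> < 0" "X *v u = \<xi> *\<^sub>R u" by auto
          moreover have "b \<bullet> (X *v u) = 0" using sa(1)[of b u] that by simp
          ultimately have "b \<bullet> u = 0" by simp
          then show ?case using step that by (simp add: inner_add_right)
        qed simp
      qed
      \<comment> \<open>Since \<open>Y\<close> annihilates the range of \<open>X\<close>, the
        equation \<open>X b = - Y c\<close> makes \<open>X b\<close> orthogonal to itself.\<close>
      have "(X *v b) \<bullet> (X *v b) = - ((Y *v c) \<bullet> (X *v b))" using eq' by simp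
      also have "\<dots> = 0" using sa(2) ranX by simp
      finally have "X *v b = 0" by simp
      then show ?thesis using kerX eq' by simp
    qed
  qed
qed

section \<open>The Clarke Jacobian of the coupled system\<close>

text \<open>The Bouligand subdifferential. Sequence and compactness arguments are carried out for
  it, before the convex hull is taken.\<close>

definition deriv_limits :: "('a::euclidean_space \<Rightarrow> 'b::euclidean_space) \<Rightarrow> 'a \<Rightarrow> ('a \<Rightarrow>\<^sub>L 'b) set" where
  "deriv_limits G x = {V. \<exists>xs Df. xs \<longlonglongrightarrow> x \<and>
     (\<forall>n. (G has_derivative blinfun_apply (Df n)) (at (xs n))) \<and> Df \<longlonglongrightarrow> V}"

lemma clarke_jac_eq_hull: "clarke_jac G x = convex hull (deriv_limits G x)"
  by (simp add: clarke_jac_def deriv_limits_def)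

text \<open>A property of derivatives that is closed under limits and convex combinations passes to
  all Clarke elements.\<close>

lemma clarke_jac_subset_closed_convex:
  assumes "closed T" "convex T" "\<And>y D. (G has_derivative blinfun_apply D) (at y) \<Longrightarrow> D \<in> T"
  shows "clarke_jac G x \<subseteq> T"
  unfolding clarke_jac_eq_hull
proof (rule hull_minimal)
  show "convex T" by fact
  show "deriv_limits G x \<subseteq> T"
    unfolding deriv_limits_def using closed_sequentially[OF assms(1)] assms(3) by blast
qed

text \<open>Derivatives near \<open>x\<close> are bounded by the local Lipschitz constant. A
  sequence of them at points tending to \<open>x\<close> therefore has a convergent subsequence,
  whose limit is in \<open>deriv_limits G x\<close> by construction and cannot be \<epsilon> away
  from all its terms.\<close>

lemma deriv_limits_near:
  assumes lip: "locally_lipschitz_near G x" and \<epsilon>: "0 < \<epsilon>"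
  shows "\<exists>\<delta>>0. \<forall>y \<in> ball x \<delta>. \<forall>D. (G has_derivative blinfun_apply D) (at y) \<longrightarrow>
    (\<exists>V \<in> deriv_limits G x. norm (D - V) < \<epsilon>)"
proof (rule ccontr)
  from locally_lipschitz_near_extension[OF lip] obtain G' L e
    where e: "0 < e" and lipG': "L-lipschitz_on UNIV G'" and ext: "\<forall>y\<in>ball x e. G' y = G y \<and>
      (\<forall>D. (G' has_derivative D) (at y) \<longleftrightarrow> (G has_derivative D) (at y))"
    by (elim exE conjE)
  assume neg: "\<not> (\<exists>\<delta>>0. \<forall>y \<in> ball x \<delta>. \<forall>D. (G has_derivative blinfun_apply D) (at y) \<longrightarrow>
    (\<exists>V \<in> deriv_limits G x. norm (D - V) < \<epsilon>))"
  have "\<exists>y D. y \<in> ball x (e / real (Suc n)) \<and> (G has_derivative blinfun_apply D) (at y) \<and>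
      (\<forall>V \<in> deriv_limits G x. \<epsilon> \<le> norm (D - V))" for n
  proof -
    have "0 < e / real (Suc n)" using e by simp
    with neg show ?thesis unfolding not_less[symmetric] by blast
  qed
  then obtain y D where y: "\<And>n. y n \<in> ball x (e / real (Suc n))"
    and D: "\<And>n. (G has_derivative blinfun_apply (D n)) (at (y n))"
    and far: "\<And>n V. V \<in> deriv_limits G x \<Longrightarrow> \<epsilon> \<le> norm (D n - V)"
    by metis
  have yx: "y \<longlonglongrightarrow> x"
  proof (rule metric_tendsto_imp_tendsto)
    show "(\<lambda>n. e / real (Suc n)) \<longlonglongrightarrow> 0"
      using filterlim_inverse_Suc_at_right[OF e] by (simp add: filterlim_at)
    show "\<forall>\<^sub>F n in sequentially. dist (y n) x \<le> dist (e / real (Suc n)) 0"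
      using y e by (intro always_eventually) (auto simp: dist_commute less_imp_le)
  qed
  have "norm (D n) \<le> L" for n
  proof (rule norm_blinfun_bound)
    fix v
    have "e / real (Suc n) \<le> e" using e by (simp add: pos_divide_le_eq)
    then have "y n \<in> ball x e" using y[of n] by simp
    then have "(G' has_derivative blinfun_apply (D n)) (at (y n))" using ext D by blast
    from has_derivative_norm_le_lipschitz[OF lipG' this]
    show "norm (blinfun_apply (D n) v) \<le> L * norm v" .
  qed (rule lipschitz_on_nonneg[OF lipG'])
  then have "\<forall>n. D n \<in> cball 0 L" by simp
  then obtain V r where r: "strict_mono r" and V: "(D \<circ> r) \<longlonglongrightarrow> V"
    using compact_cball[of 0 L] unfolding compact_def by metis
  have "V \<in> deriv_limits G x"
    unfolding deriv_limits_def
    using LIMSEQ_subseq_LIMSEQ[OF yx r] V D by (auto intro!: exI[of _ "y \<circ> r"] exI[of _ "D \<circ> r"])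
  then have "\<epsilon> \<le> norm ((D \<circ> r) n - V)" for n using far by simp
  moreover have "(\<lambda>n. norm ((D \<circ> r) n - V)) \<longlonglongrightarrow> 0"
    by (rule tendsto_norm_zero[OF LIM_zero[OF V]])
  ultimately have "\<epsilon> \<le> 0" by (intro LIMSEQ_le_const) auto
  then show False using \<epsilon> by simp
qed

lemma compact_deriv_limits:
  assumes lip: "locally_lipschitz_near G x"
  shows "compact (deriv_limits G x)"
proof -
  from locally_lipschitz_near_extension[OF lip] obtain G' L e
    where e: "0 < e" and lipG': "L-lipschitz_on UNIV G'" and ext: "\<forall>y\<in>ball x e. G' y = G y \<and>
      (\<forall>D. (G' has_derivative D) (at y) \<longleftrightarrow> (G has_derivative D) (at y))"
    by (elim exE conjE)
  have "norm V \<le> L" if V: "V \<in> deriv_limits G x" for V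
  proof -
    obtain y D where y: "y \<longlonglongrightarrow> x" and D: "\<And>n. (G has_derivative blinfun_apply (D n)) (at (y n))"
      and DV: "D \<longlonglongrightarrow> V"
      using V by (auto simp: deriv_limits_def)
    have "\<forall>\<^sub>F n in sequentially. norm (D n) \<le> L"
      using tendstoD[OF y e]
    proof eventually_elim
      case (elim n)
      then have "(G' has_derivative blinfun_apply (D n)) (at (y n))"
        using ext D by (simp add: dist_commute)
      from has_derivative_norm_le_lipschitz[OF lipG' this]
      show ?case by (rule norm_blinfun_bound[OF lipschitz_on_nonneg[OF lipG']])
    qed
    with tendsto_norm[OF DV] show ?thesis by (rule tendsto_upperbound) simp
  qed
  then have bdd: "bounded (deriv_limits G x)" by (auto simp: bounded_iff)
  have "closed (deriv_limits G x)"
    unfolding closed_sequential_limits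
  proof (intro allI impI; elim conjE)
    fix W V assume W: "\<forall>n. W n \<in> deriv_limits G x" and WV: "W \<longlonglongrightarrow> V"
    \<comment> \<open>Diagonal choice: from the sequence representing \<open>W n\<close>, one point
      and one derivative, both with error below \<open>1 / Suc n\<close>.\<close>
    have "\<exists>y D. dist y x < 1 / real (Suc n) \<and> (G has_derivative blinfun_apply D) (at y) \<and>
        dist D (W n) < 1 / real (Suc n)" for n
    proof -
      obtain y D where y: "y \<longlonglongrightarrow> x" and D: "\<And>k. (G has_derivative blinfun_apply (D k)) (at (y k))"
        and DW: "D \<longlonglongrightarrow> W n"
        using W by (force simp: deriv_limits_def)
      have p: "0 < 1 / real (Suc n)" by simp
      from eventually_conj[OF tendstoD[OF y p] tendstoD[OF DW p]] show ?thesis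
        using D by (auto simp: eventually_sequentially)
    qed
    then obtain y D where y: "\<And>n. dist (y n) x < 1 / real (Suc n)"
      and D: "\<And>n. (G has_derivative blinfun_apply (D n)) (at (y n))"
      and DW: "\<And>n. dist (D n) (W n) < 1 / real (Suc n)"
      by metis
    have z: "(\<lambda>n. 1 / real (Suc n)) \<longlonglongrightarrow> 0"
      using filterlim_inverse_Suc_at_right[of 1] by (simp add: filterlim_at)
    have "y \<longlonglongrightarrow> x"
      by (rule metric_tendsto_imp_tendsto[OF z]) (use y in \<open>auto intro!: always_eventually less_imp_le\<close>)
    moreover have "D \<longlonglongrightarrow> V"
    proof -
      have "(\<lambda>n. D n - W n) \<longlonglongrightarrow> 0"
        by (rule metric_tendsto_imp_tendsto[OF z])
          (use DW in \<open>auto intro!: always_eventually less_imp_le simp: dist_norm\<close>)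
      from tendsto_add[OF this WV] show ?thesis by simp
    qed
    ultimately show "V \<in> deriv_limits G x" using D by (auto simp: deriv_limits_def)
  qed
  with bdd show ?thesis by (simp add: compact_eq_bounded_closed)
qed

lemma clarke_jac_upper_semicontinuous:
  assumes lip: "locally_lipschitz_near G x" and \<epsilon>: "0 < \<epsilon>"
  shows "\<exists>\<delta>>0. \<forall>y \<in> ball x \<delta>. \<forall>H \<in> clarke_jac G y. \<exists>V \<in> clarke_jac G x. norm (H - V) \<le> \<epsilon>"
proof -
  obtain \<delta> where \<delta>: "0 < \<delta>" and near: "\<And>y D. y \<in> ball x \<delta> \<Longrightarrow>
      (G has_derivative blinfun_apply D) (at y) \<Longrightarrow> \<exists>V \<in> deriv_limits G x. norm (D - V) < \<epsilon> / 2"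
    using deriv_limits_near[OF lip, of "\<epsilon> / 2"] \<epsilon> by auto
  \<comment> \<open>The closed \<epsilon>-neighbourhood of a convex set is convex, so it suffices to
    place limits of derivatives in it; the hull follows. One half of \<epsilon> is spent on the
    limit, the other on the distance of derivatives to \<open>deriv_limits G x\<close>.\<close>
  define T where "T = (\<Union>V\<in>clarke_jac G x. \<Union>E\<in>cball 0 \<epsilon>. {V + E})"
  have "convex T" unfolding T_def
    by (intro convex_sums convex_cball) (simp add: clarke_jac_eq_hull convex_convex_hull)
  have "clarke_jac G y \<subseteq> T" if y: "y \<in> ball x \<delta>" for y
    unfolding clarke_jac_eq_hull[of G y]
  proof (rule hull_minimal[OF subsetI])
    show "convex T" by fact
    fix H assume "H \<in> deriv_limits G y"
    then obtain ys D where ys: "ys \<longlonglongrightarrow> y" and D: "\<And>n. (G has_derivative blinfun_apply (D n)) (at (ys n))"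
      and DH: "D \<longlonglongrightarrow> H"
      by (auto simp: deriv_limits_def)
    have "\<forall>\<^sub>F n in sequentially. ys n \<in> ball x \<delta>"
      by (rule topological_tendstoD[OF ys open_ball y])
    moreover have "\<forall>\<^sub>F n in sequentially. dist (D n) H < \<epsilon> / 2"
      using \<epsilon> by (intro tendstoD[OF DH]) simp
    ultimately have "\<forall>\<^sub>F n in sequentially. ys n \<in> ball x \<delta> \<and> dist (D n) H < \<epsilon> / 2"
      by (rule eventually_conj)
    then obtain n where n: "ys n \<in> ball x \<delta>" "dist (D n) H < \<epsilon> / 2"
      by (auto simp: eventually_sequentially)
    obtain V where V: "V \<in> deriv_limits G x" "norm (D n - V) < \<epsilon> / 2"
      using near[OF n(1) D] by blast
    have "norm (H - V) \<le> \<epsilon>"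
      using norm_triangle_ineq[of "H - D n" "D n - V"] n(2) V(2)
      by (simp add: dist_norm norm_minus_commute)
    moreover have "V \<in> clarke_jac G x" using V(1) by (simp add: clarke_jac_eq_hull hull_inc)
    ultimately show "H \<in> T"
      unfolding T_def by (intro UN_I[of V] UN_I[of "H - V"]) auto
  qed
  then have "\<exists>V \<in> clarke_jac G x. norm (H - V) \<le> \<epsilon>" if "y \<in> ball x \<delta>" "H \<in> clarke_jac G y" for y H
  proof -
    have "H \<in> T" using \<open>\<And>y. y \<in> ball x \<delta> \<Longrightarrow> clarke_jac G y \<subseteq> T\<close> that by blast
    then obtain V E where "V \<in> clarke_jac G x" "norm E \<le> \<epsilon>" "H = V + E" by (auto simp: T_def)
    then show ?thesis by (intro bexI[of _ V]) simp_all
  qed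
  then show ?thesis using \<delta> by blast
qed

section \<open>Block structure of the system and its Jacobians\<close>

definition unblk :: "'n::finite \<Rightarrow> real^'l \<Rightarrow> real^('n \<times> 'l::finite)" where
  "unblk i w = (\<chi> p. if fst p = i then w $ snd p else 0)"

lemma blk_unblk [simp]: "blk (unblk i w) i = w"
  by (simp add: blk_def unblk_def)

lemma blk_nth [simp]: "blk v i $ j = v $ (i, j)"
  by (simp add: blk_def)

type_synonym ('a, 'n, 'l) state = "(real^'a) \<times> (real^('n \<times> 'l)) \<times> (real^('n \<times> 'l))"

definition block_in :: "'n \<Rightarrow> ('a::finite, 'n::finite, 'l::finite) state \<Rightarrow> (real^'l) \<times> (real^'l)" where
  "block_in i x = (blk (fst (snd x)) i, blk (snd (snd x)) i)"

definition block_embed :: "'n \<Rightarrow> (real^'l) \<times> (real^'l) \<Rightarrow> ('a::finite, 'n::finite, 'l::finite) state" where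
  "block_embed i z = (0, unblk i (fst z), unblk i (snd z))"

definition block_out :: "'n \<Rightarrow> ('a::finite, 'n::finite, 'l::finite) state \<Rightarrow> real^'l" where
  "block_out i x = blk (snd (snd x)) i"

lemma block_in_embed [simp]: "block_in i (block_embed i z) = z"
  by (simp add: block_in_def block_embed_def)

lemma bounded_linear_block_in: "bounded_linear (block_in i)"
  unfolding linear_conv_bounded_linear[symmetric]
  by (rule linearI) (simp_all add: block_in_def vec_eq_iff)

lemma bounded_linear_block_embed: "bounded_linear (block_embed i)"
  unfolding linear_conv_bounded_linear[symmetric]
  by (rule linearI) (simp_all add: block_embed_def unblk_def vec_eq_iff zero_prod_def)

lemma bounded_linear_block_out: "bounded_linear (block_out i)"
  unfolding linear_conv_bounded_linear[symmetric]
  by (rule linearI) (simp_all add: block_out_def vec_eq_iff)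

text \<open>The blocks \<open>X_i\<close> and \<open>Y_i\<close> of \<open>H\<close> as one linear
  map of the pair of block arguments. Composing with fixed linear maps makes it linear and
  continuous in \<open>H\<close>, so it passes through limits and convex hulls.\<close>

definition block_jac :: "'n \<Rightarrow> ('a::finite, 'n::finite, 'l::finite) state \<Rightarrow>\<^sub>L ('a, 'n, 'l) state
    \<Rightarrow> ((real^'l) \<times> (real^'l)) \<Rightarrow>\<^sub>L (real^'l)" where
  "block_jac i H = Blinfun (block_out i) o\<^sub>L H o\<^sub>L Blinfun (block_embed i)"

lemma block_jac_apply: "blinfun_apply (block_jac i H) z = block_out i (blinfun_apply H (block_embed i z))"
  by (simp add: block_jac_def bounded_linear_Blinfun_apply bounded_linear_block_out bounded_linear_block_embed)

lemma bounded_linear_block_jac: "bounded_linear (block_jac i)"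
  unfolding block_jac_def[abs_def]
  by (rule bounded_linear_compose[OF
        bounded_bilinear.bounded_linear_left[OF bounded_bilinear_blinfun_compose]
        bounded_bilinear.bounded_linear_right[OF bounded_bilinear_blinfun_compose]])

lemma sys_F_eq:
  "sys_F A B C D l S x = (A *v fst x + B *v fst (snd x) + l,
     transpose B *v fst x + C *v fst (snd x) + D *v snd (snd x),
     \<chi> p. S (fst p) (block_in (fst p) x) $ snd p)"
  by (cases x) (simp add: sys_F_def block_in_def)

lemma block_out_sys_F [simp]: "block_out i (sys_F A B C D l S x) = S i (block_in i x)"
  by (simp add: sys_F_eq block_out_def vec_eq_iff)

text \<open>Differentiability of \<open>S i\<close> is a conclusion here: on the affine slice
  through \<open>x\<close> along which only block \<open>i\<close> varies, output block
  \<open>i\<close> of the system is \<open>S i\<close> itself.\<close>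

lemma sys_F_block_has_derivative:
  fixes x :: "('a::finite, 'n::finite, 'l::finite) state"
  assumes "(sys_F A B C D l S has_derivative blinfun_apply H) (at x)"
  shows "(S i has_derivative blinfun_apply (block_jac i H)) (at (block_in i x))"
proof -
  let ?F = "sys_F A B C D l S"
  interpret E: bounded_linear "block_embed i :: _ \<Rightarrow> ('a, 'n, 'l) state" by (rule bounded_linear_block_embed)
  interpret P: bounded_linear "block_in i :: ('a, 'n, 'l) state \<Rightarrow> _" by (rule bounded_linear_block_in)
  have "((\<lambda>z. x + block_embed i (z - block_in i x)) has_derivative block_embed i) (at (block_in i x))"
    by (auto intro!: derivative_eq_intros E.has_derivative)
  from has_derivative_compose[OF this, of ?F] assms
  have "((\<lambda>z. ?F (x + block_embed i (z - block_in i x))) has_derivative (\<lambda>z. blinfun_apply H (block_embed i z)))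
      (at (block_in i x))" by (simp add: E.zero)
  from bounded_linear.has_derivative[OF bounded_linear_block_out this, of i]
  show ?thesis by (simp add: P.add block_jac_apply[abs_def])
qed

text \<open>The last clause contains both the zero block and block diagonality: output block
  \<open>i\<close> depends on \<open>v\<close> only through \<open>block_in i v\<close>. Expressed
  through values on vectors, the condition is visibly closed and convex in \<open>H\<close>.\<close>

definition jac_form where
  "jac_form A B C D H \<longleftrightarrow> (\<forall>v.
     fst (blinfun_apply H v) = A *v fst v + B *v fst (snd v) \<and>
     fst (snd (blinfun_apply H v)) = transpose B *v fst v + C *v fst (snd v) + D *v snd (snd v) \<and>
     (\<forall>i. block_out i (blinfun_apply H v) = blinfun_apply (block_jac i H) (block_in i v)))"

lemma has_derivative_mult_vec:
  fixes A :: "real^'n^'m"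
  assumes "(f has_derivative f') F"
  shows "((\<lambda>x. A *v f x) has_derivative (\<lambda>x. A *v f' x)) F"
  using assms by (rule bounded_linear.has_derivative[OF matrix_vector_mul_bounded_linear])

lemma sys_F_derivative_jac_form:
  assumes D: "(sys_F A B C Dg l S has_derivative blinfun_apply H) (at x)"
  shows "jac_form A B C Dg H"
proof -
  let ?F = "sys_F A B C Dg l S"
  have 1: "((\<lambda>x. fst (?F x)) has_derivative (\<lambda>v. fst (blinfun_apply H v))) (at x)"
    using D by (rule has_derivative_fst)
  have "((\<lambda>x. fst (?F x)) has_derivative (\<lambda>v. A *v fst v + B *v fst (snd v))) (at x)"
    unfolding sys_F_eq fst_conv
    by (auto intro!: derivative_eq_intros has_derivative_mult_vec)
  note e1 = has_derivative_unique[OF 1 this]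
  have 2: "((\<lambda>x. fst (snd (?F x))) has_derivative (\<lambda>v. fst (snd (blinfun_apply H v)))) (at x)"
    using D by (intro has_derivative_fst has_derivative_snd)
  have "((\<lambda>x. fst (snd (?F x))) has_derivative
      (\<lambda>v. transpose B *v fst v + C *v fst (snd v) + Dg *v snd (snd v))) (at x)"
    unfolding sys_F_eq fst_conv snd_conv
    by (auto intro!: derivative_eq_intros has_derivative_mult_vec simp del: transpose_matrix_vector)
  note e2 = has_derivative_unique[OF 2 this]
  have e3: "(\<lambda>v. block_out i (blinfun_apply H v)) = (\<lambda>v. blinfun_apply (block_jac i H) (block_in i v))" for i
  proof -
    have 3: "((\<lambda>x. block_out i (?F x)) has_derivative (\<lambda>v. block_out i (blinfun_apply H v))) (at x)"
      using D by (rule bounded_linear.has_derivative[OF bounded_linear_block_out])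
    have "((\<lambda>x. S i (block_in i x)) has_derivative (\<lambda>v. blinfun_apply (block_jac i H) (block_in i v))) (at x)"
      by (rule has_derivative_compose[OF bounded_linear_imp_has_derivative[OF bounded_linear_block_in]])
        (rule sys_F_block_has_derivative[OF D])
    then show ?thesis using has_derivative_unique[OF 3] by simp
  qed
  show ?thesis unfolding jac_form_def using fun_cong[OF e1] fun_cong[OF e2] fun_cong[OF e3] by simp
qed

lemma clarke_jac_sys_F_form:
  fixes x :: "('a::finite, 'n::finite, 'l::finite) state"
  assumes "H \<in> clarke_jac (sys_F A B C D l S) x"
  shows "jac_form A B C D H"
proof -
  let ?T = "{H. jac_form A B C D H}"
  have bl: "bounded_linear (\<lambda>H. blinfun_apply (block_jac i H) z)" for i z
    by (rule bounded_linear_compose[OF blinfun.bounded_linear_left bounded_linear_block_jac])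
  note cont = bounded_linear.continuous_on[OF bounded_linear_block_out]
     bounded_linear.continuous_on[OF bl] continuous_on_id
  have "closed ?T"
    unfolding jac_form_def
    by (intro closed_Collect_all closed_Collect_conj closed_Collect_eq continuous_intros cont)
  moreover have "convex ?T"
  proof (rule convexI)
    fix H1 H2 :: "('a, 'n, 'l) state \<Rightarrow>\<^sub>L ('a, 'n, 'l) state" and u v :: real
    assume H: "H1 \<in> ?T" "H2 \<in> ?T" and uv: "0 \<le> u" "0 \<le> v" "u + v = 1"
    \<comment> \<open>The entries \<open>A\<close>, \<open>B\<close>, \<open>C\<close>,
      \<open>D\<close> are the same for every \<open>H\<close>, so the condition is affine in
      \<open>H\<close> and uses that the weights sum to 1.\<close>
    have comb: "u *\<^sub>R y + v *\<^sub>R y = y" for y :: "'z::real_vector"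
      using uv by (simp flip: scaleR_add_left)
    have jac: "block_jac i (u *\<^sub>R H1 + v *\<^sub>R H2) = u *\<^sub>R block_jac i H1 + v *\<^sub>R block_jac i H2" for i
      by (simp add: linear_add linear_scale bounded_linear.linear[OF bounded_linear_block_jac])
    have out: "block_out i (u *\<^sub>R y + v *\<^sub>R z) = u *\<^sub>R block_out i y + v *\<^sub>R block_out i z"
      for i and y z :: "('a, 'n, 'l) state"
      by (simp add: linear_add linear_scale bounded_linear.linear[OF bounded_linear_block_out])
    show "u *\<^sub>R H1 + v *\<^sub>R H2 \<in> ?T"
      using H by (simp add: jac_form_def blinfun.add_left blinfun.scaleR_left jac out comb)
  qed
  ultimately show ?thesis
    using clarke_jac_subset_closed_convex[of ?T "sys_F A B C D l S" x] sys_F_derivative_jac_form assms by blast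
qed

text \<open>Semismoothness is assumed of each \<open>S i\<close>, whereas the method picks elements
  for the whole system; this brings the choice back to the blocks.\<close>

lemma block_jac_in_clarke_jac:
  assumes "H \<in> clarke_jac (sys_F A B C D l S) x"
  shows "block_jac i H \<in> clarke_jac (S i) (block_in i x)"
proof -
  let ?T = "block_jac i -` clarke_jac (S i) (block_in i x)"
  have "clarke_jac (sys_F A B C D l S) x \<subseteq> ?T"
    unfolding clarke_jac_eq_hull[of "sys_F A B C D l S"]
  proof (rule hull_minimal)
    show "convex ?T"
      by (intro convex_linear_vimage bounded_linear.linear[OF bounded_linear_block_jac])
        (simp add: clarke_jac_eq_hull convex_convex_hull)
    show "deriv_limits (sys_F A B C D l S) x \<subseteq> ?T"
    proof
      fix V assume "V \<in> deriv_limits (sys_F A B C D l S) x"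
      then obtain y Df where y: "y \<longlonglongrightarrow> x"
        and Df: "\<And>n. (sys_F A B C D l S has_derivative blinfun_apply (Df n)) (at (y n))" and V: "Df \<longlonglongrightarrow> V"
        by (auto simp: deriv_limits_def)
      have "block_jac i V \<in> deriv_limits (S i) (block_in i x)"
        unfolding deriv_limits_def mem_Collect_eq
        by (intro exI[of _ "\<lambda>n. block_in i (y n)"] exI[of _ "\<lambda>n. block_jac i (Df n)"] conjI allI
            bounded_linear.tendsto[OF bounded_linear_block_in y]
            bounded_linear.tendsto[OF bounded_linear_block_jac V] sys_F_block_has_derivative[OF Df])
      then show "V \<in> ?T" by (simp add: clarke_jac_eq_hull hull_inc)
    qed
  qed
  with assms show ?thesis by blast
qed

section \<open>Lipschitz and residual estimates for the system\<close>

lemma norm_blk_le: "norm (blk v i) \<le> norm v"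
proof -
  have "(\<Sum>j\<in>UNIV. (norm (v $ (i, j)))\<^sup>2) = (\<Sum>p\<in>Pair i ` UNIV. (norm (v $ p))\<^sup>2)"
    by (subst sum.reindex) (auto simp: inj_on_def)
  also have "\<dots> \<le> (\<Sum>p\<in>UNIV. (norm (v $ p))\<^sup>2)"
    by (rule sum_mono2) auto
  finally show ?thesis by (simp add: norm_vec_def L2_set_def)
qed

lemma norm_block_in_le: "norm (block_in i x) \<le> norm x"
proof -
  have "norm (block_in i x) \<le> norm (snd x)"
    using norm_blk_le[of "fst (snd x)" i] norm_blk_le[of "snd (snd x)" i]
    by (auto simp: block_in_def norm_prod_def intro!: real_sqrt_le_mono add_mono power_mono)
  also have "\<dots> \<le> norm x" by (simp add: norm_prod_def)
  finally show ?thesis .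
qed

text \<open>A crude bound through the sum of the absolute values of all entries. The dimension
  factor is a fixed constant and affects no rate.\<close>

lemma norm_block_vec_le:
  fixes r :: "'n::finite \<Rightarrow> real^'l::finite"
  assumes "\<And>i. norm (r i) \<le> m"
  shows "norm (\<chi> p. r (fst p) $ snd p) \<le> real CARD('n \<times> 'l) * m"
proof -
  have "norm (\<chi> p. r (fst p) $ snd p) \<le> (\<Sum>p\<in>UNIV. \<bar>r (fst p) $ snd p\<bar>)"
    using norm_le_l1_cart[of "\<chi> p. r (fst p) $ snd p"] by simp
  also have "\<dots> \<le> (\<Sum>p\<in>(UNIV :: ('n \<times> 'l) set). m)"
    using assms by (intro sum_mono) (meson component_le_norm_cart order_trans)
  finally show ?thesis by simp
qed

lemma jac_formD:
  assumes "jac_form A B C D H"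
  shows "fst (blinfun_apply H v) = A *v fst v + B *v fst (snd v)"
    and "fst (snd (blinfun_apply H v)) = transpose B *v fst v + C *v fst (snd v) + D *v snd (snd v)"
    and "snd (snd (blinfun_apply H v)) $ p = blinfun_apply (block_jac (fst p) H) (block_in (fst p) v) $ snd p"
    and "block_out i (blinfun_apply H v) = blinfun_apply (block_jac i H) (block_in i v)"
proof -
  show "fst (blinfun_apply H v) = A *v fst v + B *v fst (snd v)"
    "fst (snd (blinfun_apply H v)) = transpose B *v fst v + C *v fst (snd v) + D *v snd (snd v)"
    and out: "block_out i (blinfun_apply H v) = blinfun_apply (block_jac i H) (block_in i v)" for i
    using assms unfolding jac_form_def by blast+
  have "snd (snd (blinfun_apply H v)) $ p = block_out (fst p) (blinfun_apply H v) $ snd p"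
    by (simp add: block_out_def)
  then show "snd (snd (blinfun_apply H v)) $ p = blinfun_apply (block_jac (fst p) H) (block_in (fst p) v) $ snd p"
    by (simp only: out)
qed

lemma norm_triple_le: "norm (a, b, c) \<le> norm (a, b) + norm c"
  using norm_triangle_ineq[of "(a, b, 0)" "(0, 0, c)"] by (simp add: norm_Pair)

text \<open>The first two rows of the system are affine with the coefficients of \<open>H\<close>,
  so there the residual cancels exactly.\<close>

lemma sys_F_residual:
  assumes "jac_form A B C D H"
  shows "sys_F A B C D l S y - sys_F A B C D l S x - blinfun_apply H (y - x)
    = (0, 0, \<chi> p. (S (fst p) (block_in (fst p) y) - S (fst p) (block_in (fst p) x)
        - blinfun_apply (block_jac (fst p) H) (block_in (fst p) (y - x))) $ snd p)"
  by (simp add: prod_eq_iff sys_F_eq jac_formD[OF assms] vec_eq_iff matrix_vector_mult_diff_distrib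
      del: transpose_matrix_vector)

lemma sys_F_residual_norm_le:
  fixes x :: "('a::finite, 'n::finite, 'l::finite) state"
  assumes "jac_form A B C D H"
    and "\<And>i. norm (S i (block_in i y) - S i (block_in i x) - blinfun_apply (block_jac i H) (block_in i (y - x))) \<le> m"
  shows "norm (sys_F A B C D l S y - sys_F A B C D l S x - blinfun_apply H (y - x)) \<le> real CARD('n \<times> 'l) * m"
  unfolding sys_F_residual[OF assms(1)] norm_Pair norm_zero
  using norm_block_vec_le[OF assms(2)] by simp

lemma locally_lipschitz_near_sys_F:
  fixes x :: "('a::finite, 'n::finite, 'l::finite) state"
  assumes S: "\<And>i. locally_lipschitz_near (S i) (block_in i x)"
  shows "locally_lipschitz_near (sys_F A B C D l S) x"
proof -
  have "\<exists>e K. 0 < e \<and> (\<forall>y\<in>ball (block_in i x) e. \<forall>z\<in>ball (block_in i x) e. norm (S i y - S i z) \<le> K * norm (y - z))" for i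
    using S[of i] unfolding locally_lipschitz_near_def by blast
  then obtain e K where e: "\<And>i. 0 < e i" and K: "\<And>i y z. y \<in> ball (block_in i x) (e i) \<Longrightarrow>
      z \<in> ball (block_in i x) (e i) \<Longrightarrow> norm (S i y - S i z) \<le> K i * norm (y - z)"
    by metis
  define r where "r = Min (range e)"
  have r: "0 < r" "\<And>i. r \<le> e i" using e by (auto simp: r_def)
  define k where "k = (\<Sum>i\<in>UNIV. \<bar>K i\<bar>)"
  let ?lin = "\<lambda>v::('a, 'n, 'l) state. (A *v fst v + B *v fst (snd v),
      transpose B *v fst v + C *v fst (snd v) + D *v snd (snd v))"
  have "bounded_linear ?lin"
    unfolding linear_conv_bounded_linear[symmetric]
    by (rule linearI) (simp_all add: matrix_vector_right_distrib matrix_vector_mult_scaleR scaleR_add_right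
        del: transpose_matrix_vector)
  from bounded_linear.bounded[OF this] obtain a where a: "\<forall>v. norm (?lin v) \<le> norm v * a"
    by (elim exE)
  have "norm (sys_F A B C D l S y - sys_F A B C D l S z) \<le> (a + real CARD('n \<times> 'l) * k) * norm (y - z)"
    if "y \<in> ball x r" "z \<in> ball x r" for y z
  proof -
    have blk: "block_in i y - block_in i z = block_in i (y - z)" for i and y z :: "('a, 'n, 'l) state"
      by (simp add: linear_diff bounded_linear.linear[OF bounded_linear_block_in])
    have inb: "block_in i y \<in> ball (block_in i x) (e i)" if "y \<in> ball x r" for i and y
      using norm_block_in_le[of i "x - y"] that r(2)[of i] by (simp add: dist_norm blk)
    have Si: "norm (S i (block_in i y) - S i (block_in i z)) \<le> k * norm (y - z)" for i
    proof -
      have "norm (S i (block_in i y) - S i (block_in i z)) \<le> K i * norm (block_in i (y - z))"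
        using K[OF inb inb, of y z] that by (simp add: blk)
      also have "\<dots> \<le> \<bar>K i\<bar> * norm (y - z)"
        by (intro mult_mono norm_block_in_le) auto
      also have "\<dots> \<le> k * norm (y - z)"
        unfolding k_def by (intro mult_right_mono member_le_sum) auto
      finally show ?thesis .
    qed
    have eq: "sys_F A B C D l S y - sys_F A B C D l S z
        = (fst (?lin (y - z)), snd (?lin (y - z)), \<chi> p. (S (fst p) (block_in (fst p) y) - S (fst p) (block_in (fst p) z)) $ snd p)"
      by (simp add: prod_eq_iff sys_F_eq vec_eq_iff matrix_vector_mult_diff_distrib del: transpose_matrix_vector)
    have "norm (sys_F A B C D l S y - sys_F A B C D l S z) \<le> norm (?lin (y - z))
        + norm (\<chi> p. (S (fst p) (block_in (fst p) y) - S (fst p) (block_in (fst p) z)) $ snd p)"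
      unfolding eq using norm_triple_le[of "fst (?lin (y - z))" "snd (?lin (y - z))"] by (simp only: prod.collapse)
    with spec[OF a, of "y - z"] norm_block_vec_le[of "\<lambda>i. S i (block_in i y) - S i (block_in i z)", OF Si]
    have "norm (sys_F A B C D l S y - sys_F A B C D l S z)
        \<le> norm (y - z) * a + real CARD('n \<times> 'l) * (k * norm (y - z))"
      by linarith
    then show ?thesis by (simp add: algebra_simps)
  qed
  then show ?thesis
    unfolding locally_lipschitz_near_def using r(1)
    by (intro exI[of _ r] exI[of _ "a + real CARD('n \<times> 'l) * k"] conjI ballI)
qed

section \<open>Invertibility at and near the solution\<close>

lemma unblk_axis [simp]: "unblk i (axis k 1) = axis (i, k) 1"
  by (auto simp: unblk_def axis_def vec_eq_iff)

lemma unblk_0 [simp]: "unblk i 0 = 0"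
  by (simp add: unblk_def vec_eq_iff)

text \<open>Connects the Jacobian as a linear map with the matrices about which eigencomplementarity
  speaks.\<close>

lemma block_jac_eq_Xblk_Yblk:
  "blinfun_apply (block_jac i H) (u, w) = Xblk H i *v u + Yblk H i *v w"
proof -
  let ?J = "blinfun_apply (block_jac i H)"
  have lin: "linear (\<lambda>u. ?J (u, 0))" "linear (\<lambda>w. ?J (0, w))"
    by (rule linearI; simp flip: blinfun.add_right blinfun.scaleR_right)+
  have "Xblk H i = matrix (\<lambda>u. ?J (u, 0))" "Yblk H i = matrix (\<lambda>w. ?J (0, w))"
    by (simp_all add: Xblk_def Yblk_def matrix_def vec_eq_iff block_jac_apply block_embed_def block_out_def)
  then have "Xblk H i *v u = ?J (u, 0)" "Yblk H i *v w = ?J (0, w)"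
    using lin by (simp_all add: matrix_works)
  then show ?thesis by (simp flip: blinfun.add_right)
qed

lemma diag_blocks_mult_nth [simp]: "(diag_blocks d *v c) $ p = d (fst p) * c $ p"
  by (simp add: matrix_vector_mult_def diag_blocks_def if_distrib[of "\<lambda>x. x * _"] cong: if_cong)

text \<open>The coupling matrix is scalar on each block, so its form splits into blockwise inner
  products, whose signs are what \<open>eigencomplementary_kernel\<close> provides.\<close>

lemma inner_diag_blocks:
  "b \<bullet> (diag_blocks d *v c) = (\<Sum>i\<in>UNIV. d i * (blk b i \<bullet> blk c i))"
proof -
  have "b \<bullet> (diag_blocks d *v c) = (\<Sum>p\<in>UNIV \<times> UNIV. d (fst p) * (b $ p * c $ p))"
    by (simp add: inner_vec_def mult_ac)
  also have "\<dots> = (\<Sum>i\<in>UNIV. \<Sum>j\<in>UNIV. d i * (b $ (i, j) * c $ (i, j)))"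
    by (simp add: sum.cartesian_product case_prod_beta)
  finally show ?thesis by (simp add: inner_vec_def sum_distrib_left)
qed

text \<open>Complementarity of the blocks makes the coupling term \<open>b \<bullet> D c\<close> nonnegative on the kernel,
  while positive definiteness of the coupled matrix forces it to be negative unless the kernel is trivial.\<close>

lemma jac_form_injective:
  fixes v :: "('a::finite, 'n::finite, 'l::finite) state"
  assumes pd: "\<forall>a b. (a, b) \<noteq> 0 \<longrightarrow> 0 < a \<bullet> (A *v a + B *v b) + b \<bullet> (transpose B *v a + C *v b)"
    and d: "\<forall>i. 0 < d i" and form: "jac_form A B C (diag_blocks d) H"
    and ec: "\<And>i. eigencomplementary (Xblk H i) (Yblk H i)" and ker: "blinfun_apply H v = 0"
  shows "v = 0"
proof -
  obtain a b c where v: "v = (a, b, c)" by (cases v)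
  have 1: "A *v a + B *v b = 0"
    and 2: "transpose B *v a + C *v b = - (diag_blocks d *v c)"
    and 3: "Xblk H i *v blk b i + Yblk H i *v blk c i = 0" for i
  proof -
    note f = jac_formD(1,2)[OF form, where v=v, unfolded ker]
    show "A *v a + B *v b = 0" using f(1) by (simp add: v)
    show "transpose B *v a + C *v b = - (diag_blocks d *v c)"
      using f(2) by (simp add: v eq_neg_iff_add_eq_0 del: transpose_matrix_vector)
    have "block_out i (0 :: ('a, 'n, 'l) state) = 0"
      by (rule linear_0[OF bounded_linear.linear[OF bounded_linear_block_out]])
    then show "Xblk H i *v blk b i + Yblk H i *v blk c i = 0"
      using jac_formD(4)[OF form, where v=v and i=i] unfolding ker
      by (simp add: v block_in_def block_jac_eq_Xblk_Yblk)
  qed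
  have "0 \<le> b \<bullet> (diag_blocks d *v c)"
    unfolding inner_diag_blocks
    using d eigencomplementary_kernel[OF ec 3] by (intro sum_nonneg mult_nonneg_nonneg) (auto simp: less_imp_le)
  then have "\<not> 0 < a \<bullet> (A *v a + B *v b) + b \<bullet> (transpose B *v a + C *v b)"
    unfolding 1 2 by simp
  then have ab: "a = 0" "b = 0" using pd by (auto simp: zero_prod_def)
  have "diag_blocks d *v c = 0" using 2 by (simp add: ab del: transpose_matrix_vector)
  then have "d (fst p) * c $ p = 0" for p by (metis diag_blocks_mult_nth zero_index)
  then have "c = 0" using d by (simp add: vec_eq_iff) (metis less_irrefl)
  then show ?thesis by (simp add: v ab zero_prod_def)
qed

text \<open>Compactness of convex hulls is available for Euclidean spaces only, and the type of bounded
  linear maps is not an instance. The blocks live in a Euclidean space and determine the Jacobian.\<close>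

lemma clarke_jac_sys_F_bounded_below:
  fixes x :: "('a::finite, 'n::finite, 'l::finite) state" and D :: "real^('n \<times> 'l)^('n \<times> 'l)"
  assumes lip: "locally_lipschitz_near (sys_F A B C D l S) x"
    and inj: "\<And>H v. H \<in> clarke_jac (sys_F A B C D l S) x \<Longrightarrow> blinfun_apply H v = 0 \<Longrightarrow> v = 0"
  shows "\<exists>c>0. \<forall>H \<in> clarke_jac (sys_F A B C D l S) x. \<forall>v. c * norm v \<le> norm (blinfun_apply H v)"
proof (cases "clarke_jac (sys_F A B C D l S) x = {}")
  case False
  let ?F = "sys_F A B C D l S"
  define \<Phi> :: "('a, 'n, 'l) state \<Rightarrow>\<^sub>L ('a, 'n, 'l) state \<Rightarrow> ((real^'l^'l) \<times> (real^'l^'l))^'n"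
    where "\<Phi> H = (\<chi> i. (Xblk H i, Yblk H i))" for H
  have lin: "linear \<Phi>"
    by (rule linearI) (simp_all add: \<Phi>_def Xblk_def Yblk_def vec_eq_iff blinfun.add_left blinfun.scaleR_left)
  have cont: "continuous_on UNIV \<Phi>"
    unfolding \<Phi>_def[abs_def] Xblk_def Yblk_def by (intro continuous_intros)
  \<comment> \<open>\<open>N W v\<close> rebuilds the value of a Jacobian at \<open>v\<close> from
    its blocks \<open>W\<close>, so its norm becomes a continuous function of a pair of Euclidean
    variables.\<close>
  define N :: "((real^'l^'l) \<times> (real^'l^'l))^'n \<Rightarrow> ('a, 'n, 'l) state \<Rightarrow> ('a, 'n, 'l) state"
    where "N W v = (A *v fst v + B *v fst (snd v),
      transpose B *v fst v + C *v fst (snd v) + D *v snd (snd v),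
      \<chi> p. (fst (W $ fst p) *v blk (fst (snd v)) (fst p) + snd (W $ fst p) *v blk (snd (snd v)) (fst p)) $ snd p)" for W v
  have N: "blinfun_apply H v = N (\<Phi> H) v" if "H \<in> clarke_jac ?F x" for H v
  proof -
    note form = clarke_jac_sys_F_form[OF that]
    show ?thesis
      by (simp add: prod_eq_iff N_def jac_formD[OF form] vec_eq_iff block_in_def block_jac_eq_Xblk_Yblk \<Phi>_def
          del: transpose_matrix_vector)
  qed
  define P where "P = \<Phi> ` clarke_jac ?F x"
  \<comment> \<open>Linear images commute with convex hulls, so \<open>P\<close> is the hull of a
    compact set in a Euclidean space.\<close>
  have "P = convex hull (\<Phi> ` deriv_limits ?F x)"
    unfolding P_def clarke_jac_eq_hull by (rule convex_hull_linear_image[OF lin])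
  then have "compact P"
    using compact_continuous_image[OF continuous_on_subset[OF cont] compact_deriv_limits[OF lip]]
    by (simp add: compact_convex_hull)
  then have "compact (P \<times> sphere (0 :: ('a, 'n, 'l) state) 1)" by (rule compact_Times) simp
  moreover have "P \<times> sphere (0 :: ('a, 'n, 'l) state) 1 \<noteq> {}"
    using False by (simp add: P_def)
  moreover have "continuous_on (P \<times> sphere (0 :: ('a, 'n, 'l) state) 1) (\<lambda>(W, v). norm (N W v))"
    unfolding N_def matrix_vector_mult_def case_prod_beta blk_def transpose_def
    by (intro continuous_intros)
  ultimately obtain q where q: "q \<in> P \<times> sphere 0 1"
    and least: "\<And>q'. q' \<in> P \<times> sphere 0 1 \<Longrightarrow> (case q of (W, v) \<Rightarrow> norm (N W v)) \<le> (case q' of (W, v) \<Rightarrow> norm (N W v))"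
    using continuous_attains_inf by (metis (no_types, lifting))
  obtain H0 v0 where H0: "H0 \<in> clarke_jac ?F x" "norm v0 = 1" "q = (\<Phi> H0, v0)"
    using q by (auto simp: P_def)
  \<comment> \<open>The minimum is attained at an actual Clarke element and a unit vector, so
    injectivity makes it positive.\<close>
  define c where "c = norm (blinfun_apply H0 v0)"
  have "0 < c" using inj[OF H0(1), of v0] H0(2) by (auto simp: c_def)
  moreover have "c * norm v \<le> norm (blinfun_apply H v)" if H: "H \<in> clarke_jac ?F x" for H v
  proof (cases "v = 0")
    case False
    have "(\<Phi> H, (1 / norm v) *\<^sub>R v) \<in> P \<times> sphere 0 1" using H False by (simp add: P_def)
    from least[OF this] have "c \<le> norm (blinfun_apply H ((1 / norm v) *\<^sub>R v))"
      by (simp add: c_def H0(3) N[OF H] N[OF H0(1)])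
    then show ?thesis using False by (simp add: blinfun.scaleR_right pos_le_divide_eq)
  qed simp
  ultimately show ?thesis by blast
qed (auto intro: exI[of _ 1])

text \<open>A perturbation of operator norm at most \<open>c / 2\<close> takes away at most half of
  the lower bound.\<close>

lemma clarke_jac_bounded_below_near:
  fixes G :: "'a::euclidean_space \<Rightarrow> 'b::euclidean_space"
  assumes lip: "locally_lipschitz_near G x" and c: "0 < c"
    and below: "\<And>H v. H \<in> clarke_jac G x \<Longrightarrow> c * norm v \<le> norm (blinfun_apply H v)"
  shows "\<exists>\<delta>>0. \<forall>y \<in> ball x \<delta>. \<forall>H \<in> clarke_jac G y. \<forall>v. c / 2 * norm v \<le> norm (blinfun_apply H v)"
proof -
  obtain \<delta> where \<delta>: "0 < \<delta>"
    and near: "\<And>y H. y \<in> ball x \<delta> \<Longrightarrow> H \<in> clarke_jac G y \<Longrightarrow> \<exists>V \<in> clarke_jac G x. norm (H - V) \<le> c / 2"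
    using clarke_jac_upper_semicontinuous[OF lip, of "c / 2"] c by auto
  have "c / 2 * norm v \<le> norm (blinfun_apply H v)" if H: "y \<in> ball x \<delta>" "H \<in> clarke_jac G y" for y H v
  proof -
    obtain V where V: "V \<in> clarke_jac G x" "norm (H - V) \<le> c / 2" using near[OF H] by blast
    have "norm (blinfun_apply (H - V) v) \<le> c / 2 * norm v"
      using norm_blinfun[of "H - V" v] mult_right_mono[OF V(2), of "norm v"] by simp
    moreover have "norm (blinfun_apply V v) \<le> norm (blinfun_apply H v) + norm (blinfun_apply (H - V) v)"
      using norm_triangle_ineq4[of "blinfun_apply H v" "blinfun_apply (H - V) v"] by (simp add: blinfun.diff_left)
    ultimately show ?thesis using below[OF V(1), of v] by simp
  qed
  then show ?thesis using \<delta> by blast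
qed

text \<open>\<open>g\<close> stands for either rate, a multiple of the distance or of its power.
  Monotonicity is for passing from the norm of a block of \<open>y - x\<close> to the norm of
  \<open>y - x\<close>.\<close>

lemma sys_F_residual_near:
  fixes x :: "('a::finite, 'n::finite, 'l::finite) state"
  assumes mono: "mono_on {0..} g"
    and S: "\<And>i. \<exists>\<delta>>0. \<forall>h V. norm h < \<delta> \<and> V \<in> clarke_jac (S i) (block_in i x + h) \<longrightarrow>
      norm (S i (block_in i x + h) - S i (block_in i x) - blinfun_apply V h) \<le> g (norm h)"
  shows "\<exists>\<delta>>0. \<forall>y \<in> ball x \<delta>. \<forall>H \<in> clarke_jac (sys_F A B C D l S) y.
    norm (sys_F A B C D l S y - sys_F A B C D l S x - blinfun_apply H (y - x)) \<le> real CARD('n \<times> 'l) * g (norm (y - x))"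
proof -
  obtain e where e: "\<And>i. 0 < e i"
    and est: "\<And>i h V. norm h < e i \<Longrightarrow> V \<in> clarke_jac (S i) (block_in i x + h) \<Longrightarrow>
      norm (S i (block_in i x + h) - S i (block_in i x) - blinfun_apply V h) \<le> g (norm h)"
    using S by metis
  define \<delta> where "\<delta> = Min (range e)"
  have \<delta>: "0 < \<delta>" "\<And>i. \<delta> \<le> e i" using e by (auto simp: \<delta>_def)
  have "norm (sys_F A B C D l S y - sys_F A B C D l S x - blinfun_apply H (y - x)) \<le> real CARD('n \<times> 'l) * g (norm (y - x))"
    if y: "y \<in> ball x \<delta>" and H: "H \<in> clarke_jac (sys_F A B C D l S) y" for y H
  proof (rule sys_F_residual_norm_le[OF clarke_jac_sys_F_form[OF H]])
    fix i
    have eq: "block_in i x + block_in i (y - x) = block_in i y"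
      by (simp add: linear_diff bounded_linear.linear[OF bounded_linear_block_in])
    have "norm (block_in i (y - x)) < e i"
      using norm_block_in_le[of i "y - x"] y \<delta>(2)[of i] by (simp add: dist_norm norm_minus_commute)
    from est[OF this, unfolded eq, OF block_jac_in_clarke_jac[OF H]]
    have "norm (S i (block_in i y) - S i (block_in i x) - blinfun_apply (block_jac i H) (block_in i (y - x)))
        \<le> g (norm (block_in i (y - x)))" .
    also have "\<dots> \<le> g (norm (y - x))"
      by (rule mono_onD[OF mono]) (auto intro: norm_block_in_le)
    finally show "norm (S i (block_in i y) - S i (block_in i x) - blinfun_apply (block_jac i H) (block_in i (y - x)))
        \<le> g (norm (y - x))" .
  qed
  then show ?thesis using \<delta>(1) by blast
qed

text \<open>Invertibility refers to every element that can be chosen after finitely many completed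
  steps, convergence to all infinite runs. The neighbourhood \<open>U\<close> is fixed before
  \<alpha>.\<close>

theorem theorem3p2:
  fixes A :: "real^('d::finite \<times> 'm::finite)^('d \<times> 'm)"
    and B :: "real^('n::finite \<times> 'l::finite)^('d \<times> 'm)"
    and C :: "real^('n \<times> 'l)^('n \<times> 'l)"
    and Dv :: "'n \<Rightarrow> real"
    and l :: "real^('d \<times> 'm)"
    and S :: "'n \<Rightarrow> ((real^'l) \<times> (real^'l)) \<Rightarrow> real^'l"
    and xs :: "(real^('d \<times> 'm)) \<times> (real^('n \<times> 'l)) \<times> (real^('n \<times> 'l))"
  defines "F \<equiv> sys_F A B C (diag_blocks Dv) l S"
  assumes d: "CARD('d) \<in> {2, 3}"
    and A_pd: "sym_pos_def A" and C_pd: "sym_pos_def C"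
    and ABC_pd: "\<forall>a b. (a, b) \<noteq> 0 \<longrightarrow>
                   0 < a \<bullet> (A *v a + B *v b) + b \<bullet> (transpose B *v a + C *v b)"
    and D_pos: "\<forall>i. Dv i > 0"
    and S_ss: "\<forall>i z. semismooth_at (S i) z"
    and sol: "F xs = 0"
    and eigc: "\<forall>H \<in> clarke_jac F xs. \<forall>i. eigencomplementary (Xblk H i) (Yblk H i)"
  shows "\<exists>U. open U \<and> xs \<in> U \<and>
    (\<forall>x0\<in>U. \<forall>Hs x n. x 0 = x0 \<and>
        (\<forall>k<n. Hs k \<in> clarke_jac F (x k) \<and> blinfun_apply (Hs k) (x (Suc k) - x k) = - F (x k)) \<and>
        Hs n \<in> clarke_jac F (x n)
      \<longrightarrow> bij (blinfun_apply (Hs n))) \<and>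
    (\<forall>x0\<in>U. \<forall>Hs x. x 0 = x0 \<and>
        (\<forall>k. Hs k \<in> clarke_jac F (x k) \<and> blinfun_apply (Hs k) (x (Suc k) - x k) = - F (x k))
      \<longrightarrow> x \<longlonglongrightarrow> xs \<and>
          (\<forall>\<epsilon>>0. \<forall>\<^sub>F k in sequentially. norm (x (Suc k) - xs) \<le> \<epsilon> * norm (x k - xs))) \<and>
    (\<forall>\<alpha>. 0 < \<alpha> \<and> \<alpha> \<le> 1 \<and> (\<forall>i z. semismooth_order_at \<alpha> (S i) z) \<longrightarrow>
      (\<forall>x0\<in>U. \<forall>Hs x. x 0 = x0 \<and>
        (\<forall>k. Hs k \<in> clarke_jac F (x k) \<and> blinfun_apply (Hs k) (x (Suc k) - x k) = - F (x k))
      \<longrightarrow> (\<exists>K. \<forall>\<^sub>F k in sequentially. norm (x (Suc k) - xs) \<le> K * norm (x k - xs) powr (1 + \<alpha>))))"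
proof -
  have S_lip: "locally_lipschitz_near (S i) z" for i z
    using S_ss[rule_format, of i z] by (simp add: semismooth_at_def)
  have lip: "locally_lipschitz_near F xs"
    unfolding F_def by (rule locally_lipschitz_near_sys_F[OF S_lip])
  have inj: "v = 0" if "H \<in> clarke_jac F xs" "blinfun_apply H v = 0" for H v
    using jac_form_injective[OF ABC_pd D_pos clarke_jac_sys_F_form[OF that(1)[unfolded F_def]] _ that(2)] eigc that(1)
    by blast
  obtain c where c: "0 < c"
    and below: "\<And>H v. H \<in> clarke_jac F xs \<Longrightarrow> c * norm v \<le> norm (blinfun_apply H v)"
    using clarke_jac_sys_F_bounded_below[OF lip[unfolded F_def]] inj unfolding F_def by metis
  obtain \<delta>0 where \<delta>0: "0 < \<delta>0"
    and inv: "\<forall>y \<in> ball xs \<delta>0. \<forall>H \<in> clarke_jac F y. \<forall>v. c / 2 * norm v \<le> norm (blinfun_apply H v)"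
    using clarke_jac_bounded_below_near[OF lip c below] by metis
  let ?N = "real CARD('n \<times> 'l)"
  have res: "\<forall>\<epsilon>>0. \<exists>\<delta>>0. \<forall>y \<in> ball xs \<delta>. \<forall>H \<in> clarke_jac F y. norm (F y - blinfun_apply H (y - xs)) \<le> \<epsilon> * norm (y - xs)"
  proof (intro allI impI)
    fix \<epsilon> :: real assume "0 < \<epsilon>"
    \<comment> \<open>Offsets the dimension factor in \<open>sys_F_residual_near\<close>.\<close>
    then have \<epsilon>: "0 < \<epsilon> / ?N" by simp
    have "mono_on {0..} (\<lambda>t. \<epsilon> / ?N * t)"
      using \<epsilon> by (intro mono_onI mult_left_mono) auto
    moreover have "\<exists>\<delta>>0. \<forall>h V. norm h < \<delta> \<and> V \<in> clarke_jac (S i) (block_in i xs + h) \<longrightarrow>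
        norm (S i (block_in i xs + h) - S i (block_in i xs) - blinfun_apply V h) \<le> \<epsilon> / ?N * norm h" for i
      by (rule semismooth_residual[OF _ \<epsilon>]) (use S_ss in blast)
    ultimately have "\<exists>\<delta>>0. \<forall>y \<in> ball xs \<delta>. \<forall>H \<in> clarke_jac F y.
        norm (F y - F xs - blinfun_apply H (y - xs)) \<le> ?N * (\<epsilon> / ?N * norm (y - xs))"
      unfolding F_def by (rule sys_F_residual_near)
    then show "\<exists>\<delta>>0. \<forall>y \<in> ball xs \<delta>. \<forall>H \<in> clarke_jac F y.
        norm (F y - blinfun_apply H (y - xs)) \<le> \<epsilon> * norm (y - xs)"
      by (simp add: sol)
  qed
  from newton_local_convergence[OF sol half_gt_zero[OF c] \<delta>0 inv res]
  obtain U where U: "open U" "xs \<in> U"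
    and bij: "(\<forall>Hs x n. x 0 \<in> U \<and>
        (\<forall>k<n. Hs k \<in> clarke_jac F (x k) \<and> blinfun_apply (Hs k) (x (Suc k) - x k) = - F (x k)) \<and>
        Hs n \<in> clarke_jac F (x n) \<longrightarrow> bij (blinfun_apply (Hs n)))"
    and superlinear: "(\<forall>Hs x. x 0 \<in> U \<and>
        (\<forall>k. Hs k \<in> clarke_jac F (x k) \<and> blinfun_apply (Hs k) (x (Suc k) - x k) = - F (x k)) \<longrightarrow>
        x \<longlonglongrightarrow> xs \<and> (\<forall>\<epsilon>>0. \<forall>\<^sub>F k in sequentially. norm (x (Suc k) - xs) \<le> \<epsilon> * norm (x k - xs)))"
    and ord: "(\<forall>Hs x \<alpha> C \<delta>. x 0 \<in> U \<and>
        (\<forall>k. Hs k \<in> clarke_jac F (x k) \<and> blinfun_apply (Hs k) (x (Suc k) - x k) = - F (x k)) \<and>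
        0 < \<delta> \<and> (\<forall>y \<in> ball xs \<delta>. \<forall>H \<in> clarke_jac F y. norm (F y - blinfun_apply H (y - xs)) \<le> C * norm (y - xs) powr (1 + \<alpha>)) \<longrightarrow>
        (\<exists>K. \<forall>\<^sub>F k in sequentially. norm (x (Suc k) - xs) \<le> K * norm (x k - xs) powr (1 + \<alpha>)))"
    by (elim exE conjE)
  have order: "\<exists>C \<delta>. 0 < \<delta> \<and> (\<forall>y \<in> ball xs \<delta>. \<forall>H \<in> clarke_jac F y.
      norm (F y - blinfun_apply H (y - xs)) \<le> C * norm (y - xs) powr (1 + \<alpha>))"
    if \<alpha>: "0 < \<alpha>" and ord: "\<forall>i z. semismooth_order_at \<alpha> (S i) z" for \<alpha>
  proof -
    have "\<exists>C \<delta>. 0 < \<delta> \<and> (\<forall>h V. norm h < \<delta> \<and> V \<in> clarke_jac (S i) (block_in i xs + h) \<longrightarrow>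
        norm (S i (block_in i xs + h) - S i (block_in i xs) - blinfun_apply V h) \<le> C * norm h powr (1 + \<alpha>))" for i
      using semismooth_order_residual[OF ord[rule_format] \<alpha>] .
    then obtain \<kappa> where \<kappa>: "\<And>i. \<exists>\<delta>>0. \<forall>h V. norm h < \<delta> \<and> V \<in> clarke_jac (S i) (block_in i xs + h) \<longrightarrow>
        norm (S i (block_in i xs + h) - S i (block_in i xs) - blinfun_apply V h) \<le> \<kappa> i * norm h powr (1 + \<alpha>)"
      by metis
    \<comment> \<open>The constants differ from block to block. A sum of absolute values dominates
      them all and is nonnegative, as monotonicity of the rate requires.\<close>
    define k where "k = (\<Sum>i\<in>UNIV. \<bar>\<kappa> i\<bar>)"
    have k0: "0 \<le> k" by (simp add: k_def sum_nonneg)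
    have "\<kappa> i \<le> k" for i
      using member_le_sum[of i UNIV "\<lambda>i. \<bar>\<kappa> i\<bar>"] by (simp add: k_def)
    then have \<kappa>k: "\<kappa> i * norm h powr (1 + \<alpha>) \<le> k * norm h powr (1 + \<alpha>)" for i and h :: "(real^'l) \<times> (real^'l)"
      by (intro mult_right_mono) auto
    have "mono_on {0..} (\<lambda>t. k * t powr (1 + \<alpha>))"
      using k0 \<alpha> by (intro mono_onI mult_left_mono powr_mono2) auto
    moreover have "\<exists>\<delta>>0. \<forall>h V. norm h < \<delta> \<and> V \<in> clarke_jac (S i) (block_in i xs + h) \<longrightarrow>
        norm (S i (block_in i xs + h) - S i (block_in i xs) - blinfun_apply V h) \<le> k * norm h powr (1 + \<alpha>)" for i
      using \<kappa>[of i] \<kappa>k[of i] by (meson order_trans)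
    ultimately have "\<exists>\<delta>>0. \<forall>y \<in> ball xs \<delta>. \<forall>H \<in> clarke_jac F y.
        norm (F y - F xs - blinfun_apply H (y - xs)) \<le> ?N * (k * norm (y - xs) powr (1 + \<alpha>))"
      unfolding F_def by (rule sys_F_residual_near)
    then show ?thesis unfolding sol diff_zero mult.assoc[symmetric] by blast
  qed
  show ?thesis
  proof (intro exI[of _ U] conjI U)
    show "\<forall>x0\<in>U. \<forall>Hs x n. x 0 = x0 \<and>
        (\<forall>k<n. Hs k \<in> clarke_jac F (x k) \<and> blinfun_apply (Hs k) (x (Suc k) - x k) = - F (x k)) \<and>
        Hs n \<in> clarke_jac F (x n) \<longrightarrow> bij (blinfun_apply (Hs n))"
    proof (intro ballI allI impI)
      fix x0 Hs x n
      assume "x0 \<in> U" and "x 0 = x0 \<and>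
        (\<forall>k<n. Hs k \<in> clarke_jac F (x k) \<and> blinfun_apply (Hs k) (x (Suc k) - x k) = - F (x k)) \<and>
        Hs n \<in> clarke_jac F (x n)"
      then show "bij (blinfun_apply (Hs n))"
        by (intro bij[THEN spec[where x=Hs], THEN spec[where x=x], THEN spec[where x=n], THEN mp]) simp
    qed
    show "\<forall>x0\<in>U. \<forall>Hs x. x 0 = x0 \<and>
        (\<forall>k. Hs k \<in> clarke_jac F (x k) \<and> blinfun_apply (Hs k) (x (Suc k) - x k) = - F (x k)) \<longrightarrow>
        x \<longlonglongrightarrow> xs \<and> (\<forall>\<epsilon>>0. \<forall>\<^sub>F k in sequentially. norm (x (Suc k) - xs) \<le> \<epsilon> * norm (x k - xs))"
    proof (intro ballI allI impI)
      fix x0 Hs x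
      assume "x0 \<in> U" and "x 0 = x0 \<and>
        (\<forall>k. Hs k \<in> clarke_jac F (x k) \<and> blinfun_apply (Hs k) (x (Suc k) - x k) = - F (x k))"
      then show "x \<longlonglongrightarrow> xs \<and> (\<forall>\<epsilon>>0. \<forall>\<^sub>F k in sequentially. norm (x (Suc k) - xs) \<le> \<epsilon> * norm (x k - xs))"
        by (intro superlinear[THEN spec[where x=Hs], THEN spec[where x=x], THEN mp]) simp
    qed
    show "\<forall>\<alpha>. 0 < \<alpha> \<and> \<alpha> \<le> 1 \<and> (\<forall>i z. semismooth_order_at \<alpha> (S i) z) \<longrightarrow>
      (\<forall>x0\<in>U. \<forall>Hs x. x 0 = x0 \<and>
        (\<forall>k. Hs k \<in> clarke_jac F (x k) \<and> blinfun_apply (Hs k) (x (Suc k) - x k) = - F (x k)) \<longrightarrow>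
        (\<exists>K. \<forall>\<^sub>F k in sequentially. norm (x (Suc k) - xs) \<le> K * norm (x k - xs) powr (1 + \<alpha>)))"
    proof (intro allI ballI impI; elim conjE)
      fix \<alpha> x0 Hs x
      assume \<alpha>: "0 < \<alpha>" "\<forall>i z. semismooth_order_at \<alpha> (S i) z" and x0: "x0 \<in> U" "x 0 = x0"
        and it: "\<forall>k. Hs k \<in> clarke_jac F (x k) \<and> blinfun_apply (Hs k) (x (Suc k) - x k) = - F (x k)"
      obtain C \<delta> where C: "0 < \<delta>" "\<forall>y \<in> ball xs \<delta>. \<forall>H \<in> clarke_jac F y.
          norm (F y - blinfun_apply H (y - xs)) \<le> C * norm (y - xs) powr (1 + \<alpha>)"
        using order[OF \<alpha>] by blast
      have "x 0 \<in> U" using x0 by simp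
      with it C
      show "\<exists>K. \<forall>\<^sub>F k in sequentially. norm (x (Suc k) - xs) \<le> K * norm (x k - xs) powr (1 + \<alpha>)"
        by (intro ord[THEN spec[where x=Hs], THEN spec[where x=x], THEN spec[where x=\<alpha>], THEN spec[where x=C], THEN spec[where x=\<delta>], THEN mp] conjI)
    qed
  qed
qed

end
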